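(* The $(\min,-)$ convolution (and symmetrically the $(\max,-)$ convolution) of two vectors of length $n$ can be computed in $O(n^2/\lg n)$ time on a real RAM.
   Context: For vectors $\vec x=\langle x_0,\dots,x_{n-1}\rangle$, $\vec y=\langle y_0,\dots,y_{n-1}\rangle$ of reals, the $(\min,-)$ convolution has $k$th entry $\min_{i=0}^{k}(x_i-y_{k-i})$ and the $(\max,-)$ convolution has $k$th entry $\max_{i=0}^{k}(x_i-y_{k-i})$, $k=0,\dots,n-1$. The real RAM is the model with unit-cost arithmetic operations and comparisons on real numbers. *)

theory Defs
  imports Complex_Main
begin

definition min_minus_conv :: "(nat \<Rightarrow> real) \<Rightarrow> (nat \<Rightarrow> real) \<Rightarrow> nat \<Rightarrow> real" where
  "min_minus_conv x y k = Min ((\<lambda>i. x i - y (k - i)) ` {0..k})"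

definition max_minus_conv :: "(nat \<Rightarrow> real) \<Rightarrow> (nat \<Rightarrow> real) \<Rightarrow> nat \<Rightarrow> real" where
  "max_minus_conv x y k = Max ((\<lambda>i. x i - y (k - i)) ` {0..k})"

text \<open>Real registers R (unit-cost arithmetic and comparisons on reals), integer
  (word) registers I with unit-cost integer arithmetic and indirect addressing.
  Word values are required (in the theorem) to stay polynomially bounded in n,
  i.e. word size O(lg n). Reals cannot be converted to integers (no floor).\<close>

datatype instr =
    RFromI nat nat
  | RAdd nat nat nat
  | RSub nat nat nat
  | RMul nat nat nat
  | RDiv nat nat nat
  | RLoad nat nat
  | RStore nat nat
  | IConst nat int
  | IAdd nat nat nat
  | ISub nat nat nat
  | IMul nat nat nat
  | IDiv nat nat nat
  | IMod nat nat nat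
  | ILoad nat nat
  | IStore nat nat
  | JmpRLess nat nat nat
  | JmpILess nat nat nat
  | Jmp nat

record config =
  pc :: nat
  rr :: "nat \<Rightarrow> real"
  ir :: "nat \<Rightarrow> int"

fun exec :: "instr \<Rightarrow> config \<Rightarrow> config" where
  "exec (RFromI d s) c = c\<lparr>pc := Suc (pc c), rr := (rr c)(d := real_of_int (ir c s))\<rparr>"
| "exec (RAdd d a b) c = c\<lparr>pc := Suc (pc c), rr := (rr c)(d := rr c a + rr c b)\<rparr>"
| "exec (RSub d a b) c = c\<lparr>pc := Suc (pc c), rr := (rr c)(d := rr c a - rr c b)\<rparr>"
| "exec (RMul d a b) c = c\<lparr>pc := Suc (pc c), rr := (rr c)(d := rr c a * rr c b)\<rparr>"
| "exec (RDiv d a b) c = c\<lparr>pc := Suc (pc c), rr := (rr c)(d := rr c a / rr c b)\<rparr>"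
| "exec (RLoad d a) c = c\<lparr>pc := Suc (pc c), rr := (rr c)(d := rr c (nat (ir c a)))\<rparr>"
| "exec (RStore a s) c = c\<lparr>pc := Suc (pc c), rr := (rr c)(nat (ir c a) := rr c s)\<rparr>"
| "exec (IConst d k) c = c\<lparr>pc := Suc (pc c), ir := (ir c)(d := k)\<rparr>"
| "exec (IAdd d a b) c = c\<lparr>pc := Suc (pc c), ir := (ir c)(d := ir c a + ir c b)\<rparr>"
| "exec (ISub d a b) c = c\<lparr>pc := Suc (pc c), ir := (ir c)(d := ir c a - ir c b)\<rparr>"
| "exec (IMul d a b) c = c\<lparr>pc := Suc (pc c), ir := (ir c)(d := ir c a * ir c b)\<rparr>"
| "exec (IDiv d a b) c = c\<lparr>pc := Suc (pc c), ir := (ir c)(d := ir c a div ir c b)\<rparr>"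
| "exec (IMod d a b) c = c\<lparr>pc := Suc (pc c), ir := (ir c)(d := ir c a mod ir c b)\<rparr>"
| "exec (ILoad d a) c = c\<lparr>pc := Suc (pc c), ir := (ir c)(d := ir c (nat (ir c a)))\<rparr>"
| "exec (IStore a s) c = c\<lparr>pc := Suc (pc c), ir := (ir c)(nat (ir c a) := ir c s)\<rparr>"
| "exec (JmpRLess a b t) c = c\<lparr>pc := (if rr c a < rr c b then t else Suc (pc c))\<rparr>"
| "exec (JmpILess a b t) c = c\<lparr>pc := (if ir c a < ir c b then t else Suc (pc c))\<rparr>"
| "exec (Jmp t) c = c\<lparr>pc := t\<rparr>"

definition halted :: "instr list \<Rightarrow> config \<Rightarrow> bool" where
  "halted P c \<longleftrightarrow> length P \<le> pc c"

definition step :: "instr list \<Rightarrow> config \<Rightarrow> config" where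
  "step P c = (if halted P c then c else exec (P ! pc c) c)"

definition run :: "instr list \<Rightarrow> nat \<Rightarrow> config \<Rightarrow> config" where
  "run P t c = (step P ^^ t) c"

definition init :: "nat \<Rightarrow> (nat \<Rightarrow> real) \<Rightarrow> (nat \<Rightarrow> real) \<Rightarrow> config" where
  "init n x y = \<lparr>pc = 0,
     rr = (\<lambda>i. if i < n then x i else if i < 2 * n then y (i - n) else 0),
     ir = (\<lambda>r. if r = 0 then int n else 0)\<rparr>"

definition computes_in_n2_over_lg :: "instr list \<Rightarrow>
    ((nat \<Rightarrow> real) \<Rightarrow> (nat \<Rightarrow> real) \<Rightarrow> nat \<Rightarrow> real) \<Rightarrow> bool" where
  "computes_in_n2_over_lg P F \<longleftrightarrow>
     (\<exists>N0 C (e::nat). \<forall>n\<ge>N0. \<forall>x y. \<exists>t.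
        real t \<le> C * real n ^ 2 / log 2 (real n) \<and>
        halted P (run P t (init n x y)) \<and>
        (\<forall>k<n. rr (run P t (init n x y)) k = F x y k) \<and>
        (\<forall>s\<le>t. \<forall>r. \<bar>ir (run P s (init n x y)) r\<bar> \<le> (int n + 2) ^ e))"

end

theory Submission
  imports Defs
begin

text \<open>
  Put \<open>d = \<Theta>(lg n)\<close> and cut \<open>x\<close> into blocks of \<open>d\<close> entries. For a block starting at \<open>e\<close> and a shift \<open>j\<close>,
  the block contributes \<open>min\<^sub>a (x\<^sub>e\<^sub>+\<^sub>a - y\<^sub>j\<^sub>-\<^sub>a)\<close> to the output entry \<open>e + j\<close>; there are \<open>O(n\<^sup>2/d)\<close> such pairs, so
  constant amortized time per pair is enough. The index \<open>a\<close> attains the minimum iff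
  \<open>x\<^sub>e\<^sub>+\<^sub>a - x\<^sub>e\<^sub>+\<^sub>c \<le> y\<^sub>j\<^sub>-\<^sub>a - y\<^sub>j\<^sub>-\<^sub>c\<close> for all \<open>c < d\<close>, which is a \<open>d\<close>-dimensional dominance test between a
  point depending on \<open>e\<close> and one depending on \<open>j\<close> (Fredman's trick). Following Chan, the dominated points
  are enumerated with a search tree: for a group of \<open>16^d\<close> blocks and a fixed \<open>a\<close>, a node splits its blocks
  at the median of the last remaining coordinate. If \<open>j\<close> passes the median, the lower half needs that
  coordinate no more and the upper half stays open; otherwise only the lower half survives. A query visits
  \<open>O(2^d (3/2)^(4d))\<close> nodes, which is \<open>O(16^d/d)\<close>, and ties are broken so that each pair is reported
  for exactly one \<open>a\<close>, apart from one block per visited leaf. Boundary terms are handled by brute force.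
\<close>

section \<open>A while language on the RAM\<close>

text \<open>The time budget dictates the design. For one group and one shift there are
  \<open>d\<close> candidates, hence \<open>d\<close> tree queries, and since
  \<open>G * S * d\<close> is at most \<open>n\<close>, they may cost only \<open>O(S)\<close>
  together. Reports cannot be bounded query by query, because a single query may report all
  \<open>S\<close> blocks; but an index passing all tests is the least minimiser, so the
  \<open>d\<close> reported sets are disjoint and their sizes add up to at most \<open>S\<close>.
  Visits are bounded query by query: a passed test opens two subtrees, but one of them has lost a
  coordinate, and the weight \<open>2^D * (3/2)^l\<close> for \<open>D\<close> open coordinates and
  \<open>l\<close> remaining levels is preserved because \<open>2^(D-1) + 2^D = (3/2) * 2^D\<close>.
  With \<open>l = 4 * d\<close> this is \<open>(162/16)^d\<close>, which leaves room for the factor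
  \<open>d\<close> below \<open>16^d\<close>. Storing the lower half twice makes the tree ternary,
  with \<open>81^d\<close> leaves; its construction is paid for because all \<open>n\<close> shifts
  share it. The claim asks for one fixed instruction list and for bounded registers at every step.
  Hence the small language below counts machine steps exactly and constrains every intermediate
  value.\<close>

datatype binop = Plus | Minus | Times | Quot

datatype expr = C int | Vr nat | Ar nat expr | Bin binop expr expr

abbreviation "Add \<equiv> Bin Plus"
abbreviation "Sub \<equiv> Bin Minus"
abbreviation "Mul \<equiv> Bin Times"
abbreviation "Dv \<equiv> Bin Quot"

fun apply_op :: "binop \<Rightarrow> int \<Rightarrow> int \<Rightarrow> int" where
  "apply_op Plus i j = i + j"
| "apply_op Minus i j = i - j"
| "apply_op Times i j = i * j"
| "apply_op Quot i j = i div j"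

fun op_instr :: "binop \<Rightarrow> nat \<Rightarrow> nat \<Rightarrow> nat \<Rightarrow> instr" where
  "op_instr Plus = IAdd"
| "op_instr Minus = ISub"
| "op_instr Times = IMul"
| "op_instr Quot = IDiv"

lemma exec_op_instr: "exec (op_instr f d x y) c =
    c\<lparr>pc := Suc (pc c), ir := (ir c)(d := apply_op f (ir c x) (ir c y))\<rparr>"
  by (cases f) auto

text \<open>
  Variables \<open>iv\<close> live in the word registers below 32, temporaries in 32 to 63, and cell \<open>i\<close> of the word array
  \<open>k < 8\<close> in register \<open>64 + 8 * i + k\<close>. The real registers \<open>rm\<close> are not abstracted: the first four serve as
  scratch registers.
\<close>

record st =
  iv :: "nat \<Rightarrow> int"
  ia :: "nat \<Rightarrow> nat \<Rightarrow> int"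
  rm :: "nat \<Rightarrow> real"

fun aval :: "expr \<Rightarrow> st \<Rightarrow> int" where
  "aval (C k) s = k"
| "aval (Vr r) s = iv s r"
| "aval (Ar k e) s = ia s k (nat (aval e s))"
| "aval (Bin g e f) s = apply_op g (aval e s) (aval f s)"

text \<open>A variable carries no condition because \<open>vals_bounded\<close> is kept for all
  states. An index must be nonnegative since \<open>nat\<close> would send all negative ones to cell
  0. Subexpressions are constrained too, because their values also sit in registers.\<close>

fun in_range :: "int \<Rightarrow> expr \<Rightarrow> st \<Rightarrow> bool" where
  "in_range b (C k) s \<longleftrightarrow> \<bar>k\<bar> \<le> b"
| "in_range b (Vr r) s \<longleftrightarrow> True"
| "in_range b (Ar k e) s \<longleftrightarrow> in_range b e s \<and> 0 \<le> aval e s"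
| "in_range b (Bin g e f) s \<longleftrightarrow> in_range b e s \<and> in_range b f s \<and> \<bar>apply_op g (aval e s) (aval f s)\<bar> \<le> b"

text \<open>The machine has no move between word registers, so a variable is added to zero. The
  value ends up in register \<open>d\<close>, and a right operand works from \<open>Suc d\<close>
  upwards, which leaves the left one intact.\<close>

fun comp_expr :: "nat \<Rightarrow> expr \<Rightarrow> instr list" where
  "comp_expr d (C k) = [IConst d k]"
| "comp_expr d (Vr r) = [IConst d 0, IAdd d d r]"
| "comp_expr d (Ar k e) = comp_expr d e @ [IConst (Suc d) 8, IMul d d (Suc d),
     IConst (Suc d) (64 + int k), IAdd d d (Suc d), ILoad d d]"
| "comp_expr d (Bin g e f) = comp_expr d e @ comp_expr (Suc d) f @ [op_instr g d d (Suc d)]"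

fun elen :: "expr \<Rightarrow> nat" where
  "elen (C k) = 1"
| "elen (Vr r) = 2"
| "elen (Ar k e) = elen e + 5"
| "elen (Bin g e f) = elen e + elen f + 1"

lemma length_comp_expr [simp]: "length (comp_expr d e) = elen e"
  by (induction e arbitrary: d) auto

text \<open>The bound 63 leaves room for the auxiliary register \<open>Suc d\<close> of an array
  access; from 64 on the registers hold the arrays.\<close>

fun wf_expr :: "nat \<Rightarrow> expr \<Rightarrow> bool" where
  "wf_expr d (C k) \<longleftrightarrow> d < 63"
| "wf_expr d (Vr r) \<longleftrightarrow> d < 63 \<and> r < 32"
| "wf_expr d (Ar k e) \<longleftrightarrow> k < 8 \<and> wf_expr d e"
| "wf_expr d (Bin g e f) \<longleftrightarrow> wf_expr d e \<and> wf_expr (Suc d) f"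

datatype com =
    Asg nat expr
  | ASt nat expr expr
  | RLd nat expr
  | RSt expr nat
  | RSb nat nat nat
  | RMl nat nat nat
  | RFI nat expr
  | Seq com com (infixr ";;" 60)
  | If expr expr com com
  | IfR nat nat com com
  | While expr expr com
  | Skip

fun com_len :: "com \<Rightarrow> nat" where
  "com_len (Asg r e) = elen e + 2"
| "com_len (ASt k e f) = elen e + 4 + elen f + 1"
| "com_len (RLd d e) = elen e + 1"
| "com_len (RSt e r) = elen e + 1"
| "com_len (RSb d a b) = 1"
| "com_len (RMl d a b) = 1"
| "com_len (RFI d e) = elen e + 1"
| "com_len (Seq c1 c2) = com_len c1 + com_len c2"
| "com_len (If e f c1 c2) = elen e + elen f + 1 + com_len c2 + 1 + com_len c1"
| "com_len (IfR a b c1 c2) = 1 + com_len c2 + 1 + com_len c1"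
| "com_len (While e f c) = elen e + elen f + 2 + com_len c + 1"
| "com_len Skip = 0"

text \<open>Jump targets are absolute, hence the start address \<open>p\<close> and the separate
  length function. A conditional jump falls through when its test fails, so the else branch is laid
  out first and ends with a jump over the then branch.\<close>

fun comp :: "nat \<Rightarrow> com \<Rightarrow> instr list" where
  "comp p (Asg r e) = comp_expr 32 e @ [IConst 33 0, IAdd r 32 33]"
| "comp p (ASt k e f) = comp_expr 32 e @ [IConst 33 8, IMul 32 32 33, IConst 33 (64 + int k), IAdd 32 32 33]
     @ comp_expr 33 f @ [IStore 32 33]"
| "comp p (RLd d e) = comp_expr 32 e @ [RLoad d 32]"
| "comp p (RSt e r) = comp_expr 32 e @ [RStore 32 r]"
| "comp p (RSb d a b) = [RSub d a b]"
| "comp p (RMl d a b) = [RMul d a b]"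
| "comp p (RFI d e) = comp_expr 32 e @ [RFromI d 32]"
| "comp p (Seq c1 c2) = comp p c1 @ comp (p + com_len c1) c2"
| "comp p (If e f c1 c2) = (let q = p + elen e + elen f + 1; r = q + com_len c2 + 1 in
     comp_expr 32 e @ comp_expr 33 f @ [JmpILess 32 33 r] @ comp q c2 @ [Jmp (r + com_len c1)] @ comp r c1)"
| "comp p (IfR a b c1 c2) = (let q = p + 1; r = q + com_len c2 + 1 in
     [JmpRLess a b r] @ comp q c2 @ [Jmp (r + com_len c1)] @ comp r c1)"
| "comp p (While e f c) = (let q = p + elen e + elen f + 2 in
     comp_expr 32 e @ comp_expr 33 f @ [JmpILess 32 33 q] @ [Jmp (q + com_len c + 1)] @ comp q c @ [Jmp p])"
| "comp p Skip = []"

lemma length_comp [simp]: "length (comp p c) = com_len c"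
  by (induction c arbitrary: p) (auto simp: Let_def)

fun wf_com :: "com \<Rightarrow> bool" where
  "wf_com (Asg r e) \<longleftrightarrow> r < 32 \<and> wf_expr 32 e"
| "wf_com (ASt k e f) \<longleftrightarrow> k < 8 \<and> wf_expr 32 e \<and> wf_expr 33 f"
| "wf_com (RLd d e) \<longleftrightarrow> wf_expr 32 e"
| "wf_com (RSt e r) \<longleftrightarrow> wf_expr 32 e"
| "wf_com (RSb d a b) \<longleftrightarrow> True"
| "wf_com (RMl d a b) \<longleftrightarrow> True"
| "wf_com (RFI d e) \<longleftrightarrow> wf_expr 32 e"
| "wf_com (Seq c1 c2) \<longleftrightarrow> wf_com c1 \<and> wf_com c2"
| "wf_com (If e f c1 c2) \<longleftrightarrow> wf_expr 32 e \<and> wf_expr 33 f \<and> wf_com c1 \<and> wf_com c2"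
| "wf_com (IfR a b c1 c2) \<longleftrightarrow> wf_com c1 \<and> wf_com c2"
| "wf_com (While e f c) \<longleftrightarrow> wf_expr 32 e \<and> wf_expr 33 f \<and> wf_com c"
| "wf_com Skip \<longleftrightarrow> True"

text \<open>The step counts are those of the compiled code, exactly; a failed test costs one step
  more because of the jump that closes the else branch. A statement that leaves the range
  \<open>b\<close> has no derivation, so the existence of a run already contains the bound on
  words.\<close>

inductive big_step :: "int \<Rightarrow> com \<Rightarrow> st \<Rightarrow> nat \<Rightarrow> st \<Rightarrow> bool" for b where
  Asg: "in_range b e s \<Longrightarrow> big_step b (Asg r e) s (elen e + 2) (s\<lparr>iv := (iv s)(r := aval e s)\<rparr>)"
| ASt: "\<lbrakk>in_range b e s; in_range b f s; 0 \<le> aval e s\<rbrakk> \<Longrightarrow> big_step b (ASt k e f) s (elen e + elen f + 5)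
     (s\<lparr>ia := (ia s)(k := (ia s k)(nat (aval e s) := aval f s))\<rparr>)"
| RLd: "in_range b e s \<Longrightarrow> big_step b (RLd d e) s (elen e + 1) (s\<lparr>rm := (rm s)(d := rm s (nat (aval e s)))\<rparr>)"
| RSt: "in_range b e s \<Longrightarrow> big_step b (RSt e r) s (elen e + 1) (s\<lparr>rm := (rm s)(nat (aval e s) := rm s r)\<rparr>)"
| RSb: "big_step b (RSb d x y) s 1 (s\<lparr>rm := (rm s)(d := rm s x - rm s y)\<rparr>)"
| RMl: "big_step b (RMl d x y) s 1 (s\<lparr>rm := (rm s)(d := rm s x * rm s y)\<rparr>)"
| RFI: "in_range b e s \<Longrightarrow> big_step b (RFI d e) s (elen e + 1) (s\<lparr>rm := (rm s)(d := real_of_int (aval e s))\<rparr>)"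
| Seq: "\<lbrakk>big_step b c1 s t1 s1; big_step b c2 s1 t2 s2\<rbrakk> \<Longrightarrow> big_step b (Seq c1 c2) s (t1 + t2) s2"
| If1: "\<lbrakk>in_range b e s; in_range b f s; aval e s < aval f s; big_step b c1 s t s'\<rbrakk>
     \<Longrightarrow> big_step b (If e f c1 c2) s (elen e + elen f + 1 + t) s'"
| If2: "\<lbrakk>in_range b e s; in_range b f s; \<not> aval e s < aval f s; big_step b c2 s t s'\<rbrakk>
     \<Longrightarrow> big_step b (If e f c1 c2) s (elen e + elen f + 2 + t) s'"
| IfR1: "\<lbrakk>rm s x < rm s y; big_step b c1 s t s'\<rbrakk> \<Longrightarrow> big_step b (IfR x y c1 c2) s (1 + t) s'"
| IfR2: "\<lbrakk>\<not> rm s x < rm s y; big_step b c2 s t s'\<rbrakk> \<Longrightarrow> big_step b (IfR x y c1 c2) s (2 + t) s'"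
| While1: "\<lbrakk>in_range b e s; in_range b f s; aval e s < aval f s; big_step b c s t1 s1; big_step b (While e f c) s1 t2 s2\<rbrakk>
     \<Longrightarrow> big_step b (While e f c) s (elen e + elen f + 2 + t1 + t2) s2"
| While2: "\<lbrakk>in_range b e s; in_range b f s; \<not> aval e s < aval f s\<rbrakk>
     \<Longrightarrow> big_step b (While e f c) s (elen e + elen f + 2) s"
| Skip: "big_step b Skip s 0 s"

section \<open>Machine configurations that simulate program states\<close>

definition regs_bounded :: "int \<Rightarrow> config \<Rightarrow> bool" where
  "regs_bounded B c \<longleftrightarrow> (\<forall>r. \<bar>ir c r\<bar> \<le> B)"

definition sim :: "st \<Rightarrow> config \<Rightarrow> bool" where
  "sim s c \<longleftrightarrow> (\<forall>r<32. ir c r = iv s r) \<and> (\<forall>k<8. \<forall>i. ir c (64 + 8 * i + k) = ia s k i) \<and> rr c = rm s"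

text \<open>The bound is demanded after every step, since the final claim restricts all intermediate
  register contents.\<close>

definition reach :: "instr list \<Rightarrow> int \<Rightarrow> config \<Rightarrow> nat \<Rightarrow> config \<Rightarrow> bool" where
  "reach P B c t c' \<longleftrightarrow> run P t c = c' \<and> (\<forall>i\<le>t. regs_bounded B (run P i c))"

lemma run_add: "run P (t1 + t2) c = run P t2 (run P t1 c)"
  unfolding run_def add.commute[of t1] by (simp add: funpow_add)

lemma reach_trans:
  assumes "reach P B c t1 c1" "reach P B c1 t2 c2"
  shows "reach P B c (t1 + t2) c2"
  unfolding reach_def
proof (intro conjI allI impI)
  show "run P (t1 + t2) c = c2" using assms by (simp add: reach_def run_add)
  fix i assume "i \<le> t1 + t2"
  show "regs_bounded B (run P i c)"
  proof (cases "i \<le> t1")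
    case False
    then obtain j where "i = t1 + j" by (metis le_Suc_ex nat_le_linear)
    then show ?thesis using assms \<open>i \<le> t1 + t2\<close> by (simp add: reach_def run_add)
  qed (use assms in \<open>auto simp: reach_def\<close>)
qed

lemma reach_refl: "regs_bounded B c \<Longrightarrow> reach P B c 0 c"
  by (simp add: reach_def run_def)

lemma reach_step:
  assumes "regs_bounded B c" "pc c < length P" "P ! pc c = i" "exec i c = c'" "regs_bounded B c'"
  shows "reach P B c 1 c'"
proof -
  have "run P (Suc 0) c = c'" using assms by (simp add: run_def step_def halted_def)
  moreover have "run P 0 c = c" by (simp add: run_def)
  ultimately show ?thesis using assms by (auto simp: reach_def le_Suc_eq)
qed

definition codeat :: "instr list \<Rightarrow> nat \<Rightarrow> instr list \<Rightarrow> bool" where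
  "codeat P p l \<longleftrightarrow> (\<exists>u v. P = u @ l @ v \<and> length u = p)"

lemma codeat_append [simp]: "codeat P p (l1 @ l2) \<longleftrightarrow> codeat P p l1 \<and> codeat P (p + length l1) l2"
proof
  assume "codeat P p (l1 @ l2)"
  then obtain u v where uv: "P = u @ (l1 @ l2) @ v" "length u = p" unfolding codeat_def by blast
  have "codeat P p l1" unfolding codeat_def
    by (intro exI[of _ u] exI[of _ "l2 @ v"]) (simp add: uv)
  moreover have "codeat P (p + length l1) l2" unfolding codeat_def
    by (intro exI[of _ "u @ l1"] exI[of _ v]) (simp add: uv)
  ultimately show "codeat P p l1 \<and> codeat P (p + length l1) l2" ..
next
  assume "codeat P p l1 \<and> codeat P (p + length l1) l2"
  then obtain u v u' v' where a: "P = u @ l1 @ v" "length u = p" "P = u' @ l2 @ v'" "length u' = p + length l1"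
    unfolding codeat_def by blast
  have "u' = take (length u') P" using a(3) by simp
  also have "\<dots> = u @ l1" by (simp add: a(1) a(4) a(2)[symmetric])
  finally have "P = u @ (l1 @ l2) @ v'" using a(3) by simp
  then show "codeat P p (l1 @ l2)" using a(2) unfolding codeat_def by blast
qed

text \<open>Two instructions are required in front: on a one-element list the rewriting would
  reproduce its own left-hand side.\<close>

lemma codeat_Cons [simp]: "codeat P p (i # j # l) \<longleftrightarrow> codeat P p [i] \<and> codeat P (Suc p) (j # l)"
  using codeat_append[of P p "[i]" "j # l"] by simp

lemma codeat_single: "codeat P p [i] \<Longrightarrow> p < length P \<and> P ! p = i"
  by (auto simp: codeat_def)

lemma reach_at:
  assumes "codeat P p [i]" "pc c = p" "regs_bounded B c" "regs_bounded B (exec i c)"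
  shows "reach P B c 1 (exec i c)"
  using assms codeat_single reach_step by blast

text \<open>Only the temporaries from \<open>d\<close> to 63 may change. Evaluating a right operand
  from register 33 on therefore preserves the left one in 32, and \<open>sim\<close>
  survives.\<close>

definition keep :: "nat \<Rightarrow> config \<Rightarrow> config \<Rightarrow> bool" where
  "keep d c c' \<longleftrightarrow> rr c' = rr c \<and> (\<forall>r. r < d \<or> 64 \<le> r \<longrightarrow> ir c' r = ir c r)"

lemma keep_sim: "keep d c c' \<Longrightarrow> 32 \<le> d \<Longrightarrow> sim s c \<Longrightarrow> sim s c'"
  by (auto simp: keep_def sim_def)

lemma keep_trans: "keep d c c' \<Longrightarrow> keep d' c' c'' \<Longrightarrow> d \<le> d' \<Longrightarrow> keep d c c''"
  by (auto simp: keep_def)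

lemma regs_bounded_upd: "regs_bounded B c \<Longrightarrow> \<bar>z\<bar> \<le> B \<Longrightarrow> regs_bounded B (c\<lparr>pc := q, ir := (ir c)(d := z)\<rparr>)"
  by (auto simp: regs_bounded_def)

lemma regs_bounded_pc [simp]: "regs_bounded B (c\<lparr>pc := q\<rparr>) = regs_bounded B c" "regs_bounded B (c\<lparr>pc := q, rr := f\<rparr>) = regs_bounded B c"
  by (auto simp: regs_bounded_def)

definition vals_bounded :: "int \<Rightarrow> st \<Rightarrow> bool" where
  "vals_bounded b s \<longleftrightarrow> (\<forall>r<32. \<bar>iv s r\<bar> \<le> b) \<and> (\<forall>k<8. \<forall>i. \<bar>ia s k i\<bar> \<le> b)"

lemma aval_bound: "vals_bounded b s \<Longrightarrow> in_range b e s \<Longrightarrow> wf_expr d e \<Longrightarrow> \<bar>aval e s\<bar> \<le> b"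
  by (induction e arbitrary: d) (auto simp: vals_bounded_def)

lemma wfE_less: "wf_expr d e \<Longrightarrow> d < 63"
  by (induction e arbitrary: d) auto

section \<open>Correctness of the compiler\<close>

lemma binop_correct:
  assumes e: "\<exists>c'. reach P B c (elen e) c' \<and> keep d c c' \<and> pc c' = p + elen e \<and> ir c' d = ve"
    and f: "\<And>c. \<lbrakk>pc c = p + elen e; sim s c; regs_bounded B c\<rbrakk> \<Longrightarrow>
        \<exists>c'. reach P B c (elen f) c' \<and> keep (Suc d) c c' \<and> pc c' = p + elen e + elen f \<and> ir c' (Suc d) = vf"
    and s: "sim s c" "32 \<le> d" "d < 64"
    and at: "codeat P (p + elen e + elen f) [i]"
    and i: "\<And>c. exec i c = c\<lparr>pc := Suc (pc c), ir := (ir c)(d := g (ir c d) (ir c (Suc d)))\<rparr>"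
    and b: "\<bar>g ve vf\<bar> \<le> B"
  shows "\<exists>c'. reach P B c (Suc (elen e + elen f)) c' \<and> keep d c c' \<and> pc c' = Suc (p + elen e + elen f) \<and> ir c' d = g ve vf"
proof -
  obtain c1 where c1: "reach P B c (elen e) c1" "keep d c c1" "pc c1 = p + elen e" "ir c1 d = ve"
    using e by blast
  have "sim s c1" "regs_bounded B c1" using c1 s keep_sim by (auto simp: reach_def)
  then obtain c2 where c2: "reach P B c1 (elen f) c2" "keep (Suc d) c1 c2"
      "pc c2 = p + elen e + elen f" "ir c2 (Suc d) = vf"
    using f c1 by blast
  have d2: "ir c2 d = ve" using c2(2) c1(4) by (simp add: keep_def)
  have b2: "regs_bounded B c2" using c2 by (auto simp: reach_def)
  let ?c3 = "exec i c2"
  have "regs_bounded B ?c3" unfolding i using b2 b d2 c2 by (simp add: regs_bounded_upd)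
  then have "reach P B c2 1 ?c3" using reach_at at c2 b2 by blast
  then have "reach P B c (elen e + elen f + 1) ?c3"
    using reach_trans c1 c2 by blast
  moreover have "keep d c2 ?c3" using s by (auto simp: i keep_def)
  then have "keep d c ?c3" using keep_trans c1(2) c2(2) by (metis le_refl le_SucI)
  ultimately show ?thesis using c2 d2 by (intro exI[of _ ?c3]) (auto simp: i)
qed

text \<open>Program values are at most \<open>b\<close>, but the address of an array cell passes
  through a register as well: \<open>64 + 8 * i + k\<close> with \<open>k \<le> 7\<close> and
  \<open>i \<le> b\<close> is at most \<open>8 * b + 71\<close>.\<close>

lemma comp_expr_correct:
  assumes "codeat P p (comp_expr d e)" "pc c = p" "sim s c" "regs_bounded B c" "vals_bounded b s" "in_range b e s" "wf_expr d e"
    "32 \<le> d" "8 * b + 71 \<le> B" "0 \<le> b"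
  shows "\<exists>c'. reach P B c (elen e) c' \<and> keep d c c' \<and> pc c' = p + elen e \<and> ir c' d = aval e s"
  using assms
proof (induction e arbitrary: p d c)
  case (C k)
  then have "reach P B c 1 (exec (IConst d k) c)" by (intro reach_at) (auto intro!: regs_bounded_upd)
  then show ?case using C by (intro exI[of _ "exec (IConst d k) c"]) (auto simp: keep_def)
next
  case (Vr r)
  let ?c1 = "exec (IConst d 0) c" let ?c2 = "exec (IAdd d d r) ?c1"
  have 1: "regs_bounded B ?c1" using Vr by (auto intro!: regs_bounded_upd)
  have e2: "?c2 = ?c1\<lparr>pc := Suc (pc ?c1), ir := (ir ?c1)(d := iv s r)\<rparr>"
    using Vr by (auto simp: sim_def)
  have 2: "regs_bounded B ?c2" unfolding e2 by (rule regs_bounded_upd) (use 1 Vr in \<open>auto simp: vals_bounded_def\<close>)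
  have a: "codeat P p [IConst d 0]" "codeat P (Suc p) [IAdd d d r]"
    using Vr.prems(1) by auto
  have "reach P B c 1 ?c1" using reach_at a 1 Vr by blast
  moreover have "reach P B ?c1 1 ?c2" by (rule reach_at[OF a(2) _ 1 2]) (use Vr in simp)
  ultimately have "reach P B c (1 + 1) ?c2" by (rule reach_trans)
  then show ?case using Vr by (intro exI[of _ ?c2]) (auto simp: keep_def sim_def numeral_2_eq_2)
next
  case (Ar k e)
  let ?v = "aval e s"
  obtain c0 where c0: "reach P B c (elen e) c0" "keep d c c0" "pc c0 = p + elen e" "ir c0 d = ?v"
    using Ar.IH[of p d c] Ar.prems by auto
  have at: "codeat P (p + elen e) [IConst (Suc d) 8, IMul d d (Suc d), IConst (Suc d) (64 + int k), IAdd d d (Suc d), ILoad d d]"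
    using Ar.prems by simp
  have "\<bar>?v\<bar> \<le> b" using aval_bound Ar.prems by (metis in_range.simps(3) wf_expr.simps(3))
  then have v: "0 \<le> ?v" "?v \<le> b" using Ar.prems by auto
  have k: "k < 8" "d < 63" using Ar.prems(7) wfE_less[of d "Ar k e"] by auto
  have sim0: "sim s c0" "regs_bounded B c0" using c0 keep_sim Ar.prems by (auto simp: reach_def)
  let ?c1 = "c0\<lparr>pc := pc c0 + 1, ir := (ir c0)(Suc d := 8)\<rparr>"
  let ?c2 = "?c1\<lparr>pc := pc c0 + 2, ir := (ir ?c1)(d := ?v * 8)\<rparr>"
  let ?c3 = "?c2\<lparr>pc := pc c0 + 3, ir := (ir ?c2)(Suc d := 64 + int k)\<rparr>"
  let ?c4 = "?c3\<lparr>pc := pc c0 + 4, ir := (ir ?c3)(d := ?v * 8 + (64 + int k))\<rparr>"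
  let ?c5 = "?c4\<lparr>pc := pc c0 + 5, ir := (ir ?c4)(d := ia s k (nat ?v))\<rparr>"
  have nn: "nat (?v * 8 + (64 + int k)) = 64 + 8 * nat ?v + k" using v by simp
  have ld: "ir ?c4 (64 + 8 * nat ?v + k) = ia s k (nat ?v)"
    using sim0 k by (auto simp: sim_def)
  have bb: "\<bar>ia s k (nat ?v)\<bar> \<le> b" using Ar.prems k by (auto simp: vals_bounded_def)
  have e: "exec (IConst (Suc d) 8) c0 = ?c1" "exec (IMul d d (Suc d)) ?c1 = ?c2"
     "exec (IConst (Suc d) (64 + int k)) ?c2 = ?c3" "exec (IAdd d d (Suc d)) ?c3 = ?c4"
     "exec (ILoad d d) ?c4 = ?c5"
    using c0 ld nn by auto
  have b1: "regs_bounded B ?c1" by (rule regs_bounded_upd) (use sim0 Ar.prems in \<open>auto\<close>)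
  have b2: "regs_bounded B ?c2" by (rule regs_bounded_upd) (use b1 Ar.prems v in \<open>auto\<close>)
  have b3: "regs_bounded B ?c3" by (rule regs_bounded_upd) (use b2 Ar.prems k in \<open>auto\<close>)
  have b4: "regs_bounded B ?c4" by (rule regs_bounded_upd) (use b3 Ar.prems v k in \<open>auto\<close>)
  have b5: "regs_bounded B ?c5" by (rule regs_bounded_upd) (use b4 Ar.prems bb in \<open>auto\<close>)
  have at': "codeat P (p + elen e) [IConst (Suc d) 8]" "codeat P (p + elen e + 1) [IMul d d (Suc d)]"
    "codeat P (p + elen e + 2) [IConst (Suc d) (64 + int k)]" "codeat P (p + elen e + 3) [IAdd d d (Suc d)]" "codeat P (p + elen e + 4) [ILoad d d]"
    using at by (auto simp: numeral_eq_Suc)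
  have "reach P B c0 1 ?c1" using reach_at[OF at'(1) c0(3) sim0(2)] b1 unfolding e by blast
  moreover have "reach P B ?c1 1 ?c2" using reach_at[OF at'(2) _ b1] b2 c0(3) unfolding e by simp
  moreover have "reach P B ?c2 1 ?c3" using reach_at[OF at'(3) _ b2] b3 c0(3) unfolding e by simp
  moreover have "reach P B ?c3 1 ?c4" using reach_at[OF at'(4) _ b3] b4 c0(3) unfolding e by simp
  moreover have "reach P B ?c4 1 ?c5" using reach_at[OF at'(5) _ b4] b5 c0(3) unfolding e by simp
  ultimately have "reach P B c (elen e + (1 + (1 + (1 + (1 + 1))))) ?c5"
    using c0(1) by (meson reach_trans)
  then show ?case using c0 k by (intro exI[of _ ?c5]) (auto simp: keep_def numeral_eq_Suc)
next
  case (Bin g e f)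
  have 1: "\<exists>c'. reach P B c (elen e) c' \<and> keep d c c' \<and> pc c' = p + elen e \<and> ir c' d = aval e s"
    by (rule Bin.IH(1)) (use Bin.prems in simp_all)
  have 2: "\<exists>c'. reach P B c (elen f) c' \<and> keep (Suc d) c c' \<and> pc c' = p + elen e + elen f \<and> ir c' (Suc d) = aval f s"
    if "pc c = p + elen e" "sim s c" "regs_bounded B c" for c
    by (rule Bin.IH(2)) (use Bin.prems that in simp_all)
  have 3: "\<bar>apply_op g (aval e s) (aval f s)\<bar> \<le> B" using Bin.prems by simp
  have 4: "d < 64" using wfE_less[OF Bin.prems(7)] by simp
  have 5: "codeat P (p + elen e + elen f) [op_instr g d d (Suc d)]" using Bin.prems(1) by (simp add: add.assoc)
  show ?case
    using binop_correct[of P B c e d p "aval e s" s f "aval f s" "op_instr g d d (Suc d)" "apply_op g",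
      OF 1 2 Bin.prems(3,8) 4 5 exec_op_instr 3]
    by (simp add: add.assoc)
qed

lemma comp_expr2_correct:
  assumes "codeat P p (comp_expr 32 e)" "codeat P (p + elen e) (comp_expr 33 f)" "pc c = p" "sim s c" "regs_bounded B c" "vals_bounded b s"
    "in_range b e s" "in_range b f s" "wf_expr 32 e" "wf_expr 33 f" "8 * b + 71 \<le> B" "0 \<le> b"
  shows "\<exists>c'. reach P B c (elen e + elen f) c' \<and> sim s c' \<and> pc c' = p + elen e + elen f \<and> ir c' 32 = aval e s \<and> ir c' 33 = aval f s"
proof -
  obtain c1 where c1: "reach P B c (elen e) c1" "keep 32 c c1" "pc c1 = p + elen e" "ir c1 32 = aval e s"
    using comp_expr_correct[of P p 32 e c s B b] assms by auto
  then have s1: "sim s c1" "regs_bounded B c1" using assms keep_sim by (auto simp: reach_def)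
  then obtain c2 where c2: "reach P B c1 (elen f) c2" "keep 33 c1 c2" "pc c2 = p + elen e + elen f" "ir c2 33 = aval f s"
    using comp_expr_correct[of P "p + elen e" 33 f c1 s B b] assms c1 by auto
  have "ir c2 32 = aval e s" using c1 c2(2) by (simp add: keep_def)
  moreover have "sim s c2" by (rule keep_sim[OF c2(2) _ s1(1)]) simp
  ultimately show ?thesis using c2 reach_trans[OF c1(1) c2(1)] by blast
qed

lemma comp_expr1_correct:
  assumes "codeat P p (comp_expr 32 e)" "pc c = p" "sim s c" "regs_bounded B c" "vals_bounded b s"
    "in_range b e s" "wf_expr 32 e" "8 * b + 71 \<le> B" "0 \<le> b"
  shows "\<exists>c'. reach P B c (elen e) c' \<and> sim s c' \<and> pc c' = p + elen e \<and> ir c' 32 = aval e s \<and> regs_bounded B c'"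
  using comp_expr_correct[of P p 32 e c s B b] assms keep_sim by (fastforce simp: reach_def)

lemma regs_bounded_exec [simp]: "regs_bounded B (exec (RLoad d a) c) = regs_bounded B c" "regs_bounded B (exec (RStore a d) c) = regs_bounded B c"
  "regs_bounded B (exec (RSub d x y) c) = regs_bounded B c" "regs_bounded B (exec (RMul d x y) c) = regs_bounded B c"
  "regs_bounded B (exec (RFromI d a) c) = regs_bounded B c" "regs_bounded B (exec (JmpRLess x y t) c) = regs_bounded B c"
  "regs_bounded B (exec (JmpILess x y t) c) = regs_bounded B c" "regs_bounded B (exec (Jmp t) c) = regs_bounded B c"
  by (auto simp: regs_bounded_def)

lemma comp_expr_then:
  assumes "codeat P p (comp_expr 32 e @ [i])" "pc c = p" "sim s c" "regs_bounded B c" "vals_bounded b s"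
    "in_range b e s" "wf_expr 32 e" "8 * b + 71 \<le> B" "0 \<le> b"
    and i: "\<And>c. pc (exec i c) = Suc (pc c)" "\<And>c. regs_bounded B (exec i c) = regs_bounded B c"
      "\<And>c. sim s c \<Longrightarrow> ir c 32 = aval e s \<Longrightarrow> sim s' (exec i c)"
  shows "\<exists>c'. reach P B c (elen e + 1) c' \<and> sim s' c' \<and> pc c' = p + elen e + 1"
proof -
  obtain c1 where c1: "reach P B c (elen e) c1" "sim s c1" "pc c1 = p + elen e" "ir c1 32 = aval e s" "regs_bounded B c1"
    using comp_expr1_correct[of P p e c s B b] assms by auto
  have "reach P B c1 1 (exec i c1)" by (rule reach_at[OF _ c1(3,5)]) (use assms(1) i(2) c1(5) in auto)
  then have "reach P B c (elen e + 1) (exec i c1)" using c1(1) by (meson reach_trans)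
  then show ?thesis using i(1,3) c1 by (intro exI[of _ "exec i c1"]) auto
qed

lemma If_code:
  assumes "codeat P p (comp p (If e f cm1 cm2))"
  defines "r' \<equiv> p + elen e + elen f + 1"
  defines "r \<equiv> r' + com_len cm2 + 1"
  shows "codeat P p (comp_expr 32 e)" "codeat P (p + elen e) (comp_expr 33 f)" "codeat P (p + elen e + elen f) [JmpILess 32 33 r]"
    "codeat P r' (comp r' cm2)" "codeat P (r' + com_len cm2) [Jmp (r + com_len cm1)]" "codeat P r (comp r cm1)"
proof -
  have "codeat P p (comp_expr 32 e @ comp_expr 33 f @ [JmpILess 32 33 r] @ comp r' cm2 @ [Jmp (r + com_len cm1)] @ comp r cm1)"
    using assms(1) by (simp add: Let_def r_def r'_def)
  from this[unfolded codeat_append]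
  show "codeat P p (comp_expr 32 e)" "codeat P (p + elen e) (comp_expr 33 f)" "codeat P (p + elen e + elen f) [JmpILess 32 33 r]"
    "codeat P r' (comp r' cm2)" "codeat P (r' + com_len cm2) [Jmp (r + com_len cm1)]" "codeat P r (comp r cm1)"
    by (simp_all add: add.assoc r_def r'_def)
qed

lemma While_code:
  assumes "codeat P p (comp p (While e f cm))"
  defines "q \<equiv> p + elen e + elen f + 2"
  shows "codeat P p (comp_expr 32 e)" "codeat P (p + elen e) (comp_expr 33 f)" "codeat P (p + elen e + elen f) [JmpILess 32 33 q]"
    "codeat P (p + elen e + elen f + 1) [Jmp (q + com_len cm + 1)]" "codeat P q (comp q cm)" "codeat P (q + com_len cm) [Jmp p]"
proof -
  have "codeat P p (comp_expr 32 e @ comp_expr 33 f @ [JmpILess 32 33 q] @ [Jmp (q + com_len cm + 1)] @ comp q cm @ [Jmp p])"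
    using assms(1) by (simp add: Let_def q_def)
  from this[unfolded codeat_append]
  show "codeat P p (comp_expr 32 e)" "codeat P (p + elen e) (comp_expr 33 f)" "codeat P (p + elen e + elen f) [JmpILess 32 33 q]"
    "codeat P (p + elen e + elen f + 1) [Jmp (q + com_len cm + 1)]" "codeat P q (comp q cm)" "codeat P (q + com_len cm) [Jmp p]"
    by (simp_all add: add.assoc q_def)
qed

lemma test_correct:
  assumes "codeat P p (comp_expr 32 e)" "codeat P (p + elen e) (comp_expr 33 f)" "codeat P (p + elen e + elen f) [JmpILess 32 33 r]"
    "pc c = p" "sim s c" "regs_bounded B c" "vals_bounded b s" "in_range b e s" "in_range b f s" "wf_expr 32 e" "wf_expr 33 f" "8 * b + 71 \<le> B" "0 \<le> b"
  shows "\<exists>c'. reach P B c (elen e + elen f + 1) c' \<and> sim s c' \<and> regs_bounded B c' \<and>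
    pc c' = (if aval e s < aval f s then r else p + elen e + elen f + 1)"
proof -
  obtain c1 where c1: "reach P B c (elen e + elen f) c1" "sim s c1" "pc c1 = p + elen e + elen f" "ir c1 32 = aval e s" "ir c1 33 = aval f s"
    using comp_expr2_correct[OF assms(1,2,4-13)] by blast
  let ?c2 = "exec (JmpILess 32 33 r) c1"
  have b: "regs_bounded B c1" using c1(1) by (auto simp: reach_def)
  have "reach P B c1 1 ?c2" by (rule reach_at[OF assms(3) c1(3) b]) (use b in auto)
  then have "reach P B c (elen e + elen f + 1) ?c2" using c1(1) by (meson reach_trans)
  then show ?thesis using c1 b by (intro exI[of _ ?c2]) (auto simp: sim_def)
qed

text \<open>Arrays are interleaved by residues modulo 8, so a write to one of them never disturbs
  another.\<close>

lemma interleave_eq: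
  "k' < 8 \<Longrightarrow> k < 8 \<Longrightarrow> 64 + 8 * i + k' = 64 + 8 * j + k \<longleftrightarrow> i = j \<and> k' = (k::nat)"
  by presburger

text \<open>\<open>vals_bounded\<close> is handed on together with the final configuration because
  the next statement of a sequence, or the next round of a loop, needs it again.\<close>

lemma comp_correct:
  assumes "big_step b cm s t s'" "codeat P p (comp p cm)" "pc c = p" "sim s c" "regs_bounded B c" "vals_bounded b s" "wf_com cm"
    "8 * b + 71 \<le> B" "0 \<le> b"
  shows "\<exists>c'. reach P B c t c' \<and> sim s' c' \<and> pc c' = p + com_len cm \<and> vals_bounded b s'"
  using assms
proof (induction arbitrary: p c rule: big_step.induct)
  case (Asg e s r)
  then obtain c1 where c1: "reach P B c (elen e) c1" "sim s c1" "pc c1 = p + elen e" "ir c1 32 = aval e s" "regs_bounded B c1"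
    using comp_expr1_correct[of P p e c s B b] by auto
  have v: "\<bar>aval e s\<bar> \<le> b" using aval_bound Asg by auto
  let ?c2 = "exec (IConst 33 0) c1"
  let ?c3 = "exec (IAdd r 32 33) ?c2"
  have b2: "regs_bounded B ?c2" unfolding exec.simps by (rule regs_bounded_upd) (use c1 Asg in auto)
  have b3: "regs_bounded B ?c3" unfolding exec.simps by (rule regs_bounded_upd) (use b2 c1 v Asg in auto)
  have "reach P B c1 1 ?c2" by (rule reach_at) (use Asg c1 b2 in auto)
  moreover have "reach P B ?c2 1 ?c3" by (rule reach_at) (use Asg c1 b2 b3 in auto)
  ultimately have "reach P B c (elen e + (1 + 1)) ?c3" using c1(1) by (meson reach_trans)
  moreover have "sim (s\<lparr>iv := (iv s)(r := aval e s)\<rparr>) ?c3" using c1 Asg.prems(6) by (auto simp: sim_def)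
  ultimately show ?case using c1 Asg.prems v by (intro exI[of _ ?c3]) (auto simp: vals_bounded_def numeral_2_eq_2)
next
  case (ASt e s f k)
  let ?v = "aval e s"
  obtain c0 where c0: "reach P B c (elen e) c0" "sim s c0" "pc c0 = p + elen e" "ir c0 32 = ?v" "regs_bounded B c0"
    using comp_expr1_correct[of P p e c s B b] ASt by auto
  have v: "\<bar>?v\<bar> \<le> b" "\<bar>aval f s\<bar> \<le> b"
    using aval_bound[OF ASt.prems(5) ASt.hyps(1)] aval_bound[OF ASt.prems(5) ASt.hyps(2)] ASt.prems(6) by auto
  have ats: "codeat P p (comp_expr 32 e @ [IConst 33 8] @ [IMul 32 32 33] @ [IConst 33 (64 + int k)] @ [IAdd 32 32 33]
     @ comp_expr 33 f @ [IStore 32 33])" using ASt.prems(1) by simp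
  have at: "codeat P (p + elen e) [IConst 33 8]" "codeat P (p + elen e + 1) [IMul 32 32 33]"
    "codeat P (p + elen e + 2) [IConst 33 (64 + int k)]" "codeat P (p + elen e + 3) [IAdd 32 32 33]"
    "codeat P (p + elen e + 4) (comp_expr 33 f)" "codeat P (p + elen e + 4 + elen f) [IStore 32 33]"
    using ats[unfolded codeat_append] by (simp_all add: numeral_eq_Suc)
  let ?c1 = "exec (IConst 33 8) c0"
  let ?c2 = "exec (IMul 32 32 33) ?c1"
  let ?c3 = "exec (IConst 33 (64 + int k)) ?c2"
  let ?c4 = "exec (IAdd 32 32 33) ?c3"
  have b1: "regs_bounded B ?c1" unfolding exec.simps by (rule regs_bounded_upd) (use c0 ASt in auto)
  have b2: "regs_bounded B ?c2" unfolding exec.simps by (rule regs_bounded_upd) (use b1 c0 v ASt in auto)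
  have b3: "regs_bounded B ?c3" unfolding exec.simps by (rule regs_bounded_upd) (use b2 v ASt in auto)
  have b4: "regs_bounded B ?c4" unfolding exec.simps by (rule regs_bounded_upd) (use b3 c0 v ASt in auto)
  have "reach P B c0 1 ?c1" by (rule reach_at[OF at(1)]) (use c0 b1 in auto)
  moreover have "reach P B ?c1 1 ?c2" by (rule reach_at[OF at(2)]) (use c0 b1 b2 in auto)
  moreover have "reach P B ?c2 1 ?c3" by (rule reach_at[OF at(3)]) (use c0 b2 b3 in auto)
  moreover have "reach P B ?c3 1 ?c4" by (rule reach_at[OF at(4)]) (use c0 b3 b4 in auto)
  ultimately have r4: "reach P B c (elen e + (1 + (1 + (1 + 1)))) ?c4" using c0(1) by (meson reach_trans)
  have s4: "sim s ?c4" using c0(2) by (auto simp: sim_def)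
  obtain c5 where c5: "reach P B ?c4 (elen f) c5" "keep 33 ?c4 c5" "pc c5 = p + elen e + 4 + elen f" "ir c5 33 = aval f s"
    using comp_expr_correct[of P "p + elen e + 4" 33 f ?c4 s B b] at(5) c0 s4 b4 ASt by auto
  have s5: "sim s c5" by (rule keep_sim[OF c5(2) _ s4]) simp
  have b5: "regs_bounded B c5" using c5(1) by (auto simp: reach_def)
  have a5: "ir c5 32 = ?v * 8 + (64 + int k)" using c5(2) c0 by (simp add: keep_def)
  then have nn: "nat (ir c5 32) = 64 + 8 * nat ?v + k" using ASt.hyps by simp
  let ?c6 = "exec (IStore 32 33) c5"
  have b6: "regs_bounded B ?c6" using b5 v ASt c5 by (auto simp: regs_bounded_def)
  have "reach P B c5 1 ?c6" by (rule reach_at[OF at(6)]) (use c5 b5 b6 in auto)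
  then have "reach P B c (elen e + (1 + (1 + (1 + 1))) + (elen f + 1)) ?c6" using r4 c5(1) by (meson reach_trans)
  moreover have "sim (s\<lparr>ia := (ia s)(k := (ia s k)(nat ?v := aval f s))\<rparr>) ?c6"
    unfolding sim_def
  proof (intro conjI allI impI)
    fix k' i assume k': "k' < (8::nat)"
    have kk: "k < 8" using ASt.prems(6) by simp
    have "(64 + 8 * i + k' = 64 + 8 * nat ?v + k) \<longleftrightarrow> (i = nat ?v \<and> k' = k)"
      by (rule interleave_eq[OF k' kk])
    then show "ir ?c6 (64 + 8 * i + k') = ia (s\<lparr>ia := (ia s)(k := (ia s k)(nat ?v := aval f s))\<rparr>) k' i"
      using s5 nn c5(4) k' by (auto simp: sim_def)
  qed (use s5 nn in \<open>auto simp: sim_def\<close>)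
  ultimately show ?case using c5 ASt.prems v
    by (intro exI[of _ ?c6]) (auto simp: vals_bounded_def numeral_eq_Suc)
next
  case (RLd e s d)
  have "\<exists>c'. reach P B c (elen e + 1) c' \<and> sim (s\<lparr>rm := (rm s)(d := rm s (nat (aval e s)))\<rparr>) c' \<and> pc c' = p + elen e + 1"
    by (rule comp_expr_then[OF _ RLd.prems(2-5) RLd.hyps _ RLd.prems(7,8)]) (use RLd.prems in \<open>auto simp: sim_def\<close>)
  then show ?case using RLd.prems by (auto simp: vals_bounded_def)
next
  case (RSt e s r)
  have "\<exists>c'. reach P B c (elen e + 1) c' \<and> sim (s\<lparr>rm := (rm s)(nat (aval e s) := rm s r)\<rparr>) c' \<and> pc c' = p + elen e + 1"
    by (rule comp_expr_then[OF _ RSt.prems(2-5) RSt.hyps _ RSt.prems(7,8)]) (use RSt.prems in \<open>auto simp: sim_def\<close>)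
  then show ?case using RSt.prems by (auto simp: vals_bounded_def)
next
  case (RSb d x y s)
  let ?c2 = "exec (RSub d x y) c"
  have "reach P B c 1 ?c2" by (rule reach_at) (use RSb in auto)
  then show ?case using RSb.prems by (intro exI[of _ ?c2]) (auto simp: vals_bounded_def sim_def)
next
  case (RMl d x y s)
  let ?c2 = "exec (RMul d x y) c"
  have "reach P B c 1 ?c2" by (rule reach_at) (use RMl in auto)
  then show ?case using RMl.prems by (intro exI[of _ ?c2]) (auto simp: vals_bounded_def sim_def)
next
  case (RFI e s d)
  have "\<exists>c'. reach P B c (elen e + 1) c' \<and> sim (s\<lparr>rm := (rm s)(d := real_of_int (aval e s))\<rparr>) c' \<and> pc c' = p + elen e + 1"
    by (rule comp_expr_then[OF _ RFI.prems(2-5) RFI.hyps _ RFI.prems(7,8)]) (use RFI.prems in \<open>auto simp: sim_def\<close>)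
  then show ?case using RFI.prems by (auto simp: vals_bounded_def)
next
  case (Seq cm1 s t1 s1 cm2 t2 s2)
  have at: "codeat P p (comp p cm1)" "codeat P (p + com_len cm1) (comp (p + com_len cm1) cm2)" and wf: "wf_com cm1" "wf_com cm2"
    using Seq.prems by simp_all
  obtain c1 where c1: "reach P B c t1 c1" "sim s1 c1" "pc c1 = p + com_len cm1" "vals_bounded b s1"
    using Seq.IH(1)[OF at(1) Seq.prems(2-5) wf(1) Seq.prems(7,8)] by blast
  then have "regs_bounded B c1" by (auto simp: reach_def)
  then obtain c2 where c2: "reach P B c1 t2 c2" "sim s2 c2" "pc c2 = p + com_len cm1 + com_len cm2" "vals_bounded b s2"
    using Seq.IH(2)[OF at(2) c1(3,2) _ c1(4) wf(2) Seq.prems(7,8)] by blast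
  then show ?case using reach_trans[OF c1(1) c2(1)] by (intro exI[of _ c2]) (auto simp: add.assoc)
next
  case (If1 e s f cm1 t s' cm2)
  let ?q = "p + elen e + elen f + 1 + com_len cm2 + 1"
  note at = If_code[OF If1.prems(1)]
  obtain c2 where c2: "reach P B c (elen e + elen f + 1) c2" "sim s c2" "regs_bounded B c2" "pc c2 = ?q"
    using test_correct[OF at(1-3) If1.prems(2-5) If1.hyps(1,2) _ _ If1.prems(7,8)] If1.hyps(3) If1.prems(6) by auto
  obtain c3 where "reach P B c2 t c3" "sim s' c3" "pc c3 = ?q + com_len cm1" "vals_bounded b s'"
    using If1.IH[OF at(6) c2(4,2,3)] If1.prems by auto
  then show ?case using reach_trans[OF c2(1)] by (intro exI[of _ c3]) (auto simp: add.assoc)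
next
  case (If2 e s f cm2 t s' cm1)
  let ?q = "p + elen e + elen f + 1"
  let ?r = "?q + com_len cm2 + 1 + com_len cm1"
  note at = If_code[OF If2.prems(1)]
  obtain c2 where c2: "reach P B c (elen e + elen f + 1) c2" "sim s c2" "regs_bounded B c2" "pc c2 = ?q"
    using test_correct[OF at(1-3) If2.prems(2-5) If2.hyps(1,2) _ _ If2.prems(7,8)] If2.hyps(3) If2.prems(6) by auto
  obtain c3 where c3: "reach P B c2 t c3" "sim s' c3" "pc c3 = ?q + com_len cm2" "vals_bounded b s'"
    using If2.IH[OF at(4) c2(4,2,3)] If2.prems by auto
  have "reach P B c3 1 (exec (Jmp ?r) c3)"
    by (rule reach_at[OF at(5) c3(3)]) (use c3(1) in \<open>auto simp: reach_def\<close>)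
  then have "reach P B c (elen e + elen f + 1 + (t + 1)) (exec (Jmp ?r) c3)" using c2(1) c3(1) by (meson reach_trans)
  then show ?case using c3 by (intro exI[of _ "exec (Jmp ?r) c3"]) (auto simp: add.assoc sim_def)
next
  case (IfR1 s x y cm1 t s' cm2)
  let ?q' = "p + 1"
  let ?q = "p + 1 + com_len cm2 + 1"
  let ?c2 = "exec (JmpRLess x y ?q) c"
  have ats: "codeat P p ([JmpRLess x y ?q] @ comp ?q' cm2 @ [Jmp (?q + com_len cm1)] @ comp ?q cm1)"
    using IfR1.prems by (simp add: Let_def)
  have r2: "reach P B c 1 ?c2" by (rule reach_at[OF _ IfR1.prems(2)]) (use ats[unfolded codeat_append] IfR1.prems in auto)
  have at2: "codeat P ?q (comp ?q cm1)" using ats[unfolded codeat_append] by simp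
  obtain c3 where "reach P B ?c2 t c3" "sim s' c3" "pc c3 = ?q + com_len cm1" "vals_bounded b s'"
    using IfR1.IH[of ?q ?c2, OF at2] IfR1.hyps IfR1.prems by (auto simp: sim_def)
  then show ?case using reach_trans[OF r2] by (intro exI[of _ c3]) (auto simp: add.assoc)
next
  case (IfR2 s x y cm2 t s' cm1)
  let ?q' = "p + 1"
  let ?q = "p + 1 + com_len cm2 + 1"
  let ?c2 = "exec (JmpRLess x y ?q) c"
  have ats: "codeat P p ([JmpRLess x y ?q] @ comp ?q' cm2 @ [Jmp (?q + com_len cm1)] @ comp ?q cm1)"
    using IfR2.prems by (simp add: Let_def)
  have r2: "reach P B c 1 ?c2" by (rule reach_at[OF _ IfR2.prems(2)]) (use ats[unfolded codeat_append] IfR2.prems in auto)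
  have at2: "codeat P ?q' (comp ?q' cm2)" "codeat P (?q' + com_len cm2) [Jmp (?q + com_len cm1)]"
    using ats[unfolded codeat_append] by auto
  obtain c3 where c3: "reach P B ?c2 t c3" "sim s' c3" "pc c3 = ?q' + com_len cm2" "vals_bounded b s'"
    using IfR2.IH[of ?q' ?c2, OF at2(1)] IfR2.hyps IfR2.prems by (auto simp: sim_def)
  then have b3: "regs_bounded B c3" by (auto simp: reach_def)
  let ?c4 = "exec (Jmp (?q + com_len cm1)) c3"
  have "reach P B c3 1 ?c4" by (rule reach_at[OF _ c3(3)]) (use at2 b3 in auto)
  then have "reach P B c (1 + (t + 1)) ?c4" using r2 c3(1) by (meson reach_trans)
  then show ?case using c3 by (intro exI[of _ ?c4]) (auto simp: add.assoc sim_def)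
next
  case (While1 e s f cm t1 s1 t2 s2)
  let ?q = "p + elen e + elen f + 2"
  note at = While_code[OF While1.prems(1)]
  obtain c2 where c2: "reach P B c (elen e + elen f + 1) c2" "sim s c2" "regs_bounded B c2" "pc c2 = ?q"
    using test_correct[OF at(1-3) While1.prems(2-5) While1.hyps(1,2) _ _ While1.prems(7,8)] While1.hyps(3) While1.prems(6) by auto
  obtain c3 where c3: "reach P B c2 t1 c3" "sim s1 c3" "pc c3 = ?q + com_len cm" "vals_bounded b s1"
    using While1.IH(1)[OF at(5) c2(4,2,3)] While1.prems by auto
  have b3: "regs_bounded B c3" using c3(1) by (auto simp: reach_def)
  have "reach P B c3 1 (exec (Jmp p) c3)" by (rule reach_at[OF at(6) c3(3) b3]) (use b3 in auto)
  then have r4: "reach P B c (elen e + elen f + 1 + (t1 + 1)) (exec (Jmp p) c3)" using c2(1) c3(1) by (meson reach_trans)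
  obtain c5 where c5: "reach P B (exec (Jmp p) c3) t2 c5" "sim s2 c5" "pc c5 = p + com_len (While e f cm)" "vals_bounded b s2"
    using While1.IH(2)[OF While1.prems(1), of "exec (Jmp p) c3"] b3 c3 While1.prems by (auto simp: sim_def)
  have "reach P B c (elen e + elen f + 1 + (t1 + 1) + t2) c5" using r4 c5(1) by (rule reach_trans)
  moreover have "elen e + elen f + 1 + (t1 + 1) + t2 = elen e + elen f + 2 + t1 + t2" by simp
  ultimately show ?case using c5 by (intro exI[of _ c5]) (auto simp only:)
next
  case (While2 e s f cm)
  let ?q = "p + elen e + elen f + 1"
  let ?r = "p + elen e + elen f + 2 + com_len cm + 1"
  note at = While_code[OF While2.prems(1)]
  obtain c2 where c2: "reach P B c (elen e + elen f + 1) c2" "sim s c2" "regs_bounded B c2" "pc c2 = ?q"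
    using test_correct[OF at(1-3) While2.prems(2-5) While2.hyps(1,2) _ _ While2.prems(7,8)] While2.hyps(3) While2.prems(6) by auto
  have "reach P B c2 1 (exec (Jmp ?r) c2)" by (rule reach_at[OF at(4) c2(4,3)]) (use c2(3) in auto)
  then have "reach P B c (elen e + elen f + 1 + 1) (exec (Jmp ?r) c2)" using c2(1) by (rule reach_trans[rotated])
  then show ?case using c2 While2.prems by (intro exI[of _ "exec (Jmp ?r) c2"]) (auto simp: sim_def numeral_2_eq_2)
next
  case (Skip s)
  then show ?case using reach_refl by (intro exI[of _ c]) auto
qed

lemma big_step_iff:
  "big_step b (Asg r e) s t s' \<longleftrightarrow> in_range b e s \<and> t = elen e + 2 \<and> s' = s\<lparr>iv := (iv s)(r := aval e s)\<rparr>"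
  "big_step b (ASt k e f) s t s' \<longleftrightarrow> in_range b e s \<and> in_range b f s \<and> 0 \<le> aval e s \<and> t = elen e + elen f + 5 \<and>
     s' = s\<lparr>ia := (ia s)(k := (ia s k)(nat (aval e s) := aval f s))\<rparr>"
  "big_step b (RLd d e) s t s' \<longleftrightarrow> in_range b e s \<and> t = elen e + 1 \<and> s' = s\<lparr>rm := (rm s)(d := rm s (nat (aval e s)))\<rparr>"
  "big_step b (RSt e r) s t s' \<longleftrightarrow> in_range b e s \<and> t = elen e + 1 \<and> s' = s\<lparr>rm := (rm s)(nat (aval e s) := rm s r)\<rparr>"
  "big_step b (RSb d x y) s t s' \<longleftrightarrow> t = 1 \<and> s' = s\<lparr>rm := (rm s)(d := rm s x - rm s y)\<rparr>"
  "big_step b (RMl d x y) s t s' \<longleftrightarrow> t = 1 \<and> s' = s\<lparr>rm := (rm s)(d := rm s x * rm s y)\<rparr>"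
  "big_step b (RFI d e) s t s' \<longleftrightarrow> in_range b e s \<and> t = elen e + 1 \<and> s' = s\<lparr>rm := (rm s)(d := real_of_int (aval e s))\<rparr>"
  "big_step b Skip s t s' \<longleftrightarrow> t = 0 \<and> s' = s"
  "big_step b (Seq c1 c2) s t s' \<longleftrightarrow> (\<exists>t1 t2 s1. big_step b c1 s t1 s1 \<and> big_step b c2 s1 t2 s' \<and> t = t1 + t2)"
  by (subst big_step.simps, (auto)[1])+

section \<open>Weakest preconditions with running time\<close>

text \<open>An execution has to exist, so termination and all range conditions are included. The
  clock \<open>t\<close> is an argument, which lets a postcondition bound the time accumulated so
  far.\<close>

definition wp :: "int \<Rightarrow> com \<Rightarrow> (st \<Rightarrow> nat \<Rightarrow> bool) \<Rightarrow> st \<Rightarrow> nat \<Rightarrow> bool" where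
  "wp b c Q s t \<longleftrightarrow> (\<exists>t' s'. big_step b c s t' s' \<and> Q s' (t + t'))"

lemma wp_mono: "wp b c Q s t \<Longrightarrow> (\<And>s' t'. Q s' t' \<Longrightarrow> Q' s' t') \<Longrightarrow> wp b c Q' s t"
  unfolding wp_def by blast

lemma wp_simps [simp]:
  "wp b (Asg r e) Q s t \<longleftrightarrow> in_range b e s \<and> Q (s\<lparr>iv := (iv s)(r := aval e s)\<rparr>) (t + (elen e + 2))"
  "wp b (ASt k e f) Q s t \<longleftrightarrow> in_range b e s \<and> in_range b f s \<and> 0 \<le> aval e s \<and>
     Q (s\<lparr>ia := (ia s)(k := (ia s k)(nat (aval e s) := aval f s))\<rparr>) (t + (elen e + elen f + 5))"
  "wp b (RLd d e) Q s t \<longleftrightarrow> in_range b e s \<and> Q (s\<lparr>rm := (rm s)(d := rm s (nat (aval e s)))\<rparr>) (t + (elen e + 1))"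
  "wp b (RSt e r) Q s t \<longleftrightarrow> in_range b e s \<and> Q (s\<lparr>rm := (rm s)(nat (aval e s) := rm s r)\<rparr>) (t + (elen e + 1))"
  "wp b (RSb d x y) Q s t \<longleftrightarrow> Q (s\<lparr>rm := (rm s)(d := rm s x - rm s y)\<rparr>) (t + 1)"
  "wp b (RMl d x y) Q s t \<longleftrightarrow> Q (s\<lparr>rm := (rm s)(d := rm s x * rm s y)\<rparr>) (t + 1)"
  "wp b (RFI d e) Q s t \<longleftrightarrow> in_range b e s \<and> Q (s\<lparr>rm := (rm s)(d := real_of_int (aval e s))\<rparr>) (t + (elen e + 1))"
  "wp b Skip Q s t \<longleftrightarrow> Q s t"
  by (auto simp: wp_def big_step_iff)

lemma wp_Seq [simp]: "wp b (Seq c1 c2) Q s t \<longleftrightarrow> wp b c1 (wp b c2 Q) s t"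
  unfolding wp_def big_step_iff by (metis add.assoc)

lemma wp_If [simp]: "wp b (If e f c1 c2) Q s t \<longleftrightarrow> in_range b e s \<and> in_range b f s \<and>
   (aval e s < aval f s \<longrightarrow> wp b c1 Q s (t + (elen e + elen f + 1))) \<and>
   (\<not> aval e s < aval f s \<longrightarrow> wp b c2 Q s (t + (elen e + elen f + 2)))"
  (is "?l \<longleftrightarrow> ?r")
proof
  assume ?l
  then obtain t' s' where "big_step b (If e f c1 c2) s t' s'" "Q s' (t + t')" unfolding wp_def by blast
  then show ?r by (cases rule: big_step.cases) (auto simp: wp_def add.assoc)
next
  assume r: ?r
  show ?l
  proof (cases "aval e s < aval f s")
    case True
    then obtain t' s' where "big_step b c1 s t' s'" "Q s' (t + (elen e + elen f + 1) + t')" using r unfolding wp_def by blast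
    then show ?l using If1[of b e s f c1 t' s' c2] True r unfolding wp_def add.assoc by blast
  next
    case False
    then obtain t' s' where "big_step b c2 s t' s'" "Q s' (t + (elen e + elen f + 2) + t')" using r unfolding wp_def by blast
    then show ?l using If2[of b e s f c2 t' s' c1] False r unfolding wp_def add.assoc by blast
  qed
qed

lemma wp_IfR [simp]: "wp b (IfR x y c1 c2) Q s t \<longleftrightarrow>
   (rm s x < rm s y \<longrightarrow> wp b c1 Q s (t + 1)) \<and> (\<not> rm s x < rm s y \<longrightarrow> wp b c2 Q s (t + 2))"
  (is "?l \<longleftrightarrow> ?r")
proof
  assume ?l
  then obtain t' s' where "big_step b (IfR x y c1 c2) s t' s'" "Q s' (t + t')" unfolding wp_def by blast
  then show ?r by (cases rule: big_step.cases) (auto simp: wp_def)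
next
  assume r: ?r
  show ?l
  proof (cases "rm s x < rm s y")
    case True
    then obtain t' s' where "big_step b c1 s t' s'" "Q s' (t + 1 + t')" using r unfolding wp_def by blast
    then show ?l using IfR1[of s x y b c1 t' s' c2] True unfolding wp_def add.assoc by blast
  next
    case False
    then obtain t' s' where "big_step b c2 s t' s'" "Q s' (t + 2 + t')" using r unfolding wp_def by blast
    then show ?l using IfR2[of s x y b c2 t' s' c1] False unfolding wp_def add.assoc by blast
  qed
qed

text \<open>The measure \<open>k\<close> is an argument of the invariant and need not be a function
  of the state. The query loop depends on this: its measure is computed from data about pending
  nodes that the machine does not store.\<close>

lemma wp_While_measure:
  assumes I: "I k s t"
    and step: "\<And>(k::nat) s t. I k s t \<Longrightarrow> in_range b e s \<and> in_range b f s \<and> (aval e s < aval f s \<longrightarrow>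
        wp b c (\<lambda>s' t'. \<exists>k'<k. I k' s' t') s (t + (elen e + elen f + 2))) \<and>
      (\<not> aval e s < aval f s \<longrightarrow> Q s (t + (elen e + elen f + 2)))"
  shows "wp b (While e f c) Q s t"
  using I
proof (induction k arbitrary: s t rule: less_induct)
  case (less k)
  show ?case
  proof (cases "aval e s < aval f s")
    case True
    then obtain t1 s1 k1 where 1: "big_step b c s t1 s1" "I k1 s1 (t + (elen e + elen f + 2) + t1)" "k1 < k"
      using step[OF less.prems] unfolding wp_def by blast
    then obtain t2 s2 where "big_step b (While e f c) s1 t2 s2" "Q s2 (t + (elen e + elen f + 2) + t1 + t2)"
      using less.IH unfolding wp_def by blast
    then show ?thesis using While1[of b e s f c t1 s1 t2 s2] 1 True step[OF less.prems]
      unfolding wp_def by (metis add.assoc)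
  next
    case False
    then show ?thesis using While2[of b e s f c] step[OF less.prems] unfolding wp_def by blast
  qed
qed

lemma wp_While:
  assumes I: "I s t"
    and step: "\<And>s t. I s t \<Longrightarrow> in_range b e s \<and> in_range b f s \<and> (aval e s < aval f s \<longrightarrow>
        wp b c (\<lambda>s' t'. I s' t' \<and> \<mu> s' < (\<mu> s :: nat)) s (t + (elen e + elen f + 2))) \<and>
      (\<not> aval e s < aval f s \<longrightarrow> Q s (t + (elen e + elen f + 2)))"
  shows "wp b (While e f c) Q s t"
proof (rule wp_While_measure[where I = "\<lambda>k s t. I s t \<and> k = \<mu> s" and k = "\<mu> s"])
  fix k s t
  assume "I s t \<and> k = \<mu> s"
  moreover have "wp b c (\<lambda>s' t'. I s' t' \<and> \<mu> s' < \<mu> s) s u \<Longrightarrow> k = \<mu> s \<Longrightarrow>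
      wp b c (\<lambda>s' t'. \<exists>k'<k. I s' t' \<and> k' = \<mu> s') s u" for u
    by (erule wp_mono) blast
  ultimately show "in_range b e s \<and> in_range b f s \<and> (aval e s < aval f s \<longrightarrow>
        wp b c (\<lambda>s' t'. \<exists>k'<k. I s' t' \<and> k' = \<mu> s') s (t + (elen e + elen f + 2))) \<and>
      (\<not> aval e s < aval f s \<longrightarrow> Q s (t + (elen e + elen f + 2)))"
    using step[of s t] by blast
qed (use I in simp)

definition For :: "nat \<Rightarrow> expr \<Rightarrow> com \<Rightarrow> com" where
  "For v e c = Asg v (C 0) ;; While (Vr v) e (c ;; Asg v (Add (Vr v) (C 1)))"

abbreviation loop_next :: "nat \<Rightarrow> nat \<Rightarrow> nat \<Rightarrow> (nat \<Rightarrow> st \<Rightarrow> bool) \<Rightarrow> st \<Rightarrow> nat \<Rightarrow> bool" where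
  "loop_next v i T I \<equiv> \<lambda>s' t'. t' \<le> T \<and> iv s' v = int i \<and> I (Suc i) (s'\<lparr>iv := (iv s')(v := int i + 1)\<rparr>)"

text \<open>A round spends \<open>elen e + 4\<close> steps on the test and 6 on the increment; the
  initial assignment and the last test fit into one more such allowance. The bound \<open>e\<close>
  is evaluated anew in every round, so the invariant must determine its value.
  \<open>loop_next\<close> asks for the invariant after the increment, which keeps index and loop
  variable in step.\<close>

lemma wp_For:
  assumes b: "0 < b" "int m < b"
    and init: "I 0 (s\<lparr>iv := (iv s)(v := 0)\<rparr>)"
    and cond: "\<And>i s'. I i s' \<Longrightarrow> iv s' v = int i \<Longrightarrow> i \<le> m \<Longrightarrow> in_range b e s' \<and> aval e s' = int m"
    and step: "\<And>i s' t'. I i s' \<Longrightarrow> iv s' v = int i \<Longrightarrow> i < m \<Longrightarrow>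
        wp b c (loop_next v i (t' + \<tau> i) I) s' t'"
    and post: "\<And>s' t'. I m s' \<Longrightarrow> iv s' v = int m \<Longrightarrow>
        t' \<le> t + (\<Sum>i<m. \<tau> i) + (m + 1) * (elen e + 10) \<Longrightarrow> Q s' t'"
  shows "wp b (For v e c) Q s t"
proof -
  define J where "J s' t' \<longleftrightarrow> (\<exists>i\<le>m. I i s' \<and> iv s' v = int i \<and> t' \<le> t + 3 + (\<Sum>j<i. \<tau> j) + i * (elen e + 10))" for s' t'
  have "wp b (While (Vr v) e (c ;; Asg v (Add (Vr v) (C 1)))) Q (s\<lparr>iv := (iv s)(v := 0)\<rparr>) (t + 3)"
  proof (rule wp_While[where I = J and \<mu> = "\<lambda>s. m - nat (iv s v)"])
    show "J (s\<lparr>iv := (iv s)(v := 0)\<rparr>) (t + 3)" unfolding J_def using init by (intro exI[of _ 0]) simp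
    fix s' t' assume "J s' t'"
    then obtain i where i: "i \<le> m" "I i s'" "iv s' v = int i" "t' \<le> t + 3 + (\<Sum>j<i. \<tau> j) + i * (elen e + 10)"
      unfolding J_def by blast
    have e: "in_range b e s'" "aval e s' = int m" using cond[OF i(2,3,1)] by auto
    show "in_range b (Vr v) s' \<and> in_range b e s' \<and> (aval (Vr v) s' < aval e s' \<longrightarrow>
        wp b (c ;; Asg v (Add (Vr v) (C 1))) (\<lambda>s'' t''. J s'' t'' \<and> m - nat (iv s'' v) < m - nat (iv s' v)) s' (t' + (elen (Vr v) + elen e + 2))) \<and>
      (\<not> aval (Vr v) s' < aval e s' \<longrightarrow> Q s' (t' + (elen (Vr v) + elen e + 2)))"
    proof (intro conjI impI)
      assume "aval (Vr v) s' < aval e s'"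
      then have im: "i < m" using e i by simp
      show "wp b (c ;; Asg v (Add (Vr v) (C 1))) (\<lambda>s'' t''. J s'' t'' \<and> m - nat (iv s'' v) < m - nat (iv s' v)) s' (t' + (elen (Vr v) + elen e + 2))"
        unfolding wp_Seq
      proof (rule wp_mono[OF step[OF i(2,3) im]])
        fix s2 t2
        assume a: "t2 \<le> t' + (elen (Vr v) + elen e + 2) + \<tau> i \<and> iv s2 v = int i \<and> I (Suc i) (s2\<lparr>iv := (iv s2)(v := int i + 1)\<rparr>)"
        have "J (s2\<lparr>iv := (iv s2)(v := int i + 1)\<rparr>) (t2 + 6)"
          unfolding J_def using a im i(4) by (intro exI[of _ "Suc i"]) auto
        then show "wp b (Asg v (Add (Vr v) (C 1))) (\<lambda>s'' t''. J s'' t'' \<and> m - nat (iv s'' v) < m - nat (iv s' v)) s2 t2"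
          using a im i b by simp
      qed
    next
      assume "\<not> aval (Vr v) s' < aval e s'"
      then have "i = m" using e i by simp
      then show "Q s' (t' + (elen (Vr v) + elen e + 2))" using i post by simp
    qed (use e in auto)
  qed
  then show ?thesis unfolding For_def using b by (simp add: numeral_3_eq_3)
qed

section \<open>The program\<close>

text \<open>
  Word variables:
  0 \<open>n\<close>; 2 \<open>d\<close>; 3 \<open>4096^d\<close>; 4 the group size \<open>S\<close>; 5 the number \<open>VI\<close> of inner tree nodes; 6 the number \<open>G\<close> of
  groups; 7 the group \<open>g\<close>; 8 the candidate \<open>a\<close>.
  While building the tree: 9 node \<open>v\<close>; 10 its size; 11 half of it; 12 coordinate \<open>c\<close>; 13, 14 position and block
  being placed; 15, 16 position and block it is compared with; 17 its rank.
  While querying: 9 shift \<open>j\<close>; 10 stack pointer; 11 node; 12 median block; 13 coordinate; 14, 15 flags;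
  16, 17 position and block being reported; 25, 26 the indices \<open>i\<close> and \<open>k\<close> of \<open>Upd\<close>.
  Word arrays: 0 size of a node; 1 number of coordinates left to test; 2 median block; 3 the blocks of node \<open>v\<close> from
  index \<open>v * S\<close>, each given by its start index in \<open>x\<close>; 4 the query stack.
  Real memory: \<open>x\<close>, \<open>y\<close> and the current minima \<open>z\<close> start at \<open>2 * n\<close>, \<open>3 * n\<close> and \<open>4 * n\<close>.
\<close>

definition Upd :: com where
  "Upd = RLd 0 (Add (Mul (C 2) (Vr 0)) (Vr 25)) ;;
    RLd 1 (Add (Mul (C 3) (Vr 0)) (Sub (Vr 26) (Vr 25))) ;; RSb 0 0 1 ;;
    RLd 1 (Add (Mul (C 4) (Vr 0)) (Vr 26)) ;;
    IfR 0 1 (RSt (Add (Mul (C 4) (Vr 0)) (Vr 26)) 0) Skip"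

definition Key :: "nat \<Rightarrow> nat \<Rightarrow> nat \<Rightarrow> nat \<Rightarrow> com" where
  "Key q e a c = RLd q (Add (Mul (C 2) (Vr 0)) (Add (Vr e) (Vr a))) ;;
    RLd 3 (Add (Mul (C 2) (Vr 0)) (Add (Vr e) (Vr c))) ;; RSb q q 3"

text \<open>
  The children of node \<open>v\<close> are \<open>3 * v + 1\<close> (lower half), \<open>3 * v + 2\<close> (upper half) and \<open>3 * v + 3\<close> (lower half
  with the current coordinate dropped). Splitting continues below the last coordinate, so the coordinate count may
  become negative and \<open>Key\<close> then reads irrelevant memory; queries never descend into such nodes.
\<close>

definition Split :: com where
  "Split =
    Asg 10 (Ar 0 (Vr 9)) ;; Asg 11 (Dv (Vr 10) (C 2)) ;; Asg 12 (Sub (Ar 1 (Vr 9)) (C 1)) ;;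
    ASt 0 (Add (Mul (C 3) (Vr 9)) (C 1)) (Vr 11) ;;
    ASt 0 (Add (Mul (C 3) (Vr 9)) (C 2)) (Vr 11) ;;
    ASt 0 (Add (Mul (C 3) (Vr 9)) (C 3)) (Vr 11) ;;
    ASt 1 (Add (Mul (C 3) (Vr 9)) (C 1)) (Ar 1 (Vr 9)) ;;
    ASt 1 (Add (Mul (C 3) (Vr 9)) (C 2)) (Ar 1 (Vr 9)) ;;
    ASt 1 (Add (Mul (C 3) (Vr 9)) (C 3)) (Vr 12)"

text \<open>Jumps test only \<open><\<close>, so equality of keys is the failure of both directions;
  it is then resolved by position. This makes the order total, and ranks become a permutation even
  when keys coincide.\<close>

definition Compare :: com where
  "Compare = Asg 16 (Ar 3 (Add (Mul (Vr 9) (Vr 4)) (Vr 15))) ;; Key 1 16 8 12 ;;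
    IfR 1 0 (Asg 17 (Add (Vr 17) (C 1)))
     (IfR 0 1 Skip (If (Vr 15) (Vr 13) (Asg 17 (Add (Vr 17) (C 1))) Skip))"

definition Rank :: com where
  "Rank = Asg 17 (C 0) ;; For 15 (Vr 10) Compare"

text \<open>Inside the lower half, where the rank is below register 11, the test
  \<open>hf < r + 2\<close> singles out \<open>r = hf - 1\<close>: the stored median is the largest
  block of the lower half.\<close>

definition Place :: com where
  "Place =
    If (Vr 17) (Vr 11)
      (ASt 3 (Add (Mul (Add (Mul (C 3) (Vr 9)) (C 1)) (Vr 4)) (Vr 17)) (Vr 14) ;;
       ASt 3 (Add (Mul (Add (Mul (C 3) (Vr 9)) (C 3)) (Vr 4)) (Vr 17)) (Vr 14) ;;
       If (Vr 11) (Add (Vr 17) (C 2)) (ASt 2 (Vr 9) (Vr 14)) Skip)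
      (ASt 3 (Add (Mul (Add (Mul (C 3) (Vr 9)) (C 2)) (Vr 4)) (Sub (Vr 17) (Vr 11))) (Vr 14))"

definition Distribute :: com where
  "Distribute = Asg 14 (Ar 3 (Add (Mul (Vr 9) (Vr 4)) (Vr 13))) ;; Key 0 14 8 12 ;; Rank ;; Place"

definition Build :: com where
  "Build = For 9 (Vr 5) (Split ;; For 13 (Vr 10) Distribute)"

definition Root :: com where
  "Root = ASt 0 (C 0) (Vr 4) ;; ASt 1 (C 0) (Vr 2) ;;
    For 9 (Vr 4) (ASt 3 (Vr 9) (Mul (Add (Mul (Vr 7) (Vr 4)) (Vr 9)) (Vr 2)))"

text \<open>
  \<open>Upd\<close> only ever inserts admissible candidates, hence \<open>Report\<close> is sound for blocks whose dominance has not been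
  fully tested; this is used at leaves.
\<close>

definition Report :: com where
  "Report = For 16 (Ar 0 (Vr 11))
    (Asg 17 (Ar 3 (Add (Mul (Vr 11) (Vr 4)) (Vr 16))) ;;
     If (Add (Vr 17) (Vr 9)) (Vr 0)
      (Asg 26 (Add (Vr 17) (Vr 9)) ;; Asg 25 (Add (Vr 17) (Vr 8)) ;; Upd) Skip)"

text \<open>The weak inequality needed for coordinates not below \<open>a\<close> is expressed as
  the failure of the reversed strict one.\<close>

definition Good :: com where
  "Good = Asg 12 (Ar 2 (Vr 11)) ;; Asg 13 (Sub (Ar 1 (Vr 11)) (C 1)) ;;
    Key 0 12 8 13 ;;
    RLd 1 (Add (Mul (C 3) (Vr 0)) (Sub (Vr 9) (Vr 8))) ;;
    RLd 3 (Add (Mul (C 3) (Vr 0)) (Sub (Vr 9) (Vr 13))) ;; RSb 1 1 3 ;;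
    Asg 15 (C 0) ;;
    If (Vr 13) (Vr 8) (IfR 0 1 (Asg 15 (C 1)) Skip) (IfR 1 0 Skip (Asg 15 (C 1)))"

definition Branch :: com where
  "Branch = Good ;;
    If (C 0) (Vr 15)
     (ASt 4 (Vr 10) (Add (Mul (C 3) (Vr 11)) (C 3)) ;;
      ASt 4 (Add (Vr 10) (C 1)) (Add (Mul (C 3) (Vr 11)) (C 2)) ;;
      Asg 10 (Add (Vr 10) (C 2)))
     (ASt 4 (Vr 10) (Add (Mul (C 3) (Vr 11)) (C 1)) ;; Asg 10 (Add (Vr 10) (C 1)))"

text \<open>Branching requires an untested coordinate and at least two blocks. Otherwise the list is
  reported: either all its blocks have passed every test, or it consists of a single block, for
  which testing would cost more than an update.\<close>

definition Visit :: com where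
  "Visit = Asg 10 (Sub (Vr 10) (C 1)) ;; Asg 11 (Ar 4 (Vr 10)) ;; Asg 14 (C 0) ;;
      If (C 0) (Ar 1 (Vr 11)) (If (C 1) (Ar 0 (Vr 11)) (Asg 14 (C 1)) Skip) Skip ;;
      If (C 0) (Vr 14) Branch Report"

definition Query :: com where
  "Query = ASt 4 (C 0) (C 0) ;; Asg 10 (C 1) ;; While (C 0) (Vr 10) Visit"

definition Queries :: com where
  "Queries = For 9 (Vr 0) (If (Vr 2) (Add (Vr 9) (C 2)) Query Skip)"

definition Mainloop :: com where
  "Mainloop = For 7 (Vr 6) (For 8 (Vr 2) (Root ;; Build ;; Queries))"

text \<open>Two ranges of indices escape the trees: those close to \<open>k\<close>, for which
  \<open>y\<close> might be addressed below 0 while its block is processed, and the tail of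
  \<open>x\<close> after the last full group, which is shorter than \<open>S * d\<close>.\<close>

definition Brute :: com where
  "Brute = For 7 (Vr 0) (Asg 26 (Vr 7) ;; For 8 (Mul (Vr 4) (Vr 2))
     (Asg 25 (Sub (Vr 7) (Vr 8)) ;; If (Vr 25) (C 0) Skip Upd ;;
      Asg 25 (Add (Mul (Mul (Vr 6) (Vr 4)) (Vr 2)) (Vr 8)) ;; If (Vr 7) (Vr 25) Skip Upd))"

text \<open>
  The base 4096 makes \<open>2^d * 81^d * 16^d \<le> n\<close>, so that building a tree on \<open>16^d\<close> blocks (at most \<open>81^d\<close> inner
  nodes, sorted in quadratic time) is cheap.
\<close>

locale conv =
  fixes n d :: nat and x y :: "nat \<Rightarrow> real"
  assumes d1: "1 \<le> d" and dn: "4096 ^ d \<le> n"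
begin

section \<open>Parameters and size estimates\<close>

definition S where "S = (16::nat) ^ d"
text \<open>A complete ternary tree with \<open>4 * d\<close> inner levels has
  \<open>1 + 3 + ... + 3^(4*d-1)\<close> inner nodes.\<close>

definition VI where "VI = ((3::nat) ^ (4 * d) - 1) div 2"
definition G where "G = n div (S * d)"
definition b where "b = int n * int n"

lemma VI_eq: "2 * VI + 1 = 3 ^ (4 * d)"
proof -
  have "odd ((3::nat) ^ (4 * d))" by simp
  then show ?thesis unfolding VI_def by (metis Suc_eq_plus1 diff_Suc_1 dvd_mult_div_cancel even_Suc oddE)
qed

lemma n4096: "4096 \<le> n"
  using dn d1 power_increasing[of 1 d "4096::nat"] by simp

lemma d_less: "d < 2 ^ d" by simp

lemma S_pos: "0 < S" by (simp add: S_def)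

lemma d_le_S: "d < S"
  using d_less power_mono[of 2 16 d] unfolding S_def by (meson less_le_trans zero_le_numeral numeral_le_iff semiring_norm)

lemma Sd_le: "S * d \<le> n"
proof -
  have "S * d \<le> 16 ^ d * 2 ^ d" unfolding S_def using d_less by (intro mult_left_mono) auto
  also have "\<dots> = 32 ^ d" by (simp flip: power_mult_distrib)
  also have "\<dots> \<le> 4096 ^ d" by (intro power_mono) auto
  finally show ?thesis using dn by simp
qed

text \<open>Node numbers reach at most \<open>3 * VI\<close> and each node owns \<open>S\<close>
  consecutive cells, so this keeps all word indices used by the trees below
  \<open>n\<close>.\<close>

lemma nodes_le: "(3 * VI + 4) * S \<le> n"
proof -
  have "(5::nat) \<le> 81 ^ 1" by simp
  also have "\<dots> \<le> 81 ^ d" by (intro power_increasing) (use d1 in auto)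
  finally have "(5::nat) \<le> 81 ^ d" .
  moreover have "2 * VI + 1 = 81 ^ d" using VI_eq by (simp add: power_mult)
  ultimately have "3 * VI + 4 \<le> 2 * 81 ^ d" by linarith
  then have "(3 * VI + 4) * S \<le> 2 * 81 ^ d * 16 ^ d" unfolding S_def by (intro mult_right_mono) auto
  also have "\<dots> = 2 * 1296 ^ d" by (simp flip: power_mult_distrib)
  also have "\<dots> \<le> 2 ^ d * 1296 ^ d" using power_increasing[of 1 d "2::nat"] d1 by simp
  also have "\<dots> = 2592 ^ d" by (simp flip: power_mult_distrib)
  also have "\<dots> \<le> 4096 ^ d" by (intro power_mono) auto
  finally show ?thesis using dn by simp
qed

lemma GSd_le: "G * S * d \<le> n"
  unfolding G_def by (metis div_times_less_eq_dividend mult.assoc)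

text \<open>The coefficient 4096 is forced by the last test of the parameter loop, which computes
  \<open>4096^(d+1)\<close>; the addresses in real memory need much less.\<close>

lemma b_ge: "4096 * int n \<le> b"
  unfolding b_def using n4096 by (intro mult_right_mono) auto

lemma node_bound: "v \<le> 3 * VI + 3 \<Longrightarrow> r < S \<Longrightarrow> v * S + r < n"
proof -
  assume "v \<le> 3 * VI + 3" "r < S"
  then have "v * S + r < (3 * VI + 3) * S + S" by (intro add_le_less_mono mult_right_mono) auto
  then show ?thesis using nodes_le by (simp add: algebra_simps)
qed

lemma VI_n: "3 * VI + 4 \<le> n"
proof -
  have "(3 * VI + 4) * 1 \<le> (3 * VI + 4) * S" using S_pos by (intro mult_left_mono) auto
  then show ?thesis using nodes_le unfolding mult_1_right by (rule order_trans)
qed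

text \<open>The last clause is the sound half of correctness: each \<open>z k\<close> is always a
  genuine candidate, so it never falls below the true minimum. What remains to be followed is that
  \<open>z\<close> only decreases and meets the required upper bounds.\<close>

definition layout :: "st \<Rightarrow> (nat \<Rightarrow> real) \<Rightarrow> bool" where
  "layout s z \<longleftrightarrow> iv s 0 = int n \<and> iv s 2 = int d \<and> iv s 4 = int S \<and> iv s 5 = int VI \<and> iv s 6 = int G \<and>
     (\<forall>i<n. rm s (2 * n + i) = x i \<and> rm s (3 * n + i) = y i \<and> rm s (4 * n + i) = z i) \<and>
     (\<forall>k<n. \<exists>i\<le>k. z k = x i - y (k - i))"

lemma nat_simps:
  "nat (numeral k * int m + int i) = numeral k * m + i"
  "i \<le> j \<Longrightarrow> nat (numeral k * int m + (int j - int i)) = numeral k * m + (j - i)"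
  "nat (numeral k * int m + (int i + int j)) = numeral k * m + (i + j)"
proof -
  show "nat (numeral k * int m + int i) = numeral k * m + i" for i
    by (simp add: nat_add_distrib nat_mult_distrib)
  from this[of "j - i"] show "i \<le> j \<Longrightarrow> nat (numeral k * int m + (int j - int i)) = numeral k * m + (j - i)"
    by (simp only: of_nat_diff)
  show "nat (numeral k * int m + (int i + int j)) = numeral k * m + (i + j)"
    by (simp add: nat_add_distrib nat_mult_distrib)
qed

lemma wp_Upd:
  assumes "layout s z" "iv s 25 = int i" "iv s 26 = int k" "i \<le> k" "k < n"
    and Q: "\<And>s' t' z'. \<lbrakk>layout s' z'; iv s' = iv s; ia s' = ia s; \<forall>j<n. z' j \<le> z j; z' k \<le> x i - y (k - i); t' \<le> t + 60\<rbrakk> \<Longrightarrow> Q s' t'"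
  shows "wp b Upd Q s t"
proof -
  have p: "iv s 0 = int n" "\<And>i. i < n \<Longrightarrow> rm s (2 * n + i) = x i \<and> rm s (3 * n + i) = y i \<and> rm s (4 * n + i) = z i"
    using assms(1) by (auto simp: layout_def)
  have kk: "nat (3 * int n + (int k - int i)) = 3 * n + (k - i)" using assms by auto
  have px: "rm s (2 * n + i) = x i" "rm s (3 * n + (k - i)) = y (k - i)" "rm s (4 * n + k) = z k"
     "rm s (3 * n + k - i) = y (k - i)"
    using p(2)[of i] p(2)[of "k - i"] p(2)[of k] assms by auto
  show ?thesis
    unfolding Upd_def
    using n4096 b_ge assms(4,5)
    apply (simp add: p assms(2,3) kk nat_simps px)
    apply (intro conjI impI)
    subgoal
      apply (rule Q[where z' = "z(k := x i - y (k - i))"])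
      using assms(1,4,5) n4096 by (auto simp: layout_def)
    subgoal
      apply (rule Q[where z' = "z"])
      using assms(1,4,5) n4096 by (auto simp: layout_def)
    done
qed

end

section \<open>Building the search tree\<close>

text \<open>Position in the lexicographic order by key and index, obtained by counting predecessors.
  This is the quantity that \<open>Rank\<close> accumulates.\<close>

definition rank_of :: "(nat \<Rightarrow> real) \<Rightarrow> nat \<Rightarrow> nat \<Rightarrow> nat" where
  "rank_of K m i = card {j. j < m \<and> (K j < K i \<or> K j = K i \<and> j < i)}"

lemma card_less_Suc_Collect:
  "card {j. j < Suc k \<and> P j} = card {j. j < k \<and> P j} + (if P k then 1 else 0)"
proof (cases "P k")
  case True
  then have "{j. j < Suc k \<and> P j} = insert k {j. j < k \<and> P j}" by (auto simp: less_Suc_eq)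
  then show ?thesis using True by simp
next
  case False
  then have "{j. j < Suc k \<and> P j} = {j. j < k \<and> P j}" by (auto simp: less_Suc_eq)
  then show ?thesis using False by simp
qed

lemma rank_of_less:
  assumes i: "i < m" shows "rank_of K m i < m"
proof -
  have "{j. j < m \<and> (K j < K i \<or> K j = K i \<and> j < i)} \<subseteq> {..<m} - {i}" by auto
  then have "rank_of K m i \<le> card ({..<m} - {i})" unfolding rank_of_def by (intro card_mono) simp_all
  then show ?thesis using i by simp
qed

lemma rank_of_strict:
  assumes i: "i < m" and lt: "K i < K j \<or> K i = K j \<and> i < j"
  shows "rank_of K m i < rank_of K m j"
proof -
  let ?A = "\<lambda>i. {j. j < m \<and> (K j < K i \<or> K j = K i \<and> j < i)}"
  have fin: "finite (?A k)" for k by (rule finite_subset[of _ "{..<m}"]) auto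
  have "insert i (?A i) \<subseteq> ?A j"
  proof
    fix k assume "k \<in> insert i (?A i)"
    then consider "k = i" | "k < m" "K k < K i \<or> K k = K i \<and> k < i" by blast
    then show "k \<in> ?A j" using i lt by cases fastforce+
  qed
  then have "card (insert i (?A i)) \<le> card (?A j)" by (intro card_mono fin)
  moreover have "i \<notin> ?A i" by simp
  ultimately show ?thesis unfolding rank_of_def using fin by simp
qed

lemma rank_of_leD: "i < m \<Longrightarrow> j < m \<Longrightarrow> rank_of K m i \<le> rank_of K m j \<Longrightarrow> K i \<le> K j"
  using rank_of_strict[of j m K i] by fastforce

lemma rank_of_bij: "bij_betw (rank_of K m) {..<m} {..<m}"
proof -
  have "inj_on (rank_of K m) {..<m}"
  proof (rule inj_onI)
    fix i j assume a: "i \<in> {..<m}" "j \<in> {..<m}" "rank_of K m i = rank_of K m j"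
    show "i = j"
    proof (rule ccontr)
      assume "i \<noteq> j"
      then have "K i < K j \<or> K i = K j \<and> i < j \<or> K j < K i \<or> K j = K i \<and> j < i" by linarith
      then show False using rank_of_strict[of i m K j] rank_of_strict[of j m K i] a by auto
    qed
  qed
  moreover have "rank_of K m ` {..<m} \<subseteq> {..<m}" using rank_of_less by auto
  ultimately show ?thesis
    unfolding bij_betw_def by (simp add: card_image card_subset_eq)
qed

context conv
begin

lemma layout_cong:
  assumes "layout s z" "\<forall>j<9. iv s' j = iv s j" "\<forall>j\<ge>4. rm s' j = rm s j"
  shows "layout s' z"
  using assms n4096 by (auto simp: layout_def)

lemma block_eq: "r < S \<Longrightarrow> r' < S \<Longrightarrow> v * S + r = v' * S + r' \<longleftrightarrow> v = v' \<and> r = (r'::nat)"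
proof
  assume r: "r < S" "r' < S" and eq: "v * S + r = v' * S + r'"
  have "v = (v * S + r) div S" "r = (v * S + r) mod S" using r by simp_all
  moreover have "v' = (v' * S + r') div S" "r' = (v' * S + r') mod S" using r by simp_all
  ultimately show "v = v' \<and> r = r'" using eq by metis
qed simp

lemma S_le_n: "S \<le> n"
proof -
  have "S * 1 \<le> S * d" using d1 by (intro mult_left_mono) auto
  then show ?thesis using Sd_le by linarith
qed

text \<open>
  The coordinate \<open>\<gamma>\<close> may be negative, see \<open>Split\<close>; it is only required that the scratch registers are not read.
\<close>

definition key_at :: "(nat \<Rightarrow> real) \<Rightarrow> nat \<Rightarrow> int \<Rightarrow> nat \<Rightarrow> real" where
  "key_at F a \<gamma> u = F (2 * n + (u + a)) - F (nat (2 * int n + (int u + \<gamma>)))"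

lemma key_at_cong: "(\<forall>j\<ge>4. F' j = F j) \<Longrightarrow> - int n \<le> \<gamma> \<Longrightarrow> key_at F' a \<gamma> u = key_at F a \<gamma> u"
proof -
  assume F: "\<forall>j\<ge>4. F' j = F j" and "- int n \<le> \<gamma>"
  then have "4 \<le> nat (2 * int n + (int u + \<gamma>))" using n4096 by linarith
  then show ?thesis using F n4096 by (simp add: key_at_def)
qed

lemma wp_Rank:
  assumes s: "iv s 0 = int n" "iv s 4 = int S" "iv s 8 = int a" "iv s 9 = int v" "iv s 10 = int m" "iv s 12 = \<gamma>"
      "iv s 13 = int i" "rm s 0 = key_at (rm s) a \<gamma> (u i)"
    and u: "\<And>j. j < m \<Longrightarrow> ia s 3 (v * S + j) = int (u j) \<and> u j \<le> n"
    and bd: "a \<le> n" "- int n \<le> \<gamma>" "\<gamma> \<le> int n" "m \<le> S" "v \<le> VI" "i < m"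
    and Q: "\<And>s' t'. \<lbrakk>\<forall>j<15. iv s' j = iv s j; ia s' = ia s; \<forall>j\<ge>4. rm s' j = rm s j;
        iv s' 17 = int (rank_of (\<lambda>j. key_at (rm s) a \<gamma> (u j)) m i); t' \<le> t + 100 * m + 30\<rbrakk> \<Longrightarrow> Q s' t'"
  shows "wp b Rank Q s t"
proof -
  define K where "K j = key_at (rm s) a \<gamma> (u j)" for j
  define P where "P j \<longleftrightarrow> K j < K i \<or> K j = K i \<and> j < i" for j
  have mn: "m \<le> n" using bd S_le_n by linarith
  let ?s = "s\<lparr>iv := (iv s)(17 := 0)\<rparr>"
  define I where "I k s' \<longleftrightarrow> (\<forall>j<15. iv s' j = iv s j) \<and> ia s' = ia s \<and> (\<forall>j\<ge>4. rm s' j = rm s j) \<and> rm s' 0 = rm s 0 \<and>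
    iv s' 17 = int (card {j. j < k \<and> P j})" for k and s' :: st
  have "wp b (For 15 (Vr 10) Compare) Q ?s t0" if t0: "t0 \<le> t + 10" for t0
    proof (rule wp_For[where m = m and \<tau> = "\<lambda>_. 60" and I = I])
      show "0 < b" "int m < b" using b_ge n4096 mn by linarith+
      fix k t' and s' :: st
      assume "I k s'" and k: "iv s' 15 = int k" "k < m"
      note I = this(1)[unfolded I_def]
      have iv': "iv s' 0 = int n" "iv s' 4 = int S" "iv s' 8 = int a" "iv s' 9 = int v" "iv s' 10 = int m" "iv s' 12 = \<gamma>"
        "iv s' 13 = int i" using I s by auto
      have vk: "v * S + k < n" using node_bound[of v k] bd k by auto
      then have vk': "int v * int S + int k < int n" by (simp only: of_nat_add[symmetric] of_nat_mult[symmetric] of_nat_less_iff)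
      have vS: "0 \<le> int v * int S" by simp
      have nv: "nat (int v * int S + int k) = v * S + k" by (simp only: of_nat_add[symmetric] of_nat_mult[symmetric] nat_int)
      have uk: "ia s 3 (v * S + k) = int (u k)" "u k \<le> n" using u k by auto
      have Kk: "key_at (rm s') a \<gamma> (u k) = K k" unfolding K_def using I bd by (intro key_at_cong) auto
      have K0: "rm s 0 = K i" unfolding K_def by (rule s(8))
      have Ki: "rm s' 0 = K i" unfolding K_def using I s(8) by simp
      have c: "card {j. j < k \<and> P j} \<le> k" using card_mono[of "{..<k}" "{j. j < k \<and> P j}"] by auto
      have ad: "nat (2 * int n + (int (u k) + int a)) = 2 * n + (u k + a)" by (simp add: nat_simps)
      obtain p1 where p1: "nat (2 * int n + (int (u k) + \<gamma>)) = p1" by blast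
      have gt: "3 < p1" "Suc 0 < p1" using bd n4096 p1 by linarith+
      have kvu: "rm s' (2 * n + (u k + a)) - rm s' p1 = K k"
        using Kk by (simp add: key_at_def p1)
      have ineq: "\<bar>int v * int S\<bar> \<le> b" "\<bar>int v * int S + int k\<bar> \<le> b" "3 \<le> b" "2 * int n \<le> b" "\<bar>int (u k) + int a\<bar> \<le> b"
         "\<bar>2 * int n + (int (u k) + int a)\<bar> \<le> b" "\<bar>int (u k) + \<gamma>\<bar> \<le> b" "\<bar>2 * int n + (int (u k) + \<gamma>)\<bar> \<le> b"
         "\<bar>int (card {j. j < k \<and> P j}) + 1\<bar> \<le> b"
        using b_ge n4096 vk' vS uk(2) bd(1-3) c k(2) mn by linarith+
      show "wp b
      Compare
        (loop_next 15 k (t' + 60) I) s' t'"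
        unfolding Compare_def Key_def I_def card_less_Suc_Collect
        using ineq gt conjunct1[OF conjunct2[OF I]]
        apply (simp add: iv' nv uk ad p1 kvu Ki k)
        using I k n4096
        apply (auto simp: P_def K0)
        done
    next
      fix t' and s' :: st
      assume "I m s'" and "iv s' 15 = int m"
        "t' \<le> t0 + (\<Sum>i<m. 60) + (m + 1) * (elen (Vr 10) + 10)"
      then show "Q s' t'" using t0 by (intro Q) (auto simp: I_def rank_of_def P_def K_def)
    qed (use s in \<open>auto simp: I_def\<close>)
  then show ?thesis unfolding Rank_def using b_ge n4096 by simp
qed

section \<open>Splitting a single node\<close>

fun placeA :: "(nat \<Rightarrow> nat \<Rightarrow> int) \<Rightarrow> nat \<Rightarrow> nat \<Rightarrow> nat \<Rightarrow> int \<Rightarrow> nat \<Rightarrow> nat \<Rightarrow> int" where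
  "placeA A v hf r e = (if r < hf
     then let B = (A 3)((3 * v + 1) * S + r := e, (3 * v + 3) * S + r := e) in
       (if hf < r + 2 then A(3 := B, 2 := (A 2)(v := e)) else A(3 := B))
     else A(3 := (A 3)((3 * v + 2) * S + (r - hf) := e)))"

lemma nat_block: "nat ((3 * int v + numeral k) * int S + int r) = (3 * v + numeral k) * S + r"
  "nat ((3 * int v + 1) * int S + int r) = (3 * v + 1) * S + r"
proof -
  have "(3 * int v + numeral k) * int S + int r = int ((3 * v + numeral k) * S + r)" by simp
  then show "nat ((3 * int v + numeral k) * int S + int r) = (3 * v + numeral k) * S + r"
    by (simp only: nat_int)
  have "(3 * int v + 1) * int S + int r = int ((3 * v + 1) * S + r)" by (simp add: algebra_simps)
  then show "nat ((3 * int v + 1) * int S + int r) = (3 * v + 1) * S + r"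
    by (simp only: nat_int)
qed

lemma int_node_bound: "v \<le> 3 * VI + 3 \<Longrightarrow> r < S \<Longrightarrow> 0 \<le> int v * int S \<and> int v * int S + int r < int n"
  using node_bound[of v r] by (simp flip: of_nat_add of_nat_mult)

lemma child_bound:
  assumes "v < VI" "r < S" "1 \<le> k" "k \<le> 3"
  shows "0 \<le> (3 * int v + k) * int S \<and> (3 * int v + k) * int S + int r < int n"
proof -
  have "3 * int v + k = int (3 * v + nat k)" using assms by simp
  then show ?thesis using int_node_bound[of "3 * v + nat k" r] assms by simp
qed

lemma wp_Place:
  assumes s: "iv s 4 = int S" "iv s 9 = int v" "iv s 11 = int hf" "iv s 14 = e" "iv s 17 = int r"
    and bd: "v < VI" "r < S" "hf \<le> S"
    and Q: "\<And>t'. t' \<le> t + 100 \<Longrightarrow> Q (s\<lparr>ia := placeA (ia s) v hf r e\<rparr>) t'"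
  shows "wp b Place Q s t"
proof (cases "r < hf")
  case True
  have n1: "0 \<le> (3 * int v + k) * int S \<and> (3 * int v + k) * int S + int r < int n" if "1 \<le> k" "k \<le> 3" for k
    using child_bound bd that by blast
  have v: "3 * int v + 3 \<le> int n" using bd VI_n by linarith
  show ?thesis
    using n1[of 1] n1[of 3] v b_ge n4096 bd S_le_n True Q
    by (cases "hf < r + 2") (simp_all add: Place_def s nat_block)
next
  case False
  have n1: "0 \<le> (3 * int v + k) * int S \<and> (3 * int v + k) * int S + int (r - hf) < int n" if "1 \<le> k" "k \<le> 3" for k
    using child_bound[of v "r - hf" k] bd that by auto
  have v: "3 * int v + 3 \<le> int n" using bd VI_n by linarith
  have rh: "int r - int hf = int (r - hf)" using False by simp
  show ?thesis
    using n1[of 2] v b_ge n4096 bd S_le_n False Q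
    by (simp add: Place_def s rh nat_block del: of_nat_diff)
qed

fun splitA :: "(nat \<Rightarrow> nat \<Rightarrow> int) \<Rightarrow> nat \<Rightarrow> nat \<Rightarrow> nat \<Rightarrow> int" where
  "splitA A v = A(0 := (A 0)(3 * v + 1 := A 0 v div 2, 3 * v + 2 := A 0 v div 2, 3 * v + 3 := A 0 v div 2),
     1 := (A 1)(3 * v + 1 := A 1 v, 3 * v + 2 := A 1 v, 3 * v + 3 := A 1 v - 1))"

lemma nat_child: "nat (3 * int v + numeral k) = 3 * v + numeral k" "nat (3 * int v + 1) = 3 * v + 1"
  by (simp_all add: nat_add_distrib nat_mult_distrib)

lemma wp_Split:
  assumes s: "iv s 9 = int v" "v < VI" "0 \<le> ia s 0 v" "ia s 0 v \<le> int S" "- int n + 1 \<le> ia s 1 v" "ia s 1 v \<le> int d"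
    and Q: "\<And>t'. t' \<le> t + 150 \<Longrightarrow> Q (s\<lparr>iv := (iv s)(10 := ia s 0 v, 11 := ia s 0 v div 2, 12 := ia s 1 v - 1),
       ia := splitA (ia s) v\<rparr>) t'"
  shows "wp b Split Q s t"
proof -
  have v: "3 * int v + 3 \<le> int n" using s VI_n by linarith
  have "ia s 0 v div 2 \<le> int S" "0 \<le> ia s 0 v div 2" using s by linarith+
  moreover have "int d \<le> int n" "int S \<le> int n" using S_le_n d_le_S by linarith+
  moreover have "4096 \<le> b" using b_ge n4096 by linarith
  ultimately show ?thesis
    using v b_ge n4096 s Q
    by (simp add: Split_def nat_child)
qed

lemma wp_Elem:
  assumes s: "iv s 0 = int n" "iv s 4 = int S" "iv s 8 = int a" "iv s 9 = int v" "iv s 10 = int m" "iv s 11 = int hf" "iv s 12 = \<gamma>"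
      "iv s 13 = int i"
    and u: "\<And>j. j < m \<Longrightarrow> ia s 3 (v * S + j) = int (u j) \<and> u j \<le> n"
    and bd: "a \<le> n" "- int n \<le> \<gamma>" "\<gamma> \<le> int n" "m \<le> S" "v < VI" "i < m" "hf \<le> S"
    and Q: "\<And>s' t'. \<lbrakk>\<forall>j<14. iv s' j = iv s j; \<forall>j\<ge>4. rm s' j = rm s j;
        ia s' = placeA (ia s) v hf (rank_of (\<lambda>j. key_at (rm s) a \<gamma> (u j)) m i) (ia s 3 (v * S + i)); t' \<le> t + 100 * m + 200\<rbrakk> \<Longrightarrow> Q s' t'"
  shows "wp b Distribute Q s t"
proof -
  obtain p1 where p1: "nat (2 * int n + (int (u i) + \<gamma>)) = p1" by blast
  let ?s2 = "s\<lparr>iv := (iv s)(14 := int (u i)), rm := (rm s)(0 := rm s (2 * n + (u i + a)), 3 := rm s p1,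
     0 := rm s (2 * n + (u i + a)) - rm s p1)\<rparr>"
  have gt: "3 < p1" "0 < p1" using p1 bd n4096 by linarith+
  have ui: "ia s 3 (v * S + i) = int (u i)" "u i \<le> n" using u bd by auto
  have F: "\<forall>j\<ge>4. rm ?s2 j = rm s j" by simp
  have kve: "key_at (rm ?s2) a \<gamma> (u j) = key_at (rm s) a \<gamma> (u j)" for j by (rule key_at_cong[OF F bd(2)])
  have R: "wp b Rank (wp b Place Q) ?s2 t2" if t2: "t2 \<le> t + 60" for t2
  proof (rule wp_Rank[where a = a and v = v and m = m and \<gamma> = \<gamma> and i = i and u = u])
    show "rm ?s2 0 = key_at (rm ?s2) a \<gamma> (u i)" unfolding kve by (simp add: key_at_def p1)
    fix t3 and s3 :: st
    assume 3: "\<forall>j<15. iv s3 j = iv ?s2 j" "ia s3 = ia ?s2" "\<forall>j\<ge>4. rm s3 j = rm ?s2 j"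
        "iv s3 17 = int (rank_of (\<lambda>j. key_at (rm ?s2) a \<gamma> (u j)) m i)" "t3 \<le> t2 + 100 * m + 30"
    show "wp b Place Q s3 t3"
    proof (rule wp_Place[where v = v and hf = hf and r = "rank_of (\<lambda>j. key_at (rm s) a \<gamma> (u j)) m i" and e = "int (u i)"])
      show "rank_of (\<lambda>j. key_at (rm s) a \<gamma> (u j)) m i < S" using rank_of_less[OF bd(6)] bd(4) by (meson order_less_le_trans)
      show "Q (s3\<lparr>ia := placeA (ia s3) v hf (rank_of (\<lambda>j. key_at (rm s) a \<gamma> (u j)) m i) (int (u i))\<rparr>) t'" if "t' \<le> t3 + 100" for t'
        using 3 that t2 ui by (intro Q) (auto simp del: placeA.simps)
    qed (use 3(1-3) 3(4)[unfolded kve] s bd in auto)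
  qed (use s u bd in auto)
  have vi: "0 \<le> int v * int S \<and> int v * int S + int i < int n" using int_node_bound[of v i] bd by auto
  have nv: "nat (int v * int S + int i) = v * S + i"
    by (simp only: of_nat_add[symmetric] of_nat_mult[symmetric] nat_int)
  have ad: "nat (2 * int n + (int (u i) + int a)) = 2 * n + (u i + a)" by (simp add: nat_simps)
  have "\<bar>int v * int S\<bar> \<le> b" "\<bar>int v * int S + int i\<bar> \<le> b" "3 \<le> b" "2 * int n \<le> b" "\<bar>int (u i) + int a\<bar> \<le> b"
         "\<bar>2 * int n + (int (u i) + int a)\<bar> \<le> b" "\<bar>int (u i) + \<gamma>\<bar> \<le> b" "\<bar>2 * int n + (int (u i) + \<gamma>)\<bar> \<le> b"
    using b_ge n4096 vi ui(2) bd(1-3) by linarith+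
  then show ?thesis using R gt vi n4096 by (simp add: Distribute_def Key_def s nv ui ad p1)
qed

text \<open>The median array 2 is left out: splitting a node sets its median entry while size,
  coordinate count and list of that same node persist.\<close>

definition agree :: "(nat \<Rightarrow> nat \<Rightarrow> int) \<Rightarrow> (nat \<Rightarrow> nat \<Rightarrow> int) \<Rightarrow> nat \<Rightarrow> bool" where
  "agree A A' w \<longleftrightarrow> A' 0 w = A 0 w \<and> A' 1 w = A 1 w \<and> (\<forall>r<S. A' 3 (w * S + r) = A 3 (w * S + r))"

text \<open>Coordinate counts may become negative. Each loss of a coordinate leads to a larger node
  number, hence the lower bound \<open>d - w\<close>; it keeps the addresses read by
  \<open>Key\<close> above the scratch registers.\<close>

definition node_valid :: "nat set \<Rightarrow> (nat \<Rightarrow> nat \<Rightarrow> int) \<Rightarrow> nat \<Rightarrow> bool" where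
  "node_valid E A w \<longleftrightarrow> 0 \<le> A 0 w \<and> A 0 w \<le> int S \<and> int d - int w \<le> A 1 w \<and> A 1 w \<le> int d \<and>
     (\<forall>r. int r < A 0 w \<longrightarrow> (\<exists>e\<in>E. A 3 (w * S + r) = int e))"

definition key_x :: "nat \<Rightarrow> nat \<Rightarrow> nat \<Rightarrow> real" where
  "key_x a c e = x (e + a) - x (e + c)"

definition placed :: "(nat \<Rightarrow> nat \<Rightarrow> int) \<Rightarrow> nat \<Rightarrow> nat \<Rightarrow> nat \<Rightarrow> int \<Rightarrow> bool" where
  "placed A v hf r e \<longleftrightarrow> (if r < hf
     then A 3 ((3 * v + 1) * S + r) = e \<and> A 3 ((3 * v + 3) * S + r) = e \<and> (Suc r = hf \<longrightarrow> A 2 v = e)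
     else A 3 ((3 * v + 2) * S + (r - hf)) = e)"

text \<open>The sorting permutation is hidden by an existential, so that the property speaks of
  array contents alone and can outlive the state in which the keys were computed. Order is claimed
  only if a genuine coordinate remains.\<close>

definition split_ok :: "nat \<Rightarrow> (nat \<Rightarrow> nat \<Rightarrow> int) \<Rightarrow> nat \<Rightarrow> bool" where
  "split_ok a A v \<longleftrightarrow> (\<forall>k\<in>{1,2,3}. A 0 (3 * v + k) = A 0 v div 2) \<and>
     A 1 (3 * v + 1) = A 1 v \<and> A 1 (3 * v + 2) = A 1 v \<and> A 1 (3 * v + 3) = A 1 v - 1 \<and>
     (\<exists>\<rho>. bij_betw \<rho> {..<nat (A 0 v)} {..<nat (A 0 v)} \<and>
        (\<forall>i<nat (A 0 v). placed A v (nat (A 0 v div 2)) (\<rho> i) (A 3 (v * S + i))) \<and>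
        (1 \<le> A 1 v \<longrightarrow> (\<forall>i<nat (A 0 v). \<forall>j<nat (A 0 v). \<rho> i \<le> \<rho> j \<longrightarrow>
           key_x a (nat (A 1 v - 1)) (nat (A 3 (v * S + i))) \<le> key_x a (nat (A 1 v - 1)) (nat (A 3 (v * S + j))))))"

text \<open>Later splits write to children of later nodes and to medians of those nodes only, so
  what is known about earlier splits persists.\<close>

lemma split_ok_cong:
  assumes split_ok: "split_ok a A v" and sz: "0 \<le> A 0 v" "A 0 v \<le> int S"
    and ag: "agree A A' v" "agree A A' (3 * v + 1)" "agree A A' (3 * v + 2)" "agree A A' (3 * v + 3)" "A' 2 v = A 2 v"
  shows "split_ok a A' v"
proof -
  let ?m = "nat (A 0 v)"
  have e: "A' 0 v = A 0 v" "A' 1 v = A 1 v" "\<And>i. i < ?m \<Longrightarrow> A' 3 (v * S + i) = A 3 (v * S + i)"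
    using ag(1) sz by (auto simp: agree_def)
  obtain \<rho> where \<rho>: "bij_betw \<rho> {..<?m} {..<?m}"
        "\<forall>i<?m. placed A v (nat (A 0 v div 2)) (\<rho> i) (A 3 (v * S + i))"
        "1 \<le> A 1 v \<longrightarrow> (\<forall>i<?m. \<forall>j<?m. \<rho> i \<le> \<rho> j \<longrightarrow>
           key_x a (nat (A 1 v - 1)) (nat (A 3 (v * S + i))) \<le> key_x a (nat (A 1 v - 1)) (nat (A 3 (v * S + j))))"
    using split_ok unfolding split_ok_def by blast
  have "placed A' v (nat (A 0 v div 2)) (\<rho> i) (A 3 (v * S + i))" if i: "i < ?m" for i
  proof -
    have "\<rho> i < ?m" using \<rho>(1) i by (auto simp: bij_betw_def)
    then have "\<rho> i < S" using sz by linarith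
    then have lt: "\<rho> i < S" "\<rho> i - h < S" for h by linarith+
    have c: "A' 3 ((3 * v + k) * S + r) = A 3 ((3 * v + k) * S + r)" if "k \<in> {1,2,3}" "r < S" for k r
      using ag(2-4) that by (auto simp: agree_def)
    have "placed A' v h (\<rho> i) z = placed A v h (\<rho> i) z" for h z
      unfolding placed_def ag(5) c[of 1, OF _ lt(1), simplified] by (simp only: ag(5) c lt insert_iff simp_thms)
    then show ?thesis using \<rho>(2) i by blast
  qed
  then show ?thesis
    using split_ok \<rho>(1,3) ag(2-4) unfolding split_ok_def e by (auto simp: e agree_def intro!: exI[of _ \<rho>])
qed

lemma wp_Node:
  assumes layout: "layout s z" and s: "iv s 8 = int a" "iv s 9 = int v" and v: "v < VI" and a: "a < d"
    and E: "\<forall>e\<in>E. e + d \<le> n" and val: "node_valid E (ia s) v"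
    and Q: "\<And>s' t'. \<lbrakk>\<forall>j<10. iv s' j = iv s j; \<forall>j\<ge>4. rm s' j = rm s j;
        \<forall>w. w \<notin> {3 * v + 1, 3 * v + 2, 3 * v + 3} \<longrightarrow> agree (ia s) (ia s') w; \<forall>w. w \<noteq> v \<longrightarrow> ia s' 2 w = ia s 2 w;
        split_ok a (ia s') v; \<forall>w\<in>{3 * v + 1, 3 * v + 2, 3 * v + 3}. node_valid E (ia s') w; t' \<le> t + S * (100 * S + 300) + 200\<rbrakk> \<Longrightarrow> Q s' t'"
  shows "wp b (Split ;; For 13 (Vr 10) Distribute) Q s t"
proof -
  define A where "A = ia s"
  define m where "m = nat (A 0 v)"
  define hf where "hf = m div 2"
  define \<gamma> where "\<gamma> = A 1 v - 1"
  define u where "u j = nat (A 3 (v * S + j))" for j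
  define \<rho> where "\<rho> = rank_of (\<lambda>j. key_at (rm s) a \<gamma> (u j)) m"
  define s1 where "s1 = s\<lparr>iv := (iv s)(10 := ia s 0 v, 11 := ia s 0 v div 2, 12 := ia s 1 v - 1), ia := splitA (ia s) v\<rparr>"
  let ?ch = "{3 * v + 1, 3 * v + 2, 3 * v + 3}"
  have p: "iv s 0 = int n" "iv s 4 = int S" using layout by (auto simp: layout_def)
  have mA: "A 0 v = int m" "m \<le> S" using val by (auto simp: node_valid_def m_def A_def)
  have hfA: "A 0 v div 2 = int hf" "hf \<le> S" using mA by (auto simp: hf_def)
  have ue: "u j \<in> E" "A 3 (v * S + j) = int (u j)" if "j < m" for j
    using val that mA by (auto simp: node_valid_def u_def A_def)
  have un: "u j + d \<le> n" if "j < m" for j using ue(1)[OF that] E by blast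
  have VIn: "v < n" "3 * v + 3 < n" using v VI_n by linarith+
  have \<gamma>: "- int n \<le> \<gamma>" "\<gamma> < int d" using val VIn d1 by (auto simp: node_valid_def \<gamma>_def A_def)
  have dn: "d \<le> n" using S_le_n d_le_S by linarith
  have \<rho>b: "bij_betw \<rho> {..<m} {..<m}" unfolding \<rho>_def by (rule rank_of_bij)
  have \<rho>l: "\<rho> i < m" if "i < m" for i using that \<rho>b by (auto simp: bij_betw_def)
  define I where "I i s' \<longleftrightarrow> (\<forall>j<13. iv s' j = iv s1 j) \<and> (\<forall>j\<ge>4. rm s' j = rm s j) \<and> ia s' 0 = ia s1 0 \<and> ia s' 1 = ia s1 1 \<and>
     (\<forall>w r. w \<notin> ?ch \<longrightarrow> r < S \<longrightarrow> ia s' 3 (w * S + r) = A 3 (w * S + r)) \<and> (\<forall>w. w \<noteq> v \<longrightarrow> ia s' 2 w = A 2 w) \<and>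
     (\<forall>j<i. placed (ia s') v hf (\<rho> j) (A 3 (v * S + j)))" for i and s' :: st
  have For: "wp b (For 13 (Vr 10) Distribute) Q s1 t0"
    if t0: "t0 \<le> t + 150" for t0
  proof (rule wp_For[where m = m and \<tau> = "\<lambda>_. 100 * S + 200" and I = I])
    show "0 < b" "int m < b" using b_ge n4096 mA S_le_n by linarith+
    show "I 0 (s1\<lparr>iv := (iv s1)(13 := 0)\<rparr>)" by (auto simp: I_def s1_def A_def)
    show "in_range b (Vr 10) s' \<and> aval (Vr 10) s' = int m" if "I i s'" for i s'
      using that mA by (auto simp: I_def s1_def A_def)
  next
    fix i t' and s' :: st
    assume I: "I i s'" and i: "iv s' 13 = int i" "i < m"
    have iv': "iv s' 0 = int n" "iv s' 4 = int S" "iv s' 8 = int a" "iv s' 9 = int v" "iv s' 10 = int m"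
        "iv s' 11 = int hf" "iv s' 12 = \<gamma>"
      using I s p mA hfA by (auto simp: I_def s1_def A_def \<gamma>_def)
    \<comment> \<open>A node is never its own child, so its list stays readable while the lists of
      its children are being written.\<close>
    have vch: "v \<notin> ?ch" by auto
    have list: "ia s' 3 (v * S + j) = A 3 (v * S + j)" if "j < m" for j
      using I vch that mA by (simp add: I_def)
    have F: "\<forall>j\<ge>4. rm s' j = rm s j" using I by (simp add: I_def)
    have \<rho>': "rank_of (\<lambda>j. key_at (rm s') a \<gamma> (u j)) m = \<rho>" unfolding \<rho>_def using key_at_cong[OF F \<gamma>(1)] by simp
    show "wp b Distribute
        (loop_next 13 i (t' + (100 * S + 200)) I) s' t'"
    proof (rule wp_Elem[where a = a and v = v and m = m and hf = hf and \<gamma> = \<gamma> and i = i and u = u])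
      fix t2 and s2 :: st
      assume 2: "\<forall>j<14. iv s2 j = iv s' j" "\<forall>j\<ge>4. rm s2 j = rm s' j"
        "ia s2 = placeA (ia s') v hf (rank_of (\<lambda>j. key_at (rm s') a \<gamma> (u j)) m i) (ia s' 3 (v * S + i))"
        "t2 \<le> t' + 100 * m + 200"
      let ?r = "\<rho> i"
      have ia2: "ia s2 = placeA (ia s') v hf ?r (A 3 (v * S + i))" using 2(3) list[OF i(2)] \<rho>' by simp
      obtain q where q: "\<rho> i - hf = q" by blast
      have rS: "?r < S" "q < S" unfolding q[symmetric] using \<rho>l[OF i(2)] mA by linarith+
      have e: "ia s2 0 = ia s' 0" "ia s2 1 = ia s' 1" unfolding ia2 by (auto simp: Let_def)
      have blk: "ia s2 3 (w * S + r) = ia s' 3 (w * S + r)" if "w \<notin> ?ch" "r < S" for w r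
        unfolding ia2 placeA.simps q using that rS by (auto simp: Let_def block_eq simp del: mult_Suc)
      have med: "ia s2 2 w = ia s' 2 w" if "w \<noteq> v" for w unfolding ia2 using that by (auto simp: Let_def)
      have pl: "placed (ia s2) v hf ?r (A 3 (v * S + i))"
        unfolding ia2 placed_def placeA.simps q by (auto simp: Let_def)
      have pl': "placed (ia s2) v hf (\<rho> j) (A 3 (v * S + j))" if j: "j < i" for j
      proof -
        have "\<rho> j \<noteq> ?r" using \<rho>b i j by (auto simp: bij_betw_def inj_on_def)
        moreover obtain qj where qj: "\<rho> j - hf = qj" by blast
        moreover have "\<not> \<rho> i < hf \<Longrightarrow> \<not> \<rho> j < hf \<Longrightarrow> \<rho> j \<noteq> \<rho> i \<Longrightarrow> qj \<noteq> q" using q qj by linarith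
        moreover have "\<rho> j < S" "qj < S" unfolding qj[symmetric] using \<rho>l[of j] j i mA by linarith+
        moreover have "placed (ia s') v hf (\<rho> j) (A 3 (v * S + j))" using I j by (simp add: I_def)
        ultimately show ?thesis unfolding ia2 placed_def placeA.simps q qj using rS
          by (auto simp: Let_def block_eq simp del: mult_Suc split: if_splits)
      qed
      have "I (Suc i) (s2\<lparr>iv := (iv s2)(13 := int i + 1)\<rparr>)"
        unfolding I_def using 2(1,2) I[unfolded I_def] e blk med pl pl' by (auto simp: less_Suc_eq)
      then show "loop_next 13 i (t' + (100 * S + 200)) I s2 t2"
        using 2 i mA by simp
    next
      fix j assume "j < m"
      then show "ia s' 3 (v * S + j) = int (u j) \<and> u j \<le> n" using list ue un[of j] by simp
    qed (use iv' i a dn \<gamma> mA v hfA in auto)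
  next
    fix t' and s' :: st
    assume I: "I m s'" and t': "t' \<le> t0 + (\<Sum>i<m. 100 * S + 200) + (m + 1) * (elen (Vr 10) + 10)"
    note I' = I[unfolded I_def]
    have A': "ia s' 0 = (A 0)(3 * v + 1 := int hf, 3 * v + 2 := int hf, 3 * v + 3 := int hf)"
      "ia s' 1 = (A 1)(3 * v + 1 := A 1 v, 3 * v + 2 := A 1 v, 3 * v + 3 := A 1 v - 1)"
      using I' hfA by (auto simp: s1_def A_def)
    have blk: "\<And>w r. w \<notin> ?ch \<Longrightarrow> r < S \<Longrightarrow> ia s' 3 (w * S + r) = A 3 (w * S + r)" using I' by blast
    have A'v: "ia s' 0 v = int m" "ia s' 1 v = A 1 v" unfolding A' using mA by auto
    have list: "ia s' 3 (v * S + i) = int (u i)" if "i < m" for i using that mA I' ue by auto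
    show "Q s' t'"
    proof (rule Q)
      show "\<forall>j<10. iv s' j = iv s j" "\<forall>j\<ge>4. rm s' j = rm s j" "\<forall>w. w \<noteq> v \<longrightarrow> ia s' 2 w = ia s 2 w"
        using I' by (auto simp: s1_def A_def)
      show "\<forall>w. w \<notin> ?ch \<longrightarrow> agree (ia s) (ia s') w"
        using blk unfolding agree_def A' A_def by auto
      have pl: "placed (ia s') v hf (\<rho> i) (int (u i))" if "i < m" for i using I' ue that by auto
      have mono: "key_x a (nat (A 1 v - 1)) (u i) \<le> key_x a (nat (A 1 v - 1)) (u j)"
        if "1 \<le> A 1 v" "i < m" "j < m" "\<rho> i \<le> \<rho> j" for i j
      proof -
        have le: "key_at (rm s) a \<gamma> (u i) \<le> key_at (rm s) a \<gamma> (u j)"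
          using rank_of_leD[OF that(2,3)] that(4) unfolding \<rho>_def by blast
        have "key_at (rm s) a \<gamma> (u k) = key_x a (nat (A 1 v - 1)) (u k)" if "k < m" for k
        proof -
          obtain c where c: "\<gamma> = int c" "c < d" using \<open>1 \<le> A 1 v\<close> \<gamma> by (metis \<gamma>_def diff_ge_0_iff_ge nonneg_int_cases of_nat_less_iff)
          have "u k + a < n" "u k + c < n" using un[OF that] a c by linarith+
          then have "rm s (2 * n + (u k + a)) = x (u k + a)" "rm s (2 * n + (u k + c)) = x (u k + c)"
            using layout unfolding layout_def by blast+
          then show ?thesis using c unfolding key_at_def key_x_def \<gamma>_def[symmetric] by (simp add: nat_simps)
        qed
        then show ?thesis using le that by simp
      qed
      show "split_ok a (ia s') v"
        unfolding split_ok_def A'v(1,2) using A' mA hfA \<rho>b pl mono list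
        by (auto simp: hf_def intro!: exI[of _ \<rho>])
      have surj: "\<exists>i<m. \<rho> i = r" if "r < m" for r using \<rho>b that by (auto simp: bij_betw_def image_iff) (metis imageE lessThan_iff)
      show "\<forall>w\<in>?ch. node_valid E (ia s') w"
      proof
        fix w assume w: "w \<in> ?ch"
        then obtain k where k: "w = 3 * v + k" "k \<in> {1, 2, 3}" by auto
        have 0: "ia s' 0 w = int hf" "int d - int w \<le> ia s' 1 w" "ia s' 1 w \<le> int d"
          using A' w val by (auto simp: node_valid_def A_def)
        have "\<exists>e\<in>E. ia s' 3 (w * S + r) = int e" if r: "r < hf" for r
        proof -
        \<comment> \<open>Both halves have at least \<open>m div 2\<close> elements. For odd
          \<open>m\<close> the upper one receives one more, which lies beyond the recorded size of
          the child.\<close>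
        have rm: "r < m" "r + hf < m" using r unfolding hf_def by arith+
        show ?thesis
        proof (cases "k = 2")
          case False
          obtain i where i: "i < m" "\<rho> i = r" using surj[OF rm(1)] by blast
          then have "placed (ia s') v hf r (int (u i))" using pl by blast
          then have "ia s' 3 (w * S + r) = int (u i)" using r k False by (auto simp: placed_def)
          then show ?thesis using ue i by blast
        next
          case True
          obtain i where i: "i < m" "\<rho> i = r + hf" using surj[OF rm(2)] by blast
          then have "placed (ia s') v hf (r + hf) (int (u i))" using pl by metis
          then have "ia s' 3 (w * S + r) = int (u i)" using r k True by (auto simp: placed_def)
          then show ?thesis using ue i by blast
        qed
        qed
        then show "node_valid E (ia s') w" unfolding node_valid_def using 0 hfA by auto
      qed
      have "m * (100 * S + 212) \<le> S * (100 * S + 212)" using mA by (intro mult_right_mono) auto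
      then have "m * (100 * S + 200) + m * 12 \<le> S * (100 * S + 212)" by (simp add: algebra_simps)
      then show "t' \<le> t + S * (100 * S + 300) + 200" using t' t0 by (simp add: algebra_simps)
    qed
  qed
  show ?thesis unfolding wp_Seq
  proof (rule wp_Split[OF s(2) v])
    show "0 \<le> ia s 0 v" "ia s 0 v \<le> int S" "- int n + 1 \<le> ia s 1 v" "ia s 1 v \<le> int d"
      using val VIn d1 by (auto simp: node_valid_def)
  qed (use For[unfolded s1_def] in blast)
qed

lemma node_valid_cong: "agree A A' w \<Longrightarrow> node_valid E A w \<Longrightarrow> node_valid E A' w"
  unfolding agree_def node_valid_def by auto

text \<open>Nodes are split in the order of their numbers. Splitting \<open>v\<close> extends the
  valid initial segment from \<open>3 * v\<close> to \<open>3 * v + 3\<close>, so every node is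
  filled before its turn comes.\<close>

lemma wp_Build:
  assumes layout: "layout s z" and s: "iv s 8 = int a" and a: "a < d"
    and E: "\<forall>e\<in>E. e + d \<le> n" and val: "node_valid E (ia s) 0"
    and Q: "\<And>s' t'. \<lbrakk>\<forall>j<9. iv s' j = iv s j; \<forall>j\<ge>4. rm s' j = rm s j; agree (ia s) (ia s') 0;
        \<forall>w<VI. split_ok a (ia s') w; t' \<le> t + VI * (S * (100 * S + 300) + 250) + 50\<rbrakk> \<Longrightarrow> Q s' t'"
  shows "wp b Build Q s t"
proof -
  define I where "I v s' \<longleftrightarrow> (\<forall>j<9. iv s' j = iv s j) \<and> (\<forall>j\<ge>4. rm s' j = rm s j) \<and> agree (ia s) (ia s') 0 \<and>
     (\<forall>w<v. split_ok a (ia s') w) \<and> (\<forall>w\<le>3 * v. node_valid E (ia s') w)" for v and s' :: st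
  have p: "iv s 5 = int VI" using layout by (simp add: layout_def)
  show ?thesis unfolding Build_def
  proof (rule wp_For[where m = VI and \<tau> = "\<lambda>_. S * (100 * S + 300) + 200" and I = I])
    show "0 < b" "int VI < b" using b_ge n4096 VI_n by linarith+
    show "I 0 (s\<lparr>iv := (iv s)(9 := 0)\<rparr>)" using val by (simp add: I_def agree_def)
    show "in_range b (Vr 5) s' \<and> aval (Vr 5) s' = int VI" if "I i s'" for i s' using that p by (simp add: I_def)
    fix v t' and s' :: st
    assume I: "I v s'" and v: "iv s' 9 = int v" "v < VI"
    note I' = I[unfolded I_def]
    have par': "layout s' z" by (rule layout_cong[OF layout]) (use I' in auto)
    show "wp b (Split ;; For 13 (Vr 10) Distribute)
        (loop_next 9 v (t' + (S * (100 * S + 300) + 200)) I) s' t'"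
    proof (rule wp_Node[OF par' _ v(1,2) a E])
      show "iv s' 8 = int a" using I' s by simp
      show "node_valid E (ia s') v" using I' by simp
      fix s2 :: st and t2
      assume 2: "\<forall>j<10. iv s2 j = iv s' j" "\<forall>j\<ge>4. rm s2 j = rm s' j"
        "\<forall>w. w \<notin> {3 * v + 1, 3 * v + 2, 3 * v + 3} \<longrightarrow> agree (ia s') (ia s2) w" "\<forall>w. w \<noteq> v \<longrightarrow> ia s2 2 w = ia s' 2 w"
        "split_ok a (ia s2) v" "\<forall>w\<in>{3 * v + 1, 3 * v + 2, 3 * v + 3}. node_valid E (ia s2) w" "t2 \<le> t' + S * (100 * S + 300) + 200"
      have ag: "agree (ia s') (ia s2) w" if "w \<le> 3 * v" for w using 2(3) that by simp
      have "agree (ia s) (ia s2) 0" using ag[of 0] I' by (simp add: agree_def)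
      moreover have "split_ok a (ia s2) w" if w: "w < Suc v" for w
      proof (cases "w = v")
        case False
        then have wv: "w < v" using w by simp
        have "0 \<le> ia s' 0 w" "ia s' 0 w \<le> int S" using I' wv by (auto simp: node_valid_def)
        then show ?thesis using I' wv 2(4) by (intro split_ok_cong[of a "ia s'" w "ia s2"] ag) auto
      qed (use 2 in simp)
      moreover have "node_valid E (ia s2) w" if w: "w \<le> 3 * Suc v" for w
      proof (cases "w \<le> 3 * v")
        case True
        then show ?thesis using ag node_valid_cong I' by blast
      next
        case False
        then have "w \<in> {3 * v + 1, 3 * v + 2, 3 * v + 3}" using w by auto
        then show ?thesis using 2 by blast
      qed
      ultimately show "loop_next 9 v (t' + (S * (100 * S + 300) + 200)) I s2 t2"
        using 2 I' v by (simp add: I_def)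
    qed
  next
    fix t' and s' :: st
    assume "I VI s'" "t' \<le> t + (\<Sum>i<VI. S * (100 * S + 300) + 200) + (VI + 1) * (elen (Vr 5) + 10)"
    then show "Q s' t'" by (intro Q) (auto simp: I_def algebra_simps)
  qed
qed

section \<open>The tree as nested sets of blocks\<close>

definition node_list :: "(nat \<Rightarrow> nat \<Rightarrow> int) \<Rightarrow> nat \<Rightarrow> nat \<Rightarrow> nat set \<Rightarrow> bool" where
  "node_list A v m E \<longleftrightarrow> (\<exists>f. bij_betw f {..<m} E \<and> (\<forall>i<m. A 3 (v * S + i) = int (f i)))"

text \<open>Nothing is demanded below a node with \<open>D = 0\<close>, since queries report its
  list as a whole. This is where the possibly negative integer counts are replaced by natural
  numbers.\<close>

fun tree_rep :: "nat \<Rightarrow> (nat \<Rightarrow> nat \<Rightarrow> int) \<Rightarrow> nat \<Rightarrow> nat \<Rightarrow> nat \<Rightarrow> nat set \<Rightarrow> bool" where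
  "tree_rep a A 0 v D E \<longleftrightarrow> A 0 v = 1 \<and> A 1 v = int D \<and> node_list A v 1 E"
| "tree_rep a A (Suc l) v D E \<longleftrightarrow> A 0 v = 2 ^ Suc l \<and> A 1 v = int D \<and> node_list A v (2 ^ Suc l) E \<and>
    (0 < D \<longrightarrow> (\<exists>E1 E2 \<mu>. E = E1 \<union> E2 \<and> E1 \<inter> E2 = {} \<and> \<mu> \<in> E1 \<and> A 2 v = int \<mu> \<and>
       (\<forall>e\<in>E1. key_x a (D - 1) e \<le> key_x a (D - 1) \<mu>) \<and> (\<forall>e\<in>E2. key_x a (D - 1) \<mu> \<le> key_x a (D - 1) e) \<and>
       tree_rep a A l (3 * v + 1) D E1 \<and> tree_rep a A l (3 * v + 2) D E2 \<and> tree_rep a A l (3 * v + 3) (D - 1) E1))"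

lemma tree_rep_node: "tree_rep a A l v D E \<Longrightarrow> A 0 v = 2 ^ l \<and> A 1 v = int D \<and> node_list A v (2 ^ l) E"
  by (cases l) auto

text \<open>The last hypothesis places \<open>v\<close> at least \<open>l\<close> levels above the
  bottom. It is an equality at the root, and it passes to children because
  \<open>2 * (3 * v + k) + 3 \<le> 3 * (2 * v + 3)\<close> for \<open>k \<le> 3\<close>. With a
  level left it yields \<open>v < VI\<close>, so \<open>v\<close> has been split.\<close>

lemma tree_repI:
  assumes "\<forall>w<VI. split_ok a A w" "A 0 v = 2 ^ l" "A 1 v = int D" "node_list A v (2 ^ l) E" "(2 * v + 3) * 3 ^ l \<le> 3 ^ Suc (4 * d)"
  shows "tree_rep a A l v D E"
  using assms(2-)
proof (induction l arbitrary: v D E)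
  case 0
  then show ?case by simp
next
  case (Suc l)
  define h m :: nat where hdef: "h = 2 ^ l" and mdef: "m = 2 * h"
  have hpos: "0 < h" by (simp add: hdef)
  have m2: "2 ^ Suc l = m" "2 ^ l = h" by (simp_all add: mdef hdef)
  have "(2 * v + 3) * 3 \<le> (2 * v + 3) * 3 ^ Suc l" by (intro mult_left_mono) simp_all
  then have "2 * v + 3 \<le> 3 ^ (4 * d)" using Suc.prems(4) by simp
  then have v: "v < VI" using VI_eq by linarith
  have "A 0 v = int m" using Suc.prems(1) by (simp add: mdef hdef)
  then have sz: "nat (A 0 v) = m" "A 0 v div 2 = int h" by (simp_all add: mdef)
  have lv: "split_ok a A v" using assms(1) v by blast
  obtain \<rho> where \<rho>: "bij_betw \<rho> {..<m} {..<m}" "\<forall>i<m. placed A v h (\<rho> i) (A 3 (v * S + i))"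
     and mono: "1 \<le> A 1 v \<longrightarrow> (\<forall>i<m. \<forall>j<m. \<rho> i \<le> \<rho> j \<longrightarrow>
           key_x a (nat (A 1 v - 1)) (nat (A 3 (v * S + i))) \<le> key_x a (nat (A 1 v - 1)) (nat (A 3 (v * S + j))))"
    using lv[unfolded split_ok_def sz nat_int] by (elim conjE exE) blast
  have ch: "A 0 (3 * v + 1) = 2 ^ l" "A 0 (3 * v + 2) = 2 ^ l" "A 0 (3 * v + 3) = 2 ^ l"
    "A 1 (3 * v + 1) = int D" "A 1 (3 * v + 2) = int D" "A 1 (3 * v + 3) = int D - 1"
    using lv Suc.prems(1,2) by (simp_all add: split_ok_def)
  obtain f where f: "bij_betw f {..<m} E" "\<forall>i<m. A 3 (v * S + i) = int (f i)"
    using Suc.prems(3) unfolding node_list_def m2 by blast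
  \<comment> \<open>The inverse of the ranking turns \<open>F = f \<circ> \<sigma>\<close> into the
    list of blocks in sorted order, so the two halves become the images of two intervals.\<close>
  define \<sigma> where "\<sigma> = inv_into {..<m} \<rho>"
  have \<sigma>: "bij_betw \<sigma> {..<m} {..<m}" unfolding \<sigma>_def using \<rho>(1) by (rule bij_betw_inv_into)
  have \<sigma>l: "\<sigma> r < m" "\<rho> (\<sigma> r) = r" if "r < m" for r
    using that bij_betwE[OF \<sigma>] bij_betw_imp_surj_on[OF \<rho>(1)] f_inv_into_f[of r \<rho> "{..<m}"]
    by (simp_all add: \<sigma>_def)
  define F where "F r = f (\<sigma> r)" for r
  have F_eq: "F = f \<circ> \<sigma>" by (rule ext) (simp add: F_def)
  have F: "bij_betw F {..<m} E" unfolding F_eq by (rule bij_betw_trans[OF \<sigma> f(1)])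
  have pl: "placed A v h r (int (F r))" if "r < m" for r
    using \<rho>(2)[rule_format, OF \<sigma>l(1)[OF that]] f(2)[rule_format, OF \<sigma>l(1)[OF that]] \<sigma>l(2)[OF that]
    unfolding F_def by simp
  let ?E1 = "F ` {..<h}" and ?E2 = "F ` {h..<m}"
  have inj: "inj_on F {..<m}" using F by (simp add: bij_betw_def)
  have hm: "h \<le> m" by (simp add: mdef)
  have sub: "{..<h} \<subseteq> {..<m}" "{h..<m} \<subseteq> {..<m}" using hm by auto
  have "{..<m} = {..<h} \<union> {h..<m}" using hm by auto
  then have "F ` {..<m} = ?E1 \<union> ?E2" by (simp only: image_Un)
  then have EE: "E = ?E1 \<union> ?E2" using bij_betw_imp_surj_on[OF F] by (simp only:)
  have "{..<h} \<inter> {h..<m} = {}" by auto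
  then have dis: "?E1 \<inter> ?E2 = {}"
    unfolding inj_on_image_Int[OF inj sub, symmetric] by (simp only: image_empty)
  have b1: "bij_betw F {..<h} ?E1" using inj_on_subset[OF inj sub(1)] by (rule inj_on_imp_bij_betw)
  have "bij_betw (\<lambda>r. h + r) {..<h} {h..<m}"
    by (rule bij_betw_byWitness[where f' = "\<lambda>r. r - h"]) (auto simp: mdef)
  moreover have "bij_betw F {h..<m} ?E2" using inj_on_subset[OF inj sub(2)] by (rule inj_on_imp_bij_betw)
  ultimately have b2: "bij_betw (\<lambda>r. F (h + r)) {..<h} ?E2" using bij_betw_trans[of "\<lambda>r. h + r" _ _ F] by (simp only: o_def)
  have "A 3 ((3 * v + 1) * S + r) = int (F r) \<and> A 3 ((3 * v + 3) * S + r) = int (F r)" if "r < h" for r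
    using pl[of r] that hm unfolding placed_def by (auto simp del: mult_Suc)
  then have l1: "node_list A (3 * v + 1) h ?E1" "node_list A (3 * v + 3) h ?E1"
    unfolding node_list_def using b1 by blast+
  have "A 3 ((3 * v + 2) * S + r) = int (F (h + r))" if "r < h" for r
    using pl[of "h + r"] that by (simp add: placed_def mdef)
  then have l2: "node_list A (3 * v + 2) h ?E2" unfolding node_list_def using b2 by blast
  have bd: "(2 * (3 * v + k) + 3) * 3 ^ l \<le> 3 ^ Suc (4 * d)" if "k \<le> 3" for k
  proof -
    have "(2 * (3 * v + k) + 3) * 3 ^ l \<le> (3 * (2 * v + 3)) * 3 ^ l" using that by (intro mult_right_mono) auto
    also have "\<dots> = (2 * v + 3) * 3 ^ Suc l" by simp
    finally show ?thesis using Suc.prems(4) by (rule order_trans)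
  qed
  have r12: "tree_rep a A l (3 * v + 1) D (F ` {..<h})" "tree_rep a A l (3 * v + 2) D (F ` {h..<m})"
    by (rule Suc.IH[unfolded m2(2), OF ch(1,4) l1(1) bd], simp, rule Suc.IH[unfolded m2(2), OF ch(2,5) l2 bd], simp)
  have "\<exists>E1 E2 \<mu>. E = E1 \<union> E2 \<and> E1 \<inter> E2 = {} \<and> \<mu> \<in> E1 \<and> A 2 v = int \<mu> \<and>
       (\<forall>e\<in>E1. key_x a (D - 1) e \<le> key_x a (D - 1) \<mu>) \<and> (\<forall>e\<in>E2. key_x a (D - 1) \<mu> \<le> key_x a (D - 1) e) \<and>
       tree_rep a A l (3 * v + 1) D E1 \<and> tree_rep a A l (3 * v + 2) D E2 \<and> tree_rep a A l (3 * v + 3) (D - 1) E1" if D: "0 < D"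
  proof -
    have hp: "h - 1 < h" "h - 1 < m" using hpos by (auto simp: mdef)
    have r3: "tree_rep a A l (3 * v + 3) (D - 1) ?E1"
      by (rule Suc.IH[unfolded m2(2), OF ch(3) _ l1(2) bd]) (use ch(6) D in auto)
    have med: "A 2 v = int (F (h - 1))" using pl[OF hp(2)] hp hpos by (simp add: placed_def)
    have nD: "nat (A 1 v - 1) = D - 1" "1 \<le> A 1 v" using Suc.prems(2) D by auto
    have le: "key_x a (D - 1) (F r) \<le> key_x a (D - 1) (F r')" if "r \<le> r'" "r' < m" for r r'
    proof -
      have "r < m" using that by linarith
      then show ?thesis
        using mono[rule_format, OF nD(2) \<sigma>l(1)[OF \<open>r < m\<close>] \<sigma>l(1)[OF that(2)]] \<sigma>l(2)[OF \<open>r < m\<close>] \<sigma>l(2)[OF that(2)] that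
          f(2) \<sigma>l(1)[OF \<open>r < m\<close>] \<sigma>l(1)[OF that(2)] unfolding nD(1) F_def by simp
    qed
    have k1: "\<forall>e\<in>?E1. key_x a (D - 1) e \<le> key_x a (D - 1) (F (h - 1))"
    proof
      fix e assume "e \<in> F ` {..<h}"
      then obtain r where r: "e = F r" "r < h" by blast
      have "r \<le> h - 1" using r(2) by linarith
      then show "key_x a (D - 1) e \<le> key_x a (D - 1) (F (h - 1))" unfolding r(1) using hp(2) by (rule le)
    qed
    have k2: "\<forall>e\<in>?E2. key_x a (D - 1) (F (h - 1)) \<le> key_x a (D - 1) e"
    proof
      fix e assume "e \<in> F ` {h..<m}"
      then obtain r where r: "e = F r" "h \<le> r" "r < m" by auto
      have "h - 1 \<le> r" using r(2) by linarith
      then show "key_x a (D - 1) (F (h - 1)) \<le> key_x a (D - 1) e" unfolding r(1) using r(3) by (rule le)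
    qed
    have mu: "F (h - 1) \<in> ?E1" using hp by blast
    show ?thesis
      by (intro exI[of _ ?E1] exI[of _ ?E2] exI[of _ "F (h - 1)"] conjI EE dis mu med k1 k2 r12 r3)
  qed
  then show ?case using Suc.prems by simp
qed

definition bases :: "nat \<Rightarrow> nat set" where
  "bases g = (\<lambda>r. (g * S + r) * d) ` {..<S}"

lemma bases_bij: "bij_betw (\<lambda>r. (g * S + r) * d) {..<S} (bases g)"
  using d1 by (auto simp: bij_betw_def bases_def inj_on_def)

lemma bases_le: "g < G \<Longrightarrow> r < S \<Longrightarrow> (g * S + r) * d + d \<le> n"
proof -
  assume "g < G" "r < S"
  then have "g * S + r + 1 \<le> Suc g * S" by simp
  also have "\<dots> \<le> G * S" using \<open>g < G\<close> by (intro mult_right_mono) auto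
  finally have "(g * S + r + 1) * d \<le> G * S * d" by (rule mult_right_mono) simp
  then show ?thesis using GSd_le by (simp add: algebra_simps)
qed

lemma wp_Tree:
  assumes layout: "layout s z" and s: "iv s 7 = int g" "iv s 8 = int a" and a: "a < d" and g: "g < G"
    and Q: "\<And>s' t'. \<lbrakk>\<forall>j<9. iv s' j = iv s j; layout s' z; tree_rep a (ia s') (4 * d) 0 d (bases g);
        t' \<le> t + VI * (S * (100 * S + 300) + 250) + 50 * S + 100\<rbrakk> \<Longrightarrow> Q s' t'"
  shows "wp b Root (wp b Build Q) s t"
proof -
  have p: "iv s 4 = int S" "iv s 2 = int d" using layout by (auto simp: layout_def)
  define I where "I v s' \<longleftrightarrow> (\<forall>j<9. iv s' j = iv s j) \<and> (\<forall>j\<ge>4. rm s' j = rm s j) \<and> ia s' 0 0 = int S \<and> ia s' 1 0 = int d \<and>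
     (\<forall>r<v. ia s' 3 r = int ((g * S + r) * d))" for v and s' :: st
  let ?s = "s\<lparr>ia := (ia s)(0 := (ia s 0)(0 := int S), 1 := (ia s 1)(0 := int d))\<rparr>"
  have For: "wp b (For 9 (Vr 4) (ASt 3 (Vr 9) (Mul (Add (Mul (Vr 7) (Vr 4)) (Vr 9)) (Vr 2)))) (wp b Build Q) ?s t0"
    if t0: "t0 \<le> t + 30" for t0
  proof (rule wp_For[where m = S and \<tau> = "\<lambda>_. 30" and I = I])
    show "0 < b" "int S < b" using b_ge n4096 S_le_n by linarith+
    show "I 0 (?s\<lparr>iv := (iv ?s)(9 := 0)\<rparr>)" by (simp add: I_def)
    show "in_range b (Vr 4) s' \<and> aval (Vr 4) s' = int S" if "I i s'" for i s' using that p by (simp add: I_def)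
    fix v t' and s' :: st
    assume I: "I v s'" and v: "iv s' 9 = int v" "v < S"
    note I' = I[unfolded I_def]
    have iv': "iv s' 7 = int g" "iv s' 4 = int S" "iv s' 2 = int d" using I' s p by auto
    have le: "(g * S + v) * d + d \<le> n" using bases_le[OF g v(2)] .
    have "(g * S + v) * 1 \<le> (g * S + v) * d" using d1 by (intro mult_left_mono) auto
    also have "\<dots> \<le> n" using le by linarith
    finally have le2: "g * S + v \<le> n" by simp
    have ints: "(int g * int S + int v) * int d = int ((g * S + v) * d)" "int g * int S + int v = int (g * S + v)" "int g * int S = int (g * S)"
      by simp_all
    have nb: "int ((g * S + v) * d) \<le> b" "int (g * S + v) \<le> b" "int (g * S) \<le> b"
      using le le2 b_ge by linarith+
    have "\<bar>(int g * int S + int v) * int d\<bar> \<le> b" unfolding ints(1) abs_of_nat by (rule nb)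
    moreover have "\<bar>int g * int S + int v\<bar> \<le> b" unfolding ints(2) abs_of_nat by (rule nb)
    moreover have "\<bar>int g * int S\<bar> \<le> b" unfolding ints(3) abs_of_nat by (rule nb)
    ultimately show "wp b (ASt 3 (Vr 9) (Mul (Add (Mul (Vr 7) (Vr 4)) (Vr 9)) (Vr 2)))
        (loop_next 9 v (t' + 30) I) s' t'"
      using I' v by (simp add: iv' I_def less_Suc_eq)
  next
    fix t' and s' :: st
    assume I: "I S s'" and t': "t' \<le> t0 + (\<Sum>i<S. 30) + (S + 1) * (elen (Vr 4) + 10)"
    note I' = I[unfolded I_def]
    have par': "layout s' z" by (rule layout_cong[OF layout]) (use I' in auto)
    show "wp b Build Q s' t'"
    proof (rule wp_Build[OF par' _ a])
      show "iv s' 8 = int a" using I' s by simp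
      show "\<forall>e\<in>bases g. e + d \<le> n" using bases_le[OF g] by (auto simp: bases_def)
      show "node_valid (bases g) (ia s') 0" using I' by (auto simp: node_valid_def bases_def)
      fix t2 and s2 :: st
      assume 2: "\<forall>j<9. iv s2 j = iv s' j" "\<forall>j\<ge>4. rm s2 j = rm s' j" "agree (ia s') (ia s2) 0"
        "\<forall>w<VI. split_ok a (ia s2) w" "t2 \<le> t' + VI * (S * (100 * S + 300) + 250) + 50"
      have S2: "S = 2 ^ (4 * d)" by (simp add: S_def power_mult)
      show "Q s2 t2"
      proof (rule Q)
        show "\<forall>j<9. iv s2 j = iv s j" using 2 I' by simp
        show "layout s2 z" by (rule layout_cong[OF par']) (use 2 in auto)
        show "tree_rep a (ia s2) (4 * d) 0 d (bases g)"
        proof (rule tree_repI[OF 2(4)])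
          show "ia s2 0 0 = 2 ^ (4 * d)" "ia s2 1 0 = int d" using 2(3) I' S2 by (auto simp: agree_def)
          show "node_list (ia s2) 0 (2 ^ (4 * d)) (bases g)"
            unfolding node_list_def S2[symmetric] using bases_bij 2(3) I' by (auto simp: agree_def intro!: exI[of _ "\<lambda>r. (g * S + r) * d"])
        qed simp
        show "t2 \<le> t + VI * (S * (100 * S + 300) + 250) + 50 * S + 100" using 2(5) t' t0 by simp
      qed
    qed
  qed
  show ?thesis unfolding Root_def using For p b_ge n4096 by simp
qed

lemma layout_cong':
  assumes "layout s z" "\<forall>j<7. iv s' j = iv s j" "rm s' = rm s"
  shows "layout s' z"
  using assms by (auto simp: layout_def)

section \<open>Queries\<close>

definition key_y :: "nat \<Rightarrow> nat \<Rightarrow> nat \<Rightarrow> real" where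
  "key_y a j c = y (j - a) - y (j - c)"

text \<open>
  Strictness for \<open>c < a\<close> singles out the smallest index among equal minima.
\<close>

definition pass :: "nat \<Rightarrow> nat \<Rightarrow> nat \<Rightarrow> nat \<Rightarrow> bool" where
  "pass a j c e \<longleftrightarrow> (if c < a then key_x a c e < key_y a j c else key_x a c e \<le> key_y a j c)"

definition num_passing :: "nat \<Rightarrow> nat \<Rightarrow> nat \<Rightarrow> nat set \<Rightarrow> nat" where
  "num_passing a j D E = card {e \<in> E. \<forall>c<D. pass a j c e}"

text \<open>The recursion describes a passed test. A failed one opens a single subtree with the same
  \<open>D\<close>, which is one of the two terms, so the worst case over all outcomes is
  covered.\<close>

fun visits :: "nat \<Rightarrow> nat \<Rightarrow> nat" where
  "visits 0 D = 1"
| "visits (Suc l) 0 = 1"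
| "visits (Suc l) (Suc D) = 1 + visits l D + visits l (Suc D)"

lemma visits_pos: "1 \<le> visits l D"
  by (cases "(l, D)" rule: visits.cases) auto

lemma node_list_card: "node_list A v m E \<Longrightarrow> card E = m \<and> finite E"
  unfolding node_list_def by (metis bij_betw_finite bij_betw_same_card card_lessThan finite_lessThan)

section \<open>Handling a single node during a query\<close>

lemma wp_Report:
  assumes layout: "layout s z" and s: "iv s 8 = int a" "iv s 9 = int j" "iv s 11 = int v"
    and j: "j < n" "d \<le> j + 1" and a: "a < d"
    and A: "ia s 0 v = int m" "node_list (ia s) v m E" "m \<le> S" "v \<le> 3 * VI" and E: "\<forall>e\<in>E. e + d \<le> n"
    and Q: "\<And>s' t' z'. \<lbrakk>\<forall>q<16. iv s' q = iv s q; ia s' = ia s; layout s' z'; \<forall>k<n. z' k \<le> z k;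
        \<forall>e\<in>E. e + j < n \<longrightarrow> z' (e + j) \<le> x (e + a) - y (j - a); t' \<le> t + 150 * m + 50\<rbrakk> \<Longrightarrow> Q s' t'"
  shows "wp b Report Q s t"
proof -
  obtain f where f: "bij_betw f {..<m} E" "\<forall>i<m. ia s 3 (v * S + i) = int (f i)"
    using A(2) unfolding node_list_def by blast
  have fE: "f ` {..<m} = E" using f(1) by (rule bij_betw_imp_surj_on)
  have p: "iv s 0 = int n" "iv s 4 = int S" using layout by (auto simp: layout_def)
  define I where "I i s' \<longleftrightarrow> (\<forall>q<16. iv s' q = iv s q) \<and> ia s' = ia s \<and>
     (\<exists>z'. layout s' z' \<and> (\<forall>k<n. z' k \<le> z k) \<and> (\<forall>i'<i. f i' + j < n \<longrightarrow> z' (f i' + j) \<le> x (f i' + a) - y (j - a)))" for i and s' :: st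
  show ?thesis unfolding Report_def
  proof (rule wp_For[where m = m and \<tau> = "\<lambda>_. 110" and I = I])
    show "0 < b" "int m < b" using b_ge n4096 S_le_n A(3) by linarith+
    have "layout (s\<lparr>iv := (iv s)(16 := 0)\<rparr>) z" by (rule layout_cong'[OF layout]) auto
    then show "I 0 (s\<lparr>iv := (iv s)(16 := 0)\<rparr>)" by (auto simp: I_def)
    have "3 * int VI + 4 \<le> int n" using VI_n by linarith
    then show "in_range b (Ar 0 (Vr 11)) s' \<and> aval (Ar 0 (Vr 11)) s' = int m" if "I i s'" for i s' using that s A b_ge by (simp add: I_def)
    fix i and t' :: nat and s' :: st
    assume I: "I i s'" and i: "iv s' 16 = int i" "i < m"
    then obtain z' where z': "layout s' z'" "\<forall>k<n. z' k \<le> z k" "\<forall>i'<i. f i' + j < n \<longrightarrow> z' (f i' + j) \<le> x (f i' + a) - y (j - a)"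
       and I': "\<forall>q<16. iv s' q = iv s q" "ia s' = ia s" by (auto simp: I_def)
    have iv': "iv s' 0 = int n" "iv s' 4 = int S" "iv s' 8 = int a" "iv s' 9 = int j" "iv s' 11 = int v" using I' p s by auto
    let ?e = "f i"
    have e: "ia s 3 (v * S + i) = int ?e" "?e + d \<le> n" using f i fE E by auto
    have bd: "0 \<le> int v * int S \<and> int v * int S + int i < int n" using int_node_bound[of v i] A i by auto
    have nv: "nat (int v * int S + int i) = v * S + i"
      by (simp only: of_nat_add[symmetric] of_nat_mult[symmetric] nat_int)
    let ?Q = "loop_next 16 i (t' + 110) I"
    let ?s1 = "s'\<lparr>iv := (iv s')(17 := int ?e)\<rparr>"
    have skip: "?Q ?s1 t2" if "t2 \<le> t' + 50" "\<not> ?e + j < n" for t2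
    proof -
      have "layout (?s1\<lparr>iv := (iv ?s1)(16 := int i + 1)\<rparr>) z'" by (rule layout_cong'[OF z'(1)]) auto
      then show ?thesis using that I' i z' by (auto simp: I_def less_Suc_eq intro!: exI[of _ z'])
    qed
    have upd: "wp b Upd ?Q (s'\<lparr>iv := (iv s')(17 := int ?e, 26 := int ?e + int j, 25 := int ?e + int a)\<rparr>) t2"
      if t2: "t2 \<le> t' + 50" and lt: "?e + j < n" for t2
    proof (rule wp_Upd[where i = "?e + a" and k = "?e + j"])
      let ?s2 = "s'\<lparr>iv := (iv s')(17 := int ?e, 26 := int ?e + int j, 25 := int ?e + int a)\<rparr>"
      show "layout ?s2 z'" by (rule layout_cong'[OF z'(1)]) auto
      fix s3 :: st and t3 z3
      assume 3: "layout s3 z3" "iv s3 = iv ?s2" "ia s3 = ia ?s2" "\<forall>k<n. z3 k \<le> z' k"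
        "z3 (?e + j) \<le> x (?e + a) - y (?e + j - (?e + a))" "t3 \<le> t2 + 60"
      have "layout (s3\<lparr>iv := (iv s3)(16 := int i + 1)\<rparr>) z3" by (rule layout_cong'[OF 3(1)]) auto
      moreover have "\<forall>k<n. z3 k \<le> z k" using 3(4) z'(2) order_trans by blast
      moreover have "z3 (f i' + j) \<le> x (f i' + a) - y (j - a)" if "i' < Suc i" "f i' + j < n" for i'
      proof (cases "i' = i")
        case False
        then show ?thesis using z'(3) that 3(4) by (meson less_SucE order_trans)
      qed (use 3(5) in simp)
      ultimately show "?Q s3 t3" using 3(2,3,6) t2 I' i by (auto simp: I_def intro!: exI[of _ z3])
    qed (use lt a j in auto)
    have ineq: "\<bar>int ?e + int j\<bar> \<le> b" "\<bar>int ?e + int a\<bar> \<le> b" "int v * int S \<le> b" "int v * int S + int i \<le> b"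
      using e(2) j a bd b_ge n4096 S_le_n d_le_S by linarith+
    show "wp b (Asg 17 (Ar 3 (Add (Mul (Vr 11) (Vr 4)) (Vr 16))) ;;
         If (Add (Vr 17) (Vr 9)) (Vr 0) (Asg 26 (Add (Vr 17) (Vr 9)) ;; Asg 25 (Add (Vr 17) (Vr 8)) ;; Upd) Skip) ?Q s' t'"
    proof (cases "?e + j < n")
      case True
      then have "int ?e + int j < int n" by linarith
      then show ?thesis using ineq bd upd[OF _ True] by (simp add: iv' i I'(2) nv e(1))
    next
      case False
      then have "\<not> int ?e + int j < int n" by linarith
      then show ?thesis using ineq bd skip[OF _ False, of t'] by (simp add: iv' i I'(2) nv e(1))
    qed
  next
    fix t' and s' :: st
    assume "I m s'" and t': "t' \<le> t + (\<Sum>i<m. 110) + (m + 1) * (elen (Ar 0 (Vr 11)) + 10)"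
    then obtain z' where z': "layout s' z'" "\<forall>k<n. z' k \<le> z k" "\<forall>i'<m. f i' + j < n \<longrightarrow> z' (f i' + j) \<le> x (f i' + a) - y (j - a)"
       and I': "\<forall>q<16. iv s' q = iv s q" "ia s' = ia s" by (auto simp: I_def)
    show "Q s' t'" by (rule Q[OF I' z'(1,2)]) (use z'(3) fE t' in auto)
  qed
qed

lemma wp_Good:
  assumes layout: "layout s z" and s: "iv s 8 = int a" "iv s 9 = int j" "iv s 11 = int v"
    and j: "j < n" "d \<le> j + 1" and a: "a < d"
    and A: "ia s 1 v = int D" "0 < D" "D \<le> d" "ia s 2 v = int \<mu>" "\<mu> + d \<le> n" "v \<le> 3 * VI"
    and Q: "\<And>s' t'. \<lbrakk>\<forall>q<12. iv s' q = iv s q; ia s' = ia s; \<forall>q\<ge>4. rm s' q = rm s q;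
        iv s' 15 = (if pass a j (D - 1) \<mu> then 1 else 0); t' \<le> t + 150\<rbrakk> \<Longrightarrow> Q s' t'"
  shows "wp b Good Q s t"
proof -
  obtain c where c: "D = Suc c" "c < d" using A by (cases D) auto
  have p: "iv s 0 = int n" using layout by (auto simp: layout_def)
  have px: "rm s (2 * n + i) = x i" "rm s (3 * n + i) = y i" if "i < n" for i
    using layout that by (auto simp: layout_def)
  have ca: "c \<le> j" "a \<le> j" using c a j by auto
  have ad: "nat (2 * int n + (int \<mu> + int q)) = 2 * n + (\<mu> + q)" for q by (simp add: nat_simps)
  have ad3: "nat (3 * int n + (int j - int q)) = 3 * n + (j - q)" if "q \<le> j" for q
    using that by (simp add: nat_simps(2))
  have r: "rm s (2 * n + (\<mu> + q)) = x (\<mu> + q)" "rm s (3 * n + (j - q)) = y (j - q)" if "q < d" for q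
    by (rule px, use that A in linarith, rule px, use j in linarith)
  have r': "rm s (3 * n + j - q) = y (j - q)" if "q < d" for q
  proof -
    have "3 * n + j - q = 3 * n + (j - q)" using that j by simp
    then show ?thesis using r(2)[OF that] by simp
  qed
  have ineq: "int \<mu> + int a \<le> b" "int \<mu> + int c \<le> b" "2 * int n + (int \<mu> + int a) \<le> b" "2 * int n + (int \<mu> + int c) \<le> b"
    "3 * int n + (int j - int a) \<le> b" "3 * int n + (int j - int c) \<le> b" "\<bar>int j - int a\<bar> \<le> b" "\<bar>int j - int c\<bar> \<le> b"
    "0 \<le> 3 * int n + (int j - int a)" "0 \<le> 3 * int n + (int j - int c)" "3 \<le> b" "int c \<le> b" "3 * int n \<le> b"
    using A c a j b_ge n4096 S_le_n d_le_S by linarith+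
  define R0 R1 where "R0 = key_x a c \<mu>" and "R1 = key_y a j c"
  have R: "x (\<mu> + a) - x (\<mu> + c) = R0" "y (j - a) - y (j - c) = R1" by (simp_all add: R0_def R1_def key_x_def key_y_def)
  have ps: "pass a j c \<mu> \<longleftrightarrow> (if c < a then R0 < R1 else R0 \<le> R1)" by (simp add: pass_def R0_def R1_def)
  have Q': "Q s' t'" if "\<forall>q<12. iv s' q = iv s q" "ia s' = ia s" "\<forall>q\<ge>4. rm s' q = rm s q"
        "iv s' 15 = (if (if c < a then R0 < R1 else R0 \<le> R1) then 1 else 0)" "t' \<le> t + 150" for s' t'
    using Q[of s' t'] that ps c by simp
  have n4: "4 \<le> n" using n4096 by simp
  have ne: "3 * n + j - q \<noteq> Suc 0" "\<not> 3 * n + j \<le> q" "3 * n + j - q \<noteq> 3" "2 * n + (\<mu> + q) \<noteq> Suc 0"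
    "2 * n + (\<mu> + q) \<noteq> 0" "2 * n + (\<mu> + q) \<noteq> 3" if "q \<le> j" for q
    using n4096 that by linarith+
  have A1: "ia s (Suc 0) v = 1 + int c" using A(1) c by simp
  show ?thesis
    unfolding Good_def Key_def
    using ineq n4
    apply (simp add: p s A(2-) A1 ad ad3 ca ne r r' a c(2) R del: of_nat_diff)
    apply (intro conjI impI; rule Q')
    apply auto
    done
qed

lemma wp_Branch:
  assumes layout: "layout s z" and s: "iv s 8 = int a" "iv s 9 = int j" "iv s 10 = int p" "iv s 11 = int v"
    and j: "j < n" "d \<le> j + 1" and a: "a < d" and p: "int p + 2 \<le> b"
    and A: "ia s 1 v = int D" "0 < D" "D \<le> d" "ia s 2 v = int \<mu>" "\<mu> + d \<le> n" "v \<le> 3 * VI"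
    and Q: "\<And>s' t'. \<lbrakk>layout s' z; \<forall>q<10. iv s' q = iv s q; \<forall>q<4. ia s' q = ia s q;
        if pass a j (D - 1) \<mu> then iv s' 10 = int p + 2 \<and> ia s' 4 = (ia s 4)(p := int (3 * v + 3), Suc p := int (3 * v + 2))
        else iv s' 10 = int p + 1 \<and> ia s' 4 = (ia s 4)(p := int (3 * v + 1)); t' \<le> t + 250\<rbrakk> \<Longrightarrow> Q s' t'"
  shows "wp b Branch Q s t"
proof -
  have "v + 4 \<le> n" using A(6) VI_n by linarith
  then have "int v + 4 \<le> int n" by linarith
  then have v: "3 * int v + 3 \<le> 4096 * int n" "0 \<le> int v" by linarith+
  show ?thesis unfolding Branch_def wp_Seq
  proof (rule wp_Good[OF layout s(1,2,4) j a A])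
    fix s1 :: st and t1
    assume 1: "\<forall>q<12. iv s1 q = iv s q" "ia s1 = ia s" "\<forall>q\<ge>4. rm s1 q = rm s q"
        "iv s1 15 = (if pass a j (D - 1) \<mu> then 1 else 0)" "t1 \<le> t + 150"
    have par1: "layout s1 z" by (rule layout_cong[OF layout]) (use 1 in auto)
    have iv1: "iv s1 10 = int p" "iv s1 11 = int v" using 1 s by auto
    have n2: "nat (int p + 1) = Suc p" by simp
    show "wp b (If (C 0) (Vr 15)
     (ASt 4 (Vr 10) (Add (Mul (C 3) (Vr 11)) (C 3)) ;;
      ASt 4 (Add (Vr 10) (C 1)) (Add (Mul (C 3) (Vr 11)) (C 2)) ;;
      Asg 10 (Add (Vr 10) (C 2)))
     (ASt 4 (Vr 10) (Add (Mul (C 3) (Vr 11)) (C 1)) ;; Asg 10 (Add (Vr 10) (C 1)))) Q s1 t1"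
    proof (cases "pass a j (D - 1) \<mu>")
      case True
      let ?s2 = "s1\<lparr>ia := (ia s)(4 := (ia s 4)(p := 3 * int v + 3, Suc p := 3 * int v + 2)), iv := (iv s1)(10 := int p + 2)\<rparr>"
      have "layout ?s2 z" by (rule layout_cong'[OF par1]) auto
      then have "Q ?s2 t2" if "t2 \<le> t + 250" for t2 by (rule Q) (use 1 iv1 True that in auto)
      then show ?thesis using True 1(4,5) v p b_ge n4096 by (simp add: iv1 1(2) n2)
    next
      case False
      let ?s2 = "s1\<lparr>ia := (ia s)(4 := (ia s 4)(p := 3 * int v + 1)), iv := (iv s1)(10 := int p + 1)\<rparr>"
      have "layout ?s2 z" by (rule layout_cong'[OF par1]) auto
      then have "Q ?s2 t2" if "t2 \<le> t + 250" for t2 by (rule Q) (use 1 iv1 False that in auto)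
      then show ?thesis using False 1(4,5) v p b_ge n4096 by (simp add: iv1 1(2) n2)
    qed
  qed
qed

section \<open>Amortised analysis of the query stack\<close>

fun entry_ok :: "nat \<Rightarrow> (nat \<Rightarrow> nat \<Rightarrow> int) \<Rightarrow> nat set \<Rightarrow> nat \<times> nat \<times> nat \<times> nat set \<Rightarrow> bool" where
  "entry_ok a A E0 (v, l, D, E) \<longleftrightarrow> tree_rep a A l v D E \<and> (2 * v + 3) * 3 ^ l \<le> 3 ^ Suc (4 * d) \<and> D \<le> d \<and> E \<subseteq> E0"

text \<open>
  Potential of a pending stack entry: the nodes still to be visited below it plus the blocks that will be
  reported there with all coordinates tested.
\<close>

fun entry_pot :: "nat \<Rightarrow> nat \<Rightarrow> nat \<times> nat \<times> nat \<times> nat set \<Rightarrow> nat" where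
  "entry_pot a j (v, l, D, E) = visits l D + num_passing a j D E"

definition stack_pot :: "nat \<Rightarrow> nat \<Rightarrow> (nat \<times> nat \<times> nat \<times> nat set) list \<Rightarrow> nat" where
  "stack_pot a j ws = sum_list (map (entry_pot a j) ws)"

lemma stack_pot_simps [simp]: "stack_pot a j [] = 0" "stack_pot a j (w # ws) = entry_pot a j w + stack_pot a j ws"
  "stack_pot a j (ws @ ws') = stack_pot a j ws + stack_pot a j ws'"
  by (simp_all add: stack_pot_def)

text \<open>Each pending entry still has to be visited at least once. Thus the potential also bounds
  the height of the stack, and the stack pointer stays in range.\<close>

lemma length_le_stack_pot: "length ws \<le> stack_pot a j ws"
proof (induction ws)
  case (Cons w ws)
  obtain v l D E where "w = (v, l, D, E)" by (cases w)
  then show ?case using Cons visits_pos[of l D] by simp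
qed simp

text \<open>The machine stores only node numbers; levels, open coordinates and block sets are
  tracked in the proof. The last clause says that a dominated block is either already accounted for
  in \<open>z'\<close> or still contained in some pending entry.\<close>

definition stack_inv :: "nat \<Rightarrow> nat \<Rightarrow> st \<Rightarrow> nat set \<Rightarrow> (nat \<Rightarrow> real) \<Rightarrow> st \<Rightarrow> (nat \<times> nat \<times> nat \<times> nat set) list \<Rightarrow> bool" where
  "stack_inv a j s E0 z s' ws \<longleftrightarrow> (\<forall>q<10. iv s' q = iv s q) \<and> iv s' 10 = int (length ws) \<and> (\<forall>q<4. ia s' q = ia s q) \<and>
     (\<forall>i<length ws. ia s' 4 i = int (fst (ws ! i))) \<and> (\<forall>w\<in>set ws. entry_ok a (ia s) E0 w) \<and>
     (\<exists>z'. layout s' z' \<and> (\<forall>k<n. z' k \<le> z k) \<and> (\<forall>e\<in>E0. (\<forall>c<d. pass a j c e) \<longrightarrow> e + j < n \<longrightarrow>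
        z' (e + j) \<le> x (e + a) - y (j - a) \<or> (\<exists>w\<in>set ws. e \<in> snd (snd (snd w)))))"

lemma num_passing_mono: "finite E \<Longrightarrow> E' \<subseteq> E \<Longrightarrow> num_passing a j D E' \<le> num_passing a j D E"
  unfolding num_passing_def by (intro card_mono) auto

text \<open>Each visit lowers the potential by at least one, and a report lowers it in proportion to
  the blocks that it handles. The allowance of 400 per unit exceeds 350 in order to leave room for
  the loop test.\<close>

lemma wp_Visit:
  assumes s: "iv s 8 = int a" "iv s 9 = int j"
    and j: "j < n" "d \<le> j + 1" and a: "a < d" and E0: "\<forall>e\<in>E0. e + d \<le> n"
    and stack_inv: "stack_inv a j s E0 z s' (ws @ [w])" and lw: "int (length ws) + 2 \<le> b"
    and Q: "\<And>s'' t'' ws'. \<lbrakk>stack_inv a j s E0 z s'' ws'; stack_pot a j ws' < stack_pot a j (ws @ [w]);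
         t'' + 400 * stack_pot a j ws' \<le> t + 350 + 400 * (stack_pot a j (ws @ [w]) - 1)\<rbrakk> \<Longrightarrow> Q s'' t''"
  shows "wp b Visit Q s' t"
proof -
  obtain v l D E where w: "w = (v, l, D, E)" by (cases w)
  have com_len: "iv s' 10 = 1 + int (length ws)" and fr: "\<forall>q<10. iv s' q = iv s q" "\<forall>q<4. ia s' q = ia s q"
    and st: "\<forall>i<length ws. ia s' 4 i = int (fst (ws ! i))" "ia s' 4 (length ws) = int v"
    and okw: "entry_ok a (ia s) E0 w" "\<forall>w\<in>set ws. entry_ok a (ia s) E0 w"
    using stack_inv w by (auto simp: stack_inv_def nth_append split: if_splits dest: spec[of _ "length ws"])
  obtain z' where z': "layout s' z'" "\<forall>k<n. z' k \<le> z k" "\<forall>e\<in>E0. (\<forall>c<d. pass a j c e) \<longrightarrow> e + j < n \<longrightarrow>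
        z' (e + j) \<le> x (e + a) - y (j - a) \<or> (\<exists>w\<in>set (ws @ [w]). e \<in> snd (snd (snd w)))"
    using stack_inv unfolding stack_inv_def by blast
  have r: "tree_rep a (ia s) l v D E" "(2 * v + 3) * 3 ^ l \<le> 3 ^ Suc (4 * d)" "D \<le> d" "E \<subseteq> E0"
    using okw(1) w by auto
  have r': "ia s 0 v = 2 ^ l" "ia s 1 v = int D" "node_list (ia s) v (2 ^ l) E" using tree_rep_node[OF r(1)] by auto
  have finE: "finite E" "card E = 2 ^ l" using node_list_card[OF r'(3)] by auto
  have "2 * v + 3 = (2 * v + 3) * 1" by simp
  also have "\<dots> \<le> (2 * v + 3) * 3 ^ l" by (intro mult_left_mono) auto
  also have "\<dots> \<le> 3 ^ Suc (4 * d)" by (rule r(2))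
  finally have "2 * v + 3 \<le> 3 * 3 ^ (4 * d)" by simp
  then have v: "v \<le> 3 * VI" using VI_eq by linarith
  have "3 * 3 ^ l \<le> (2 * v + 3) * 3 ^ l" by (intro mult_right_mono) auto
  also have "\<dots> \<le> 3 ^ Suc (4 * d)" by (rule r(2))
  finally have "(3::nat) ^ l \<le> 3 ^ (4 * d)" by simp
  then have lh: "l \<le> 4 * d" by (simp add: power_le_imp_le_exp)
  then have "(2::nat) ^ l \<le> 2 ^ (4 * d)" by (intro power_increasing) auto
  then have lS: "2 ^ l \<le> S" by (simp add: S_def power_mult)
  have iv0: "iv s' 8 = int a" "iv s' 9 = int j" using fr s by auto
  have ia0: "ia s' 0 v = 2 ^ l" "ia s' 1 v = int D" "ia s' 2 = ia s 2" "ia s' 3 = ia s 3" using fr(2) r' by auto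
  have E: "\<forall>e\<in>E. e + d \<le> n" using r(4) E0 by blast
  let ?s2 = "\<lambda>f. s'\<lparr>iv := (iv s')(10 := int (length ws), 11 := int v, 14 := f)\<rparr>"
  have par2: "layout (?s2 f) z'" for f by (rule layout_cong'[OF z'(1)]) auto
  have pt: "stack_pot a j (ws @ [w]) = stack_pot a j ws + (visits l D + num_passing a j D E)" by (simp add: w)
  have qp: "1 \<le> visits l D" by (rule visits_pos)
  have Rep: "wp b Report Q (?s2 f) t2" if t2: "t2 \<le> t + 80" and z0: "D = 0 \<or> l = 0" for f t2
  proof (rule wp_Report[OF par2 _ _ _ j a _ _ lS v E])
    fix s3 :: st and t3 z3
    assume 3: "\<forall>q<16. iv s3 q = iv (?s2 f) q" "ia s3 = ia (?s2 f)" "layout s3 z3" "\<forall>k<n. z3 k \<le> z' k"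
        "\<forall>e\<in>E. e + j < n \<longrightarrow> z3 (e + j) \<le> x (e + a) - y (j - a)" "t3 \<le> t2 + 150 * 2 ^ l + 50"
    show "Q s3 t3"
    proof (rule Q[of _ ws])
      have "\<forall>e\<in>E0. (\<forall>c<d. pass a j c e) \<longrightarrow> e + j < n \<longrightarrow>
        z3 (e + j) \<le> x (e + a) - y (j - a) \<or> (\<exists>w\<in>set ws. e \<in> snd (snd (snd w)))"
        using z'(3) 3(4,5) w by (fastforce intro: order_trans)
      moreover have "\<forall>k<n. z3 k \<le> z k" using 3(4) z'(2) order_trans by blast
      ultimately show "stack_inv a j s E0 z s3 ws"
        unfolding stack_inv_def using 3(1-3) fr st okw by auto
      show "stack_pot a j ws < stack_pot a j (ws @ [w])" using pt qp by linarith
      \<comment> \<open>For \<open>D = 0\<close> the tests are vacuous and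
        \<open>num_passing\<close> counts all of \<open>E\<close>; at a leaf the single block is
        paid for by \<open>visits\<close>.\<close>
      have "2 ^ l \<le> visits l D + num_passing a j D E"
        using z0 finE qp by (auto simp: num_passing_def)
      then show "t3 + 400 * stack_pot a j ws \<le> t + 350 + 400 * (stack_pot a j (ws @ [w]) - 1)"
        using 3(6) t2 pt qp z0 finE by (auto simp: num_passing_def)
    qed
  qed (use iv0 ia0 r'(3) in \<open>auto simp: node_list_def\<close>)
  have Br: "wp b Branch Q (?s2 1) t2" if t2: "t2 \<le> t + 80" and D: "0 < D" and l: "l = Suc l'" for t2 l'
  proof -
    obtain E1 E2 \<mu> where E12: "E = E1 \<union> E2" "E1 \<inter> E2 = {}" "\<mu> \<in> E1" "ia s 2 v = int \<mu>"
       "\<forall>e\<in>E1. key_x a (D - 1) e \<le> key_x a (D - 1) \<mu>" "\<forall>e\<in>E2. key_x a (D - 1) \<mu> \<le> key_x a (D - 1) e"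
       "tree_rep a (ia s) l' (3 * v + 1) D E1" "tree_rep a (ia s) l' (3 * v + 2) D E2" "tree_rep a (ia s) l' (3 * v + 3) (D - 1) E1"
      using r(1) D unfolding l by auto
    have bd: "(2 * (3 * v + k) + 3) * 3 ^ l' \<le> 3 ^ Suc (4 * d)" if "k \<le> 3" for k
    proof -
      have "(2 * (3 * v + k) + 3) * 3 ^ l' \<le> (3 * (2 * v + 3)) * 3 ^ l'" using that by (intro mult_right_mono) auto
      also have "\<dots> = (2 * v + 3) * 3 ^ l" by (simp add: l)
      finally show ?thesis using r(2) by (rule order_trans)
    qed
    obtain D' where D': "D = Suc D'" using D by (cases D) auto
    have okc: "entry_ok a (ia s) E0 (3 * v + 1, l', D, E1)" "entry_ok a (ia s) E0 (3 * v + 2, l', D, E2)"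
      "entry_ok a (ia s) E0 (3 * v + 3, l', D - 1, E1)"
      using E12 r(3,4) bd[of 1] bd[of 2] bd[of 3] by auto
    have fin: "finite E1" "finite E2" using finE E12 by auto
    show ?thesis
    proof (rule wp_Branch[OF par2 _ _ _ _ j a lw _ D r(3) _ _ v])
      show "\<mu> + d \<le> n" using E12 E by blast
      show "ia (?s2 1) 2 v = int \<mu>" using E12 ia0 by simp
      fix s3 :: st and t3
      assume 3: "layout s3 z'" "\<forall>q<10. iv s3 q = iv (?s2 1) q" "\<forall>q<4. ia s3 q = ia (?s2 1) q"
        "if pass a j (D - 1) \<mu> then iv s3 10 = int (length ws) + 2 \<and>
            ia s3 4 = (ia (?s2 1) 4)(length ws := int (3 * v + 3), Suc (length ws) := int (3 * v + 2))
        else iv s3 10 = int (length ws) + 1 \<and> ia s3 4 = (ia (?s2 1) 4)(length ws := int (3 * v + 1))" "t3 \<le> t2 + 250"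
      show "Q s3 t3"
      proof (cases "pass a j (D - 1) \<mu>")
        case True
        let ?ws = "ws @ [(3 * v + 3, l', D - 1, E1), (3 * v + 2, l', D, E2)]"
        \<comment> \<open>All keys in the lower half are at most that of the median, so its blocks
          pass as well. Dropping the coordinate there leaves \<open>num_passing\<close> unchanged,
          and the potential falls by exactly one.\<close>
        have p1: "pass a j (D - 1) e" if "e \<in> E1" for e
          using True E12(5) that unfolding pass_def by (auto split: if_splits intro: order_trans le_less_trans)
        have "{e \<in> E1. \<forall>c<D'. pass a j c e} = {e \<in> E1. \<forall>c<D. pass a j c e}"
          using p1 by (auto simp: D' less_Suc_eq)
        then have "num_passing a j (D - 1) E1 = num_passing a j D E1" by (simp add: num_passing_def D')
        moreover have "num_passing a j D E = num_passing a j D E1 + num_passing a j D E2"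
        proof -
          have "{e \<in> E. \<forall>c<D. pass a j c e} = {e \<in> E1. \<forall>c<D. pass a j c e} \<union> {e \<in> E2. \<forall>c<D. pass a j c e}"
            using E12 by auto
          then show ?thesis unfolding num_passing_def using E12 fin by (simp add: card_Un_disjoint disjoint_iff)
        qed
        ultimately have pp: "stack_pot a j ?ws + 1 = stack_pot a j (ws @ [w])" unfolding pt by (simp add: l D')
        show ?thesis
        proof (rule Q[of _ ?ws])
          show "stack_pot a j ?ws < stack_pot a j (ws @ [w])" using pp by linarith
          show "t3 + 400 * stack_pot a j ?ws \<le> t + 350 + 400 * (stack_pot a j (ws @ [w]) - 1)" using pp 3(5) t2 by linarith
          have covered: "\<forall>e\<in>E0. (\<forall>c<d. pass a j c e) \<longrightarrow> e + j < n \<longrightarrow>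
            z' (e + j) \<le> x (e + a) - y (j - a) \<or> (\<exists>w\<in>set ?ws. e \<in> snd (snd (snd w)))"
            using z'(3) E12(1) by (auto simp: w)
          have "\<forall>i<length ?ws. ia s3 4 i = int (fst (?ws ! i))"
            using 3(4) True st(1) by (auto simp: nth_append less_Suc_eq)
          then show "stack_inv a j s E0 z s3 ?ws"
            unfolding stack_inv_def using 3 fr okw okc True covered z'(2) by auto
        qed
      next
        case False
        let ?ws = "ws @ [(3 * v + 1, l', D, E1)]"
        have "num_passing a j D E1 \<le> num_passing a j D E" using num_passing_mono finE E12(1) by blast
        then have pp: "stack_pot a j ?ws + 1 \<le> stack_pot a j (ws @ [w])" unfolding pt by (simp add: l D')
        \<comment> \<open>Keys in the upper half are at least that of the median, so they fail the
          same coordinate. The invariant demands nothing for them, and \<open>E2\<close> may leave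
          the stack.\<close>
        have np: "\<not> pass a j (D - 1) e" if "e \<in> E2" for e
          using False E12(6) that unfolding pass_def by (force split: if_splits)
        have nd: "\<not> (\<forall>c<d. pass a j c e)" if "e \<in> E2" for e using np[OF that] D r(3) by (metis Suc_le_lessD Suc_pred' )
        show ?thesis
        proof (rule Q[of _ ?ws])
          show "stack_pot a j ?ws < stack_pot a j (ws @ [w])" using pp by linarith
          show "t3 + 400 * stack_pot a j ?ws \<le> t + 350 + 400 * (stack_pot a j (ws @ [w]) - 1)" using pp 3(5) t2 by linarith
          have covered: "\<forall>e\<in>E0. (\<forall>c<d. pass a j c e) \<longrightarrow> e + j < n \<longrightarrow>
            z' (e + j) \<le> x (e + a) - y (j - a) \<or> (\<exists>w\<in>set ?ws. e \<in> snd (snd (snd w)))"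
            using z'(3) E12(1) nd by (auto simp: w)
          have "\<forall>i<length ?ws. ia s3 4 i = int (fst (?ws ! i))"
            using 3(4) False st(1) by (auto simp: nth_append less_Suc_eq)
          then show "stack_inv a j s E0 z s3 ?ws"
            unfolding stack_inv_def using 3 fr okw okc False covered z'(2) by auto
        qed
      qed
    qed (use iv0 ia0 in auto)
  qed
  have lb: "int (length ws) + 2 \<le> b" by (rule lw)
  have ia1: "ia s' (Suc 0) v = int D" using ia0(2) by simp
  have vb: "int v \<le> b" using v VI_n b_ge by linarith
  show ?thesis
  proof (cases "0 < D \<and> 0 < l")
    case True
    then obtain l' where l': "l = Suc l'" by (cases l) auto
    have "(1::int) < 2 ^ l" using True by simp
    then show ?thesis unfolding Visit_def using Br[OF _ _ l'] True lb b_ge n4096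
      by (simp add: com_len st ia0 ia1)
  next
    case False
    then have z0: "D = 0 \<or> l = 0" by auto
    then show ?thesis unfolding Visit_def using Rep[OF _ z0] False lb b_ge n4096
      by (auto simp add: com_len st ia0 ia1)
  qed
qed

text \<open>Adding one makes the recursion homogeneous:
  \<open>V(l+1,D+1) + 1 = (V(l,D) + 1) + (V(l,D+1) + 1)\<close>. It is solved by
  \<open>2^D * (3/2)^l\<close>; multiplication by \<open>2^l\<close> removes the fraction.\<close>

lemma visits_le: "(visits l D + 1) * 2 ^ l \<le> 2 * 2 ^ D * 3 ^ l"
proof (induction l D rule: visits.induct)
  case (1 D)
  have "2 \<le> 2 * (2::nat) ^ D" by simp
  then show ?case by (simp only: visits.simps power_0 mult_1_right one_add_one)
next
  case (2 l)
  have "(2::nat) ^ l \<le> 3 ^ l" by (intro power_mono) auto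
  then show ?case by simp
next
  case (3 l D)
  have "(visits (Suc l) (Suc D) + 1) * 2 ^ Suc l = 2 * ((visits l D + 1) * 2 ^ l) + 2 * ((visits l (Suc D) + 1) * 2 ^ l)"
    by (simp add: algebra_simps)
  also have "\<dots> \<le> 2 * (2 * 2 ^ D * 3 ^ l) + 2 * (2 * 2 ^ Suc D * 3 ^ l)"
    using 3 by (intro add_mono mult_left_mono) auto
  also have "\<dots> = 2 * 2 ^ Suc D * 3 ^ Suc l" by simp
  finally show ?case .
qed

abbreviation "root_visits \<equiv> visits (4 * d) d"

lemma visits_root_pow: "(root_visits + 1) * S \<le> 2 * 162 ^ d"
proof -
  have "(root_visits + 1) * 2 ^ (4 * d) \<le> 2 * 2 ^ d * 3 ^ (4 * d)" by (rule visits_le)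
  also have "\<dots> = 2 * 162 ^ d" by (simp add: power_mult flip: power_mult_distrib)
  finally show ?thesis by (simp add: S_def power_mult)
qed

lemma visits_root_le: "root_visits \<le> n"
proof -
  have "root_visits * 1 \<le> (root_visits + 1) * S" using S_pos by (intro mult_mono) auto
  then have "root_visits \<le> (root_visits + 1) * S" by simp
  also have "\<dots> \<le> 2 * 162 ^ d" by (rule visits_root_pow)
  also have "\<dots> \<le> 2 ^ d * 162 ^ d" using power_increasing[of 1 d "2::nat"] d1 by simp
  also have "\<dots> = 324 ^ d" by (simp flip: power_mult_distrib)
  also have "\<dots> \<le> 4096 ^ d" by (intro power_mono) auto
  finally show ?thesis using dn by simp
qed

lemma three_halves: "k * 2 ^ k \<le> 2 * (3::nat) ^ k"
proof (induction k)
  case (Suc k)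
  have "(2::nat) ^ k \<le> 3 ^ k" by (intro power_mono) auto
  have "Suc k * 2 ^ Suc k = 2 * (k * 2 ^ k) + 2 * 2 ^ k" by (simp add: algebra_simps)
  also have "\<dots> \<le> 2 * (2 * 3 ^ k) + 2 * 3 ^ k" using Suc \<open>2 ^ k \<le> 3 ^ k\<close> by linarith
  finally show ?case by simp
qed simp

text \<open>The key estimate: it makes \<open>d\<close> queries, one for each candidate, cost
  \<open>O(S)\<close> visits. The factor \<open>d\<close> is absorbed by
  \<open>d * 2^d \<le> 2 * 3^d\<close>, after which \<open>3 * 81 = 243\<close> is still below
  \<open>16 * 16 = 256\<close>.\<close>

lemma d_visits_root: "d * (root_visits + 1) \<le> 4 * S"
proof -
  have "(d * (root_visits + 1)) * S = d * ((root_visits + 1) * S)" by (rule mult.assoc)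
  also have "\<dots> \<le> d * (2 * 162 ^ d)" by (intro mult_left_mono visits_root_pow) simp
  also have "(162::nat) ^ d = 2 ^ d * 81 ^ d" by (simp flip: power_mult_distrib)
  also have "d * (2 * (2 ^ d * 81 ^ d)) = 2 * (d * 2 ^ d) * 81 ^ d" by simp
  also have "\<dots> \<le> 2 * (2 * 3 ^ d) * 81 ^ d" by (intro mult_right_mono mult_left_mono three_halves) auto
  also have "\<dots> = 4 * 243 ^ d" by (simp flip: power_mult_distrib)
  also have "\<dots> \<le> 4 * 256 ^ d" by (intro mult_left_mono power_mono) auto
  also have "\<dots> = 4 * S * S" by (simp add: S_def flip: power_mult_distrib)
  finally show ?thesis using S_pos by simp
qed

section \<open>Complete queries and the main loop\<close>

lemma wp_Query:
  assumes layout: "layout s z" and s: "iv s 8 = int a" "iv s 9 = int j"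
    and j: "j < n" "d \<le> j + 1" and a: "a < d" and E0: "\<forall>e\<in>E0. e + d \<le> n"
    and tree_rep: "tree_rep a (ia s) (4 * d) 0 d E0"
    and Q: "\<And>s' t' z'. \<lbrakk>\<forall>q<10. iv s' q = iv s q; \<forall>q<4. ia s' q = ia s q; layout s' z'; \<forall>k<n. z' k \<le> z k;
        \<forall>e\<in>E0. (\<forall>c<d. pass a j c e) \<longrightarrow> e + j < n \<longrightarrow> z' (e + j) \<le> x (e + a) - y (j - a);
        t' \<le> t + 400 * (root_visits + num_passing a j d E0) + 100\<rbrakk> \<Longrightarrow> Q s' t'"
  shows "wp b Query Q s t"
proof -
  let ?w = "(0, 4 * d, d, E0)"
  let ?p = "stack_pot a j [?w]"
  have pe: "?p = root_visits + num_passing a j d E0" by simp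
  have E: "finite E0" "card E0 = S" using tree_rep_node[OF tree_rep] node_list_card by (auto simp: S_def power_mult)
  have "num_passing a j d E0 \<le> S" unfolding num_passing_def E(2)[symmetric] using E(1) by (intro card_mono) auto
  then have pn: "?p \<le> 2 * n" unfolding pe using visits_root_le S_le_n by linarith
  let ?s1 = "s\<lparr>ia := (ia s)(4 := (ia s 4)(0 := 0)), iv := (iv s)(10 := 1)\<rparr>"
  have par1: "layout ?s1 z" by (rule layout_cong'[OF layout]) auto
  have loop: "wp b (While (C 0) (Vr 10) Visit) Q ?s1 t0" if t0: "t0 \<le> t + 50" for t0
  \<comment> \<open>Elapsed time plus 400 times the remaining potential never increases; the
    potential itself serves as the termination measure.\<close>
  proof (rule wp_While_measure[where k = ?p and
      I = "\<lambda>k s' t'. \<exists>ws. k = stack_pot a j ws \<and> stack_inv a j s E0 z s' ws \<and> stack_pot a j ws \<le> ?p \<and> t' + 400 * stack_pot a j ws \<le> t0 + 400 * ?p"])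
    show "\<exists>ws. ?p = stack_pot a j ws \<and> stack_inv a j s E0 z ?s1 ws \<and> stack_pot a j ws \<le> ?p \<and> t0 + 400 * stack_pot a j ws \<le> t0 + 400 * ?p"
    proof (intro exI[of _ "[?w]"] conjI)
      show "stack_inv a j s E0 z ?s1 [?w]"
        unfolding stack_inv_def using tree_rep par1 by (auto intro!: exI[of _ z])
    qed auto
    fix k t' and s' :: st
    assume "\<exists>ws. k = stack_pot a j ws \<and> stack_inv a j s E0 z s' ws \<and> stack_pot a j ws \<le> ?p \<and> t' + 400 * stack_pot a j ws \<le> t0 + 400 * ?p"
    then obtain ws where ws: "k = stack_pot a j ws" "stack_inv a j s E0 z s' ws" "stack_pot a j ws \<le> ?p" "t' + 400 * stack_pot a j ws \<le> t0 + 400 * ?p"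
      by blast
    have com_len: "iv s' 10 = int (length ws)" using ws(2) by (simp add: stack_inv_def)
    show "in_range b (C 0) s' \<and> in_range b (Vr 10) s' \<and> (aval (C 0) s' < aval (Vr 10) s' \<longrightarrow>
          wp b Visit (\<lambda>s'' t''. \<exists>k'<k. \<exists>ws. k' = stack_pot a j ws \<and> stack_inv a j s E0 z s'' ws \<and> stack_pot a j ws \<le> ?p \<and> t'' + 400 * stack_pot a j ws \<le> t0 + 400 * ?p)
            s' (t' + (elen (C 0) + elen (Vr 10) + 2))) \<and>
         (\<not> aval (C 0) s' < aval (Vr 10) s' \<longrightarrow> Q s' (t' + (elen (C 0) + elen (Vr 10) + 2)))"
    proof (intro conjI impI)
      show "in_range b (C 0) s'" "in_range b (Vr 10) s'" using b_ge n4096 by auto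
    next
      assume "aval (C 0) s' < aval (Vr 10) s'"
      then have "ws \<noteq> []" using com_len by auto
      then obtain us w where u: "ws = us @ [w]" by (metis rev_exhaust)
      have pp: "1 \<le> stack_pot a j ws" using length_le_stack_pot[of ws a j] u by simp
      have "length us + 1 \<le> 2 * n" using length_le_stack_pot[of ws a j] ws(3) pn u by simp
      then have lb: "int (length us) + 2 \<le> b" using b_ge n4096 by linarith
      show "wp b Visit (\<lambda>s'' t''. \<exists>k'<k. \<exists>ws. k' = stack_pot a j ws \<and> stack_inv a j s E0 z s'' ws \<and> stack_pot a j ws \<le> ?p \<and> t'' + 400 * stack_pot a j ws \<le> t0 + 400 * ?p)
            s' (t' + (elen (C 0) + elen (Vr 10) + 2))"
      proof (rule wp_Visit[OF s j a E0 ws(2)[unfolded u] lb])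
        fix s2 :: st and t2 vs
        assume 2: "stack_inv a j s E0 z s2 vs" "stack_pot a j vs < stack_pot a j (us @ [w])"
          "t2 + 400 * stack_pot a j vs \<le> t' + (elen (C 0) + elen (Vr 10) + 2) + 350 + 400 * (stack_pot a j (us @ [w]) - 1)"
        have "t2 + 400 * stack_pot a j vs \<le> t0 + 400 * ?p" using 2(3) ws(4) pp unfolding u[symmetric] elen.simps by linarith
        then show "\<exists>k'<k. \<exists>ws. k' = stack_pot a j ws \<and> stack_inv a j s E0 z s2 ws \<and> stack_pot a j ws \<le> ?p \<and> t2 + 400 * stack_pot a j ws \<le> t0 + 400 * ?p"
          using 2(1,2) ws(1,3) u by (intro exI[of _ "stack_pot a j vs"] conjI exI[of _ vs]) auto
      qed
    next
      assume "\<not> aval (C 0) s' < aval (Vr 10) s'"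
      then have "ws = []" using com_len by auto
      then obtain z' where "layout s' z'" "\<forall>k<n. z' k \<le> z k"
        "\<forall>e\<in>E0. (\<forall>c<d. pass a j c e) \<longrightarrow> e + j < n \<longrightarrow> z' (e + j) \<le> x (e + a) - y (j - a)"
        using ws(2) by (auto simp: stack_inv_def)
      then show "Q s' (t' + (elen (C 0) + elen (Vr 10) + 2))"
        using ws t0 \<open>ws = []\<close> by (intro Q) (auto simp: stack_inv_def)
    qed
  qed
  then show ?thesis unfolding Query_def using b_ge n4096 by simp
qed

text \<open>The guard \<open>d \<le> j + 1\<close> ensures \<open>c \<le> j\<close> for all
  \<open>c < d\<close>, so no subtraction \<open>j - c\<close> is truncated. Smaller shifts are left
  to the brute-force part.\<close>

definition covered :: "nat \<Rightarrow> nat \<Rightarrow> nat \<Rightarrow> (nat \<Rightarrow> real) \<Rightarrow> bool" where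
  "covered g a j z \<longleftrightarrow> (d \<le> j + 1 \<longrightarrow> (\<forall>e\<in>bases g. (\<forall>c<d. pass a j c e) \<longrightarrow> e + j < n \<longrightarrow> z (e + j) \<le> x (e + a) - y (j - a)))"

lemma covered_mono: "covered g a j z \<Longrightarrow> \<forall>k<n. z' k \<le> z k \<Longrightarrow> covered g a j z'"
  unfolding covered_def by (meson order_trans)

lemma bases_bound: "g < G \<Longrightarrow> \<forall>e\<in>bases g. e + d \<le> n"
  using bases_le by (auto simp: bases_def)

text \<open>Queries write only to the stack in array 4, so one tree serves all shifts.\<close>

lemma tree_rep_cong: "tree_rep a A l v D E \<Longrightarrow> \<forall>q<4. A' q = A q \<Longrightarrow> tree_rep a A' l v D E"
proof (induction l arbitrary: v D E)
  case 0
  then show ?case by (auto simp: node_list_def)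
next
  case (Suc l)
  have l: "node_list A' v m E = node_list A v m E" for m using Suc.prems(2) by (simp add: node_list_def)
  have e: "A' 0 = A 0" "A' 1 = A 1" "A' 2 = A 2" using Suc.prems(2) by auto
  have r: "tree_rep a A l v D E \<Longrightarrow> tree_rep a A' l v D E" for v D E using Suc.IH Suc.prems(2) by blast
  show ?case using Suc.prems(1) unfolding tree_rep.simps l e by (blast intro: r)
qed

text \<open>The reported pairs are kept as an explicit sum: for a single \<open>a\<close> they may
  be as many as \<open>n * S\<close>, and only the sum over all candidates is small.\<close>

definition query_time :: "nat \<Rightarrow> nat \<Rightarrow> nat" where
  "query_time g a = (\<Sum>j<n. 400 * (root_visits + num_passing a j d (bases g)) + 120) + (n + 1) * 12"

lemma wp_Queries:
  assumes layout: "layout s z" and s: "iv s 7 = int g" "iv s 8 = int a" and a: "a < d" and g: "g < G"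
    and tree_rep: "tree_rep a (ia s) (4 * d) 0 d (bases g)"
    and Q: "\<And>s' t' z'. \<lbrakk>\<forall>q<9. iv s' q = iv s q; layout s' z'; \<forall>k<n. z' k \<le> z k; \<forall>j<n. covered g a j z';
        t' \<le> t + query_time g a\<rbrakk> \<Longrightarrow> Q s' t'"
  shows "wp b Queries Q s t"
proof -
  have p: "iv s 0 = int n" "iv s 2 = int d" using layout by (auto simp: layout_def)
  define I where "I j s' \<longleftrightarrow> (\<forall>q<9. iv s' q = iv s q) \<and> (\<forall>q<4. ia s' q = ia s q) \<and>
     (\<exists>z'. layout s' z' \<and> (\<forall>k<n. z' k \<le> z k) \<and> (\<forall>i<j. covered g a i z'))" for j and s' :: st
  show ?thesis unfolding Queries_def
  proof (rule wp_For[where m = n and \<tau> = "\<lambda>j. 400 * (root_visits + num_passing a j d (bases g)) + 120" and I = I])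
    show "0 < b" "int n < b" using b_ge n4096 by linarith+
    have "layout (s\<lparr>iv := (iv s)(9 := 0)\<rparr>) z" by (rule layout_cong'[OF layout]) auto
    then show "I 0 (s\<lparr>iv := (iv s)(9 := 0)\<rparr>)" by (auto simp: I_def)
    show "in_range b (Vr 0) s' \<and> aval (Vr 0) s' = int n" if "I i s'" for i s' using that p by (simp add: I_def)
    fix j and t' :: nat and s' :: st
    assume I: "I j s'" and j: "iv s' 9 = int j" "j < n"
    then obtain z' where z': "layout s' z'" "\<forall>k<n. z' k \<le> z k" "\<forall>i<j. covered g a i z'"
       and I': "\<forall>q<9. iv s' q = iv s q" "\<forall>q<4. ia s' q = ia s q" by (auto simp: I_def)
    let ?Q = "loop_next 9 j (t' + (400 * (root_visits + num_passing a j d (bases g)) + 120)) I"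
    have iv': "iv s' 2 = int d" "iv s' 8 = int a" using I' p s by auto
    have query: "wp b Query ?Q s' t2" if t2: "t2 \<le> t' + 20" and dj: "d \<le> j + 1" for t2
    proof (rule wp_Query[OF z'(1) iv'(2) j(1,2) dj a bases_bound[OF g] tree_rep_cong[OF tree_rep I'(2)]])
      fix s3 :: st and t3 z3
      assume 3: "\<forall>q<10. iv s3 q = iv s' q" "\<forall>q<4. ia s3 q = ia s' q" "layout s3 z3" "\<forall>k<n. z3 k \<le> z' k"
        "\<forall>e\<in>bases g. (\<forall>c<d. pass a j c e) \<longrightarrow> e + j < n \<longrightarrow> z3 (e + j) \<le> x (e + a) - y (j - a)"
        "t3 \<le> t2 + 400 * (root_visits + num_passing a j d (bases g)) + 100"
      have "covered g a j z3" using 3(5) by (simp add: covered_def)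
      then have "\<forall>i<Suc j. covered g a i z3" using covered_mono z'(3) 3(4) by (auto simp: less_Suc_eq)
      moreover have "\<forall>k<n. z3 k \<le> z k" using 3(4) z'(2) order_trans by blast
      moreover have "layout (s3\<lparr>iv := (iv s3)(9 := int j + 1)\<rparr>) z3" by (rule layout_cong'[OF 3(3)]) auto
      ultimately show "?Q s3 t3" using 3(1,2,6) I' j t2 by (auto simp: I_def)
    qed
    have skip: "?Q s' t2" if t2: "t2 \<le> t' + 20" and dj: "\<not> d \<le> j + 1" for t2
    proof -
      have "covered g a j z'" using dj by (simp add: covered_def)
      then have "\<forall>i<Suc j. covered g a i z'" using z'(3) by (auto simp: less_Suc_eq)
      moreover have "layout (s'\<lparr>iv := (iv s')(9 := int j + 1)\<rparr>) z'" by (rule layout_cong'[OF z'(1)]) auto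
      ultimately show ?thesis using I' z'(2) j t2 by (auto simp: I_def)
    qed
    show "wp b (If (Vr 2) (Add (Vr 9) (C 2)) Query Skip) ?Q s' t'"
    proof (cases "d \<le> j + 1")
      case True
      then show ?thesis using query j b_ge n4096 by (simp add: iv')
    next
      case False
      then show ?thesis using skip[OF _ False, of "t' + 9"] j b_ge n4096 by (simp add: iv')
    qed
  next
    fix t' and s' :: st
    assume "I n s'" and t': "t' \<le> t + (\<Sum>j<n. 400 * (root_visits + num_passing a j d (bases g)) + 120) + (n + 1) * (elen (Vr 0) + 10)"
    then obtain z' where z': "layout s' z'" "\<forall>k<n. z' k \<le> z k" "\<forall>i<n. covered g a i z'"
       and I': "\<forall>q<9. iv s' q = iv s q" by (auto simp: I_def)
    show "Q s' t'" by (rule Q[OF I' z']) (use t' in \<open>simp add: query_time_def\<close>)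
  qed
qed

definition tree_time :: nat where "tree_time = VI * (S * (100 * S + 300) + 250) + 50 * S + 100"

lemma wp_Mainloop:
  assumes layout: "layout s z"
    and Q: "\<And>s' t' z'. \<lbrakk>layout s' z'; \<forall>k<n. z' k \<le> z k; \<forall>g<G. \<forall>a<d. \<forall>j<n. covered g a j z';
        t' \<le> t + (\<Sum>g<G. (\<Sum>a<d. tree_time + query_time g a) + (d + 1) * 12) + (G + 1) * 12\<rbrakk> \<Longrightarrow> Q s' t'"
  shows "wp b Mainloop Q s t"
proof -
  have p: "iv s 6 = int G" "iv s 2 = int d" using layout by (auto simp: layout_def)
  define I where "I i s' \<longleftrightarrow> (\<forall>q<7. iv s' q = iv s q) \<and>
     (\<exists>z'. layout s' z' \<and> (\<forall>k<n. z' k \<le> z k) \<and> (\<forall>g<i. \<forall>a<d. \<forall>j<n. covered g a j z'))" for i and s' :: st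
  have "G * 1 \<le> G * (S * d)" using S_pos d1 by (intro mult_left_mono) auto
  also have "\<dots> \<le> n" using GSd_le by (simp add: mult.assoc)
  finally have Gn: "G \<le> n" by simp
  have dn': "d \<le> n" using S_le_n d_le_S by linarith
  show ?thesis unfolding Mainloop_def
  proof (rule wp_For[where m = G and \<tau> = "\<lambda>g. (\<Sum>a<d. tree_time + query_time g a) + (d + 1) * 12" and I = I])
    show "0 < b" "int G < b" using b_ge n4096 Gn by linarith+
    have "layout (s\<lparr>iv := (iv s)(7 := 0)\<rparr>) z" by (rule layout_cong'[OF layout]) auto
    then show "I 0 (s\<lparr>iv := (iv s)(7 := 0)\<rparr>)" by (auto simp: I_def)
    show "in_range b (Vr 6) s' \<and> aval (Vr 6) s' = int G" if "I i s'" for i s' using that p by (simp add: I_def)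
    fix g and t' :: nat and s' :: st
    assume I: "I g s'" and g: "iv s' 7 = int g" "g < G"
    then obtain z0 where z0: "layout s' z0" "\<forall>k<n. z0 k \<le> z k" "\<forall>g'<g. \<forall>a<d. \<forall>j<n. covered g' a j z0"
       and I': "\<forall>q<7. iv s' q = iv s q" by (auto simp: I_def)
    define J where "J i s'' \<longleftrightarrow> (\<forall>q<8. iv s'' q = iv s' q) \<and>
       (\<exists>z'. layout s'' z' \<and> (\<forall>k<n. z' k \<le> z0 k) \<and> (\<forall>a<i. \<forall>j<n. covered g a j z'))" for i and s'' :: st
    show "wp b (For 8 (Vr 2) (Root ;; Build ;; Queries))
       (loop_next 7 g (t' + ((\<Sum>a<d. tree_time + query_time g a) + (d + 1) * 12)) I) s' t'"
    proof (rule wp_For[where m = d and \<tau> = "\<lambda>a. tree_time + query_time g a" and I = J])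
      show "0 < b" "int d < b" using b_ge n4096 dn' by linarith+
      have "layout (s'\<lparr>iv := (iv s')(8 := 0)\<rparr>) z0" by (rule layout_cong'[OF z0(1)]) auto
      then show "J 0 (s'\<lparr>iv := (iv s')(8 := 0)\<rparr>)" by (auto simp: J_def)
      show "in_range b (Vr 2) s'' \<and> aval (Vr 2) s'' = int d" if "J i s''" for i s'' using that p I' by (simp add: J_def)
      fix a and t2 :: nat and s2 :: st
      assume J: "J a s2" and a: "iv s2 8 = int a" "a < d"
      then obtain z2 where z2: "layout s2 z2" "\<forall>k<n. z2 k \<le> z0 k" "\<forall>a'<a. \<forall>j<n. covered g a' j z2"
         and J': "\<forall>q<8. iv s2 q = iv s' q" by (auto simp: J_def)
      have g2: "iv s2 7 = int g" using J' g by simp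
      show "wp b (Root ;; Build ;; Queries)
         (loop_next 8 a (t2 + (tree_time + query_time g a)) J) s2 t2"
        unfolding wp_Seq
      proof (rule wp_Tree[OF z2(1) g2 a(1,2) g(2)])
        fix s3 :: st and t3
        assume 3: "\<forall>j<9. iv s3 j = iv s2 j" "layout s3 z2" "tree_rep a (ia s3) (4 * d) 0 d (bases g)"
          "t3 \<le> t2 + VI * (S * (100 * S + 300) + 250) + 50 * S + 100"
        have g3: "iv s3 7 = int g" "iv s3 8 = int a" using 3(1) g2 a by auto
        show "wp b Queries
           (loop_next 8 a (t2 + (tree_time + query_time g a)) J) s3 t3"
        proof (rule wp_Queries[OF 3(2) g3 a(2) g(2) 3(3)])
          fix s4 :: st and t4 z4
          assume 4: "\<forall>q<9. iv s4 q = iv s3 q" "layout s4 z4" "\<forall>k<n. z4 k \<le> z2 k" "\<forall>j<n. covered g a j z4" "t4 \<le> t3 + query_time g a"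
          have "layout (s4\<lparr>iv := (iv s4)(8 := int a + 1)\<rparr>) z4" by (rule layout_cong'[OF 4(2)]) auto
          moreover have "\<forall>k<n. z4 k \<le> z0 k" using 4(3) z2(2) order_trans by blast
          moreover have "\<forall>a'<Suc a. \<forall>j<n. covered g a' j z4" using z2(3) 4(4) covered_mono[OF _ 4(3)] by (auto simp: less_Suc_eq)
          ultimately show "loop_next 8 a (t2 + (tree_time + query_time g a)) J s4 t4"
            using 4(1,5) 3(1,4) a J' by (auto simp: J_def tree_time_def)
        qed
      qed
    next
      fix t2 and s2 :: st
      assume "J d s2" and t2: "t2 \<le> t' + (\<Sum>a<d. tree_time + query_time g a) + (d + 1) * (elen (Vr 2) + 10)"
      then obtain z2 where z2: "layout s2 z2" "\<forall>k<n. z2 k \<le> z0 k" "\<forall>a'<d. \<forall>j<n. covered g a' j z2"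
         and J': "\<forall>q<8. iv s2 q = iv s' q" by (auto simp: J_def)
      have "layout (s2\<lparr>iv := (iv s2)(7 := int g + 1)\<rparr>) z2" by (rule layout_cong'[OF z2(1)]) auto
      moreover have "\<forall>k<n. z2 k \<le> z k" using z2(2) z0(2) order_trans by blast
      moreover have "\<forall>g'<Suc g. \<forall>a'<d. \<forall>j<n. covered g' a' j z2" using z2(3) z0(3) covered_mono[OF _ z2(2)] by (auto simp: less_Suc_eq)
      ultimately show "t2 \<le> t' + ((\<Sum>a<d. tree_time + query_time g a) + (d + 1) * 12) \<and> iv s2 7 = int g \<and> I (Suc g) (s2\<lparr>iv := (iv s2)(7 := int g + 1)\<rparr>)"
        using t2 J' I' g by (auto simp: I_def)
    qed
  next
    fix t' and s' :: st
    assume "I G s'" and t': "t' \<le> t + (\<Sum>g<G. (\<Sum>a<d. tree_time + query_time g a) + (d + 1) * 12) + (G + 1) * (elen (Vr 6) + 10)"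
    then obtain z' where z': "layout s' z'" "\<forall>k<n. z' k \<le> z k" "\<forall>g<G. \<forall>a<d. \<forall>j<n. covered g a j z'"
       by (auto simp: I_def)
    show "Q s' t'" by (rule Q[OF z']) (use t' in simp)
  qed
qed

end

lemma wp_Seq_ext: "wp b (c1 ;; c2) Q = wp b c1 (wp b c2 Q)"
  by (intro ext) simp

context conv
begin

section \<open>Running time and correctness\<close>

text \<open>Two indices \<open>a < a'\<close> cannot both pass for the same block: the weak test of
  \<open>a\<close> against \<open>a'\<close> and the strict test of \<open>a'\<close> against
  \<open>a\<close> are contradictory. So every block is counted for at most one candidate.\<close>

lemma sum_num_passing: "(\<Sum>a<d. num_passing a j d E) \<le> card E" if "finite E"
proof -
  let ?A = "\<lambda>a. {e \<in> E. \<forall>c<d. pass a j c e}"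
  have uniq: False if "a < a'" "a' < d" "e \<in> ?A a" "e \<in> ?A a'" for a a' e
  proof -
    have "pass a j a' e" "pass a' j a e" using that by auto
    then show False using that(1) by (simp add: pass_def key_x_def key_y_def)
  qed
  have "(\<Sum>a<d. num_passing a j d E) = card (\<Union>a<d. ?A a)"
    unfolding num_passing_def
  proof (rule card_UN_disjoint[symmetric])
    show "\<forall>i\<in>{..<d}. \<forall>k\<in>{..<d}. i \<noteq> k \<longrightarrow> ?A i \<inter> ?A k = {}"
    proof (intro ballI impI)
      fix i k assume "i \<in> {..<d}" "k \<in> {..<d}" "i \<noteq> k"
      then have "i < k \<and> k < d \<or> k < i \<and> i < d" by auto
      then show "?A i \<inter> ?A k = {}" using uniq by blast
    qed
  qed (use that in auto)
  also have "\<dots> \<le> card E" using that by (intro card_mono) auto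
  finally show ?thesis .
qed

lemma bases_card: "finite (bases g)" "card (bases g) = S"
  using bij_betw_same_card[OF bases_bij[of g]] by (auto simp: bases_def)

text \<open>Sorting costs about \<open>S^2\<close> at each of at most \<open>81^d\<close> inner
  nodes, for \<open>d\<close> candidates. From \<open>d \<le> 2^d\<close> and
  \<open>2 * 81 * 16 = 2592 \<le> 4096\<close> one factor \<open>S\<close> is swallowed together
  with \<open>d\<close> and \<open>81^d\<close> by \<open>n\<close>, which leaves
  \<open>n * S\<close>, the same order as the queries of a group.\<close>

lemma tree_time_le: "d * tree_time \<le> 800 * (n * S)"
proof -
  have V: "VI \<le> 81 ^ d" using VI_eq by (simp add: power_mult)
  have "d * 81 ^ d * S \<le> 2 ^ d * 81 ^ d * 16 ^ d" unfolding S_def using d_less by (intro mult_right_mono) auto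
  also have "\<dots> = 2592 ^ d" by (simp flip: power_mult_distrib)
  also have "\<dots> \<le> 4096 ^ d" by (intro power_mono) auto
  also have "\<dots> \<le> n" by (rule dn)
  finally have dV: "d * 81 ^ d * S \<le> n" .
  have SS: "S \<le> S * S" "1 \<le> S * S" using S_pos by auto
  have "S * (100 * S + 300) + 250 = 100 * (S * S) + 300 * S + 250" by (simp add: algebra_simps)
  also have "\<dots> \<le> 650 * (S * S)" using SS by linarith
  finally have "d * (VI * (S * (100 * S + 300) + 250)) \<le> d * (81 ^ d * (650 * (S * S)))"
    using V by (intro mult_left_mono mult_mono) auto
  also have "\<dots> = 650 * (d * 81 ^ d * S * S)" by simp
  also have "\<dots> \<le> 650 * (n * S)" using dV by (intro mult_left_mono mult_right_mono) auto
  finally have 1: "d * (VI * (S * (100 * S + 300) + 250)) \<le> 650 * (n * S)" .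
  have dn': "d \<le> n" using S_le_n d_le_S by linarith
  have "d * (50 * S + 100) \<le> n * (150 * S)" using dn' S_pos by (intro mult_mono) auto
  then have "d * (50 * S + 100) \<le> 150 * (n * S)" by simp
  then show ?thesis using 1 by (simp add: tree_time_def add_mult_distrib2)
qed

text \<open>Exchanging the sums over candidates and shifts lets the disjointness of the reports act
  for each fixed shift: they cost \<open>S\<close> per shift, not \<open>d * S\<close>. Visits meet
  the same bound by \<open>d_visits_root\<close>.\<close>

lemma group_time: "(\<Sum>a<d. tree_time + query_time g a) + (d + 1) * 12 \<le> 3000 * (n * S)"
proof -
  have c: "(\<Sum>a<d. \<Sum>j<n. num_passing a j d (bases g)) \<le> n * S"
  proof -
    have "(\<Sum>a<d. \<Sum>j<n. num_passing a j d (bases g)) = (\<Sum>j<n. \<Sum>a<d. num_passing a j d (bases g))" by (rule sum.swap)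
    also have "\<dots> \<le> (\<Sum>j<n. S)" using sum_num_passing[OF bases_card(1)] bases_card(2) by (intro sum_mono) metis
    finally show ?thesis by simp
  qed
  have "(\<Sum>a<d. query_time g a) = d * (n * (400 * root_visits + 120)) + 400 * (\<Sum>a<d. \<Sum>j<n. num_passing a j d (bases g)) + d * ((n + 1) * 12)"
    unfolding query_time_def by (simp add: sum.distrib sum_distrib_left algebra_simps)
  moreover have "d * (n * (400 * root_visits + 120)) \<le> 1600 * (n * S)"
  proof -
    have "d * (n * (400 * root_visits + 120)) \<le> d * (n * (400 * (root_visits + 1)))" by (intro mult_left_mono) auto
    also have "\<dots> = 400 * (n * (d * (root_visits + 1)))" by (simp add: algebra_simps)
    also have "\<dots> \<le> 400 * (n * (4 * S))" by (intro mult_left_mono d_visits_root) auto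
    finally show ?thesis by simp
  qed
  moreover have "d * ((n + 1) * 12) \<le> 24 * (n * S)"
  proof -
    have "d * ((n + 1) * 12) \<le> S * (2 * n * 12)" using d_le_S n4096 by (intro mult_mono) auto
    then show ?thesis by (simp only: mult_ac)
  qed
  moreover have "(d + 1) * 12 \<le> 12 * (n * S)"
  proof -
    have "(d + 1) * 12 \<le> S * 12" using d_le_S by simp
    also have "\<dots> \<le> (n * S) * 12" using n4096 by simp
    finally show ?thesis by simp
  qed
  moreover have "(\<Sum>a<d. tree_time + query_time g a) = d * tree_time + (\<Sum>a<d. query_time g a)" by (simp add: sum.distrib)
  ultimately show ?thesis using tree_time_le c by linarith
qed

text \<open>Multiplying by \<open>d\<close> keeps the estimate in the natural numbers. The
  inequality \<open>G * S * d \<le> n\<close> then turns \<open>G\<close> groups of cost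
  \<open>n * S\<close> into \<open>n * n\<close>.\<close>

lemma main_time: "d * ((\<Sum>g<G. (\<Sum>a<d. tree_time + query_time g a) + (d + 1) * 12) + (G + 1) * 12) \<le> 4000 * (n * n)"
proof -
  have "(\<Sum>g<G. (\<Sum>a<d. tree_time + query_time g a) + (d + 1) * 12) \<le> (\<Sum>g<G. 3000 * (n * S))"
    by (intro sum_mono group_time)
  then have "d * (\<Sum>g<G. (\<Sum>a<d. tree_time + query_time g a) + (d + 1) * 12) \<le> d * (G * (3000 * (n * S)))"
    by (intro mult_left_mono) auto
  also have "\<dots> = 3000 * (n * (G * S * d))" by simp
  also have "\<dots> \<le> 3000 * (n * n)" by (intro mult_left_mono GSd_le) auto
  finally have 1: "d * (\<Sum>g<G. (\<Sum>a<d. tree_time + query_time g a) + (d + 1) * 12) \<le> 3000 * (n * n)" .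
  have "G * 1 * d \<le> G * S * d" using S_pos by (intro mult_right_mono mult_left_mono) auto
  also have "\<dots> \<le> n" by (rule GSd_le)
  finally have "G * d \<le> n" by simp
  moreover have "d \<le> n" using S_le_n d_le_S by linarith
  moreover have "d * ((G + 1) * 12) = 12 * (G * d) + 12 * d" by (simp add: algebra_simps)
  moreover have "24 * n \<le> n * n" using n4096 by (intro mult_right_mono) auto
  ultimately have "d * ((G + 1) * 12) \<le> n * n" by linarith
  then show ?thesis using 1 by (simp add: add_mult_distrib2)
qed

section \<open>Every candidate index is covered by a block or by a boundary term\<close>

definition brute_covered :: "nat \<Rightarrow> nat \<Rightarrow> (nat \<Rightarrow> real) \<Rightarrow> bool" where
  "brute_covered k t z \<longleftrightarrow> (t \<le> k \<longrightarrow> z k \<le> x (k - t) - y t) \<and>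
     (G * S * d + t \<le> k \<longrightarrow> z k \<le> x (G * S * d + t) - y (k - (G * S * d + t)))"

lemma brute_covered_mono: "brute_covered k t z \<Longrightarrow> \<forall>k<n. z' k \<le> z k \<Longrightarrow> k < n \<Longrightarrow> brute_covered k t z'"
  unfolding brute_covered_def by (meson order_trans)

text \<open>The least minimiser passes every test: strictly against smaller indices, by leastness,
  and weakly against the others, by minimality.\<close>

lemma pass_ex: "\<exists>a<d. \<forall>c<d. pass a j c e"
proof -
  define v where "v c = x (e + c) - y (j - c)" for c
  define m where "m = Min (v ` {..<d})"
  have fin: "finite (v ` {..<d})" "v ` {..<d} \<noteq> {}" using d1 by (auto simp: lessThan_empty_iff)
  have le: "m \<le> v c" if "c < d" for c using that fin unfolding m_def by (intro Min_le) auto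
  have "m \<in> v ` {..<d}" unfolding m_def by (rule Min_in[OF fin])
  then have ex: "\<exists>a. a < d \<and> v a = m" by auto
  define a where "a = (LEAST a. a < d \<and> v a = m)"
  have a: "a < d" "v a = m" using LeastI_ex[OF ex] by (auto simp: a_def)
  have "pass a j c e" if c: "c < d" for c
  proof (cases "c < a")
    case True
    then have "v c \<noteq> m" using not_less_Least[of c "\<lambda>a. a < d \<and> v a = m"] c by (auto simp: a_def)
    then have "v a < v c" using le[OF c] a by simp
    then show ?thesis using True by (simp add: pass_def key_x_def key_y_def v_def)
  next
    case False
    then show ?thesis using le[OF c] a by (simp add: pass_def key_x_def key_y_def v_def)
  qed
  then show ?thesis using a by blast
qed

text \<open>Either \<open>i\<close> is within \<open>d\<close> of \<open>k\<close>, or it lies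
  behind the last full group, or it belongs to a full block. In the last case the block starts at
  \<open>e\<close>, the multiple of \<open>d\<close> reached by rounding \<open>i\<close> down, and
  the shift \<open>j = k - e\<close> is at least \<open>k - i\<close>, hence large enough for the
  trees.\<close>

lemma all_covered:
  assumes c: "\<forall>g<G. \<forall>a<d. \<forall>j<n. covered g a j z" and bc: "\<forall>k<n. \<forall>t<S * d. brute_covered k t z"
    and k: "k < n" "i \<le> k"
  shows "z k \<le> x i - y (k - i)"
proof -
  have Sd: "0 < S * d" using S_pos d1 by simp
  have dS: "d \<le> S * d" using S_pos by simp
  have nG: "n < G * S * d + S * d" unfolding G_def using dividend_less_div_times[OF Sd, of n] by (simp add: mult.assoc add.commute)
  consider "k - i < d" | "G * S * d \<le> i" | "d \<le> k - i" "i < G * S * d" by linarith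
  then show ?thesis
  proof cases
    case 1
    then have "k - i < S * d" using dS by linarith
    then have "brute_covered k (k - i) z" using bc k by blast
    then show ?thesis using k by (simp add: brute_covered_def)
  next
    case 2
    then have "i - G * S * d < S * d" using k nG by linarith
    then have "brute_covered k (i - G * S * d) z" using bc k by blast
    then show ?thesis using 2 k by (simp add: brute_covered_def)
  next
    case 3
    define q where "q = i div d"
    define g where "g = q div S"
    define r where "r = q mod S"
    define e where "e = q * d"
    define j where "j = k - e"
    have q: "q < G * S" using 3(2) by (simp add: q_def less_mult_imp_div_less)
    then have g: "g < G" by (simp add: g_def less_mult_imp_div_less)
    have r: "r < S" "q = g * S + r" using S_pos by (auto simp: g_def r_def)
    have eE: "e \<in> bases g" using r by (auto simp: bases_def e_def)
    have ei: "e + i mod d = i" by (simp add: e_def q_def)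
    have md: "i mod d < d" using d1 by simp
    have ej: "e + j = k" "j < n" "d \<le> j + 1" "j - i mod d = k - i" using ei k 3 by (auto simp: j_def)
    obtain a where a: "a < d" "\<forall>c<d. pass a j c e" using pass_ex by blast
    have "z k \<le> x (e + a) - y (j - a)" using c g a eE ej k unfolding covered_def by blast
    \<comment> \<open>The test for coordinate \<open>i mod d\<close>, strict or weak, is rearranged
      back from differences within \<open>x\<close> and within \<open>y\<close> into a comparison of
      two candidates for entry \<open>k\<close>.\<close>
    also have "\<dots> \<le> x (e + i mod d) - y (j - i mod d)"
      using a(2) md by (force simp: pass_def key_x_def key_y_def split: if_splits)
    finally show ?thesis using ei ej by simp
  qed
qed

lemma wp_Brute:
  assumes layout: "layout s z"
    and Q: "\<And>s' t' z'. \<lbrakk>layout s' z'; \<forall>k<n. z' k \<le> z k; \<forall>k<n. \<forall>i<S * d. brute_covered k i z';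
        t' \<le> t + n * (S * d * 260 + 60) + 100\<rbrakk> \<Longrightarrow> Q s' t'"
  shows "wp b Brute Q s t"
proof -
  have p: "iv s 0 = int n" "iv s 2 = int d" "iv s 4 = int S" "iv s 6 = int G" using layout by (auto simp: layout_def)
  define I where "I i s' \<longleftrightarrow> (\<forall>q<7. iv s' q = iv s q) \<and>
     (\<exists>z'. layout s' z' \<and> (\<forall>k<n. z' k \<le> z k) \<and> (\<forall>k<i. \<forall>t<S * d. brute_covered k t z'))" for i and s' :: st
  have dn': "d \<le> n" using S_le_n d_le_S by linarith
  have ints: "int S * int d = int (S * d)" "int G * int S = int (G * S)" "int (G * S) * int d = int (G * S * d)" by (simp_all only: of_nat_mult)
  have "G * S * 1 \<le> G * S * d" using d1 by (intro mult_left_mono) auto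
  then have "G * S \<le> n" using GSd_le by linarith
  then have bds: "int (S * d) \<le> int n" "int (G * S) \<le> int n" "int (G * S * d) \<le> int n" using Sd_le GSd_le by linarith+
  show ?thesis unfolding Brute_def
  proof (rule wp_For[where m = n and \<tau> = "\<lambda>_. S * d * 260 + 40" and I = I])
    show "0 < b" "int n < b" using b_ge n4096 by linarith+
    have "layout (s\<lparr>iv := (iv s)(7 := 0)\<rparr>) z" by (rule layout_cong'[OF layout]) auto
    then show "I 0 (s\<lparr>iv := (iv s)(7 := 0)\<rparr>)" by (auto simp: I_def)
    show "in_range b (Vr 0) s' \<and> aval (Vr 0) s' = int n" if "I i s'" for i s' using that p by (simp add: I_def)
    fix k and t' :: nat and s' :: st
    assume I: "I k s'" and k: "iv s' 7 = int k" "k < n"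
    then obtain z0 where z0: "layout s' z0" "\<forall>k<n. z0 k \<le> z k" "\<forall>k'<k. \<forall>t<S * d. brute_covered k' t z0"
       and I': "\<forall>q<7. iv s' q = iv s q" by (auto simp: I_def)
    define J where "J i s'' \<longleftrightarrow> (\<forall>q<8. iv s'' q = iv s' q) \<and> iv s'' 26 = int k \<and>
       (\<exists>z'. layout s'' z' \<and> (\<forall>k<n. z' k \<le> z0 k) \<and> (\<forall>t<i. brute_covered k t z'))" for i and s'' :: st
    let ?body = "Asg 25 (Sub (Vr 7) (Vr 8)) ;; If (Vr 25) (C 0) Skip Upd ;;
      Asg 25 (Add (Mul (Mul (Vr 6) (Vr 4)) (Vr 2)) (Vr 8)) ;; If (Vr 7) (Vr 25) Skip Upd"
    let ?Q = "loop_next 7 k (t' + (S * d * 260 + 40)) I"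
    let ?s1 = "s'\<lparr>iv := (iv s')(26 := int k)\<rparr>"
    have "wp b (For 8 (Mul (Vr 4) (Vr 2)) ?body) ?Q ?s1 t0" if t0: "t0 \<le> t' + 5" for t0
    proof (rule wp_For[where m = "S * d" and \<tau> = "\<lambda>_. 230" and I = J])
      show "0 < b" "int (S * d) < b" using b_ge n4096 bds by linarith+
      have "layout (?s1\<lparr>iv := (iv ?s1)(8 := 0)\<rparr>) z0" by (rule layout_cong'[OF z0(1)]) auto
      then show "J 0 (?s1\<lparr>iv := (iv ?s1)(8 := 0)\<rparr>)" by (auto simp: J_def)
      show "in_range b (Mul (Vr 4) (Vr 2)) s'' \<and> aval (Mul (Vr 4) (Vr 2)) s'' = int (S * d)" if "J i s''" for i s''
        using that p I' bds b_ge n4096 by (simp add: J_def ints(1) del: of_nat_mult)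
      fix i and t2 :: nat and s2 :: st
      assume J: "J i s2" and i: "iv s2 8 = int i" "i < S * d"
      then obtain z2 where z2: "layout s2 z2" "\<forall>k<n. z2 k \<le> z0 k" "\<forall>t<i. brute_covered k t z2"
         and J': "\<forall>q<8. iv s2 q = iv s' q" "iv s2 26 = int k" by (auto simp: J_def)
      have iv2: "iv s2 7 = int k" "iv s2 6 = int G" "iv s2 4 = int S" "iv s2 2 = int d" using J' k I' p by auto
      let ?R = "loop_next 8 i (t2 + 230) J"
      let ?c2 = "Asg 25 (Add (Mul (Mul (Vr 6) (Vr 4)) (Vr 2)) (Vr 8)) ;; If (Vr 7) (Vr 25) Skip Upd"
      have second: "wp b ?c2 ?R s3 t3"
        if 3: "t3 \<le> t2 + 100" "iv s3 = (iv s2)(25 := f)" "layout s3 z3" "\<forall>k<n. z3 k \<le> z2 k" "i \<le> k \<longrightarrow> z3 k \<le> x (k - i) - y i" for s3 :: st and t3 z3 f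
      proof -
        let ?o = "G * S * d + i"
        let ?s4 = "s3\<lparr>iv := (iv s3)(25 := int ?o)\<rparr>"
        have par4: "layout ?s4 z3" by (rule layout_cong'[OF 3(3)]) auto
        have fin: "?R s5 t5" if 5: "iv s5 = iv ?s4" "layout s5 z5" "\<forall>k<n. z5 k \<le> z3 k" "?o \<le> k \<longrightarrow> z5 k \<le> x ?o - y (k - ?o)" "t5 \<le> t2 + 230" for s5 t5 z5
        proof -
          have "layout (s5\<lparr>iv := (iv s5)(8 := int i + 1)\<rparr>) z5" by (rule layout_cong'[OF 5(2)]) auto
          moreover have "\<forall>k<n. z5 k \<le> z0 k" using 5(3) 3(4) z2(2) by (blast intro: order_trans)
          moreover have "z5 k \<le> z3 k" using 5(3) k by blast
          then have "brute_covered k i z5" unfolding brute_covered_def using 3(5) 5(4) by linarith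
          moreover have z52: "\<forall>k<n. z5 k \<le> z2 k" using 5(3) 3(4) order_trans by blast
          have "\<forall>t<i. brute_covered k t z5" using z2(3) brute_covered_mono[OF _ z52 k(2)] by blast
          ultimately show ?thesis using 5(1,5) 3(2) J' i k by (auto simp: J_def less_Suc_eq)
        qed
        have upd: "wp b Upd ?R ?s4 t4" if "t4 \<le> t2 + 150" "?o \<le> k" for t4
        proof (rule wp_Upd[OF par4, where i = ?o and k = k])
          fix s5 :: st and t5 z5
          assume 5: "layout s5 z5" "iv s5 = iv ?s4" "\<forall>j<n. z5 j \<le> z3 j" "z5 k \<le> x ?o - y (k - ?o)" "t5 \<le> t4 + 60"
          show "?R s5 t5" by (rule fin[OF 5(2,1,3)]) (use 5(4,5) that in auto)
        qed (use that 3(2) J' k in auto)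
        have skip: "?R ?s4 t4" if "t4 \<le> t2 + 150" "\<not> ?o \<le> k" for t4
          by (rule fin[of _ z3]) (use that par4 in auto)
        have iv3: "iv s3 8 = int i" "iv s3 7 = int k" "iv s3 6 = int G" "iv s3 4 = int S" "iv s3 2 = int d" using 3(2) i iv2 by auto
        have ieq: "int G * int S * int d + int i = int ?o" by simp
        have okk: "\<bar>int G * int S\<bar> \<le> b" "\<bar>int G * int S * int d\<bar> \<le> b" "\<bar>int G * int S * int d + int i\<bar> \<le> b"
          unfolding ieq using bds b_ge i n4096 by (auto simp: ints simp del: of_nat_mult)
        show ?thesis
        proof (cases "?o \<le> k")
          case True
          then have "\<not> int k < int ?o" by linarith
          then show ?thesis using upd[OF _ True] 3(1) okk by (simp add: iv3 ieq del: of_nat_add of_nat_mult)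
        next
          case False
          then have "int k < int ?o" by linarith
          then show ?thesis using skip[OF _ False, of t2] 3(1) okk by (simp add: iv3 ieq del: of_nat_add of_nat_mult)
        qed
      qed
      let ?s3 = "s2\<lparr>iv := (iv s2)(25 := int k - int i)\<rparr>"
      have par3: "layout ?s3 z2" by (rule layout_cong'[OF z2(1)]) auto
      have kb: "\<bar>int k - int i\<bar> \<le> b" using k i bds b_ge by linarith
      define W where "W = wp b ?c2 ?R"
      have split: "wp b ?body ?R s2 t2 \<longleftrightarrow> wp b (Asg 25 (Sub (Vr 7) (Vr 8))) (wp b (If (Vr 25) (C 0) Skip Upd) W) s2 t2"
        by (simp only: wp_Seq_ext W_def)
      show "wp b ?body ?R s2 t2"
      proof (cases "i \<le> k")
        case True
        have "wp b Upd W ?s3 t3" if t3: "t3 \<le> t2 + 30" for t3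
        proof (rule wp_Upd[OF par3, where i = "k - i" and k = k])
          fix s4 :: st and t4 z4
          assume 4: "layout s4 z4" "iv s4 = iv ?s3" "\<forall>j<n. z4 j \<le> z2 j" "z4 k \<le> x (k - i) - y (k - (k - i))" "t4 \<le> t3 + 60"
          show "W s4 t4" unfolding W_def
            by (rule second[of _ _ "int k - int i" z4]) (use 4 t3 True in auto)
        qed (use True J' k in auto)
        then show ?thesis unfolding split using True kb b_ge n4096 by (simp add: iv2 i)
      next
        case False
        have "W ?s3 t3" if t3: "t3 \<le> t2 + 30" for t3 unfolding W_def
          by (rule second[of _ _ "int k - int i" z2]) (use t3 False par3 in auto)
        then show ?thesis unfolding split using False kb b_ge n4096 by (simp add: iv2 i)
      qed
    next
      fix t2 and s2 :: st
      assume "J (S * d) s2" and t2: "t2 \<le> t0 + (\<Sum>i<S * d. 230) + (S * d + 1) * (elen (Mul (Vr 4) (Vr 2)) + 10)"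
      then obtain z2 where z2: "layout s2 z2" "\<forall>k<n. z2 k \<le> z0 k" "\<forall>t<S * d. brute_covered k t z2"
         and J': "\<forall>q<8. iv s2 q = iv s' q" by (auto simp: J_def)
      have "layout (s2\<lparr>iv := (iv s2)(7 := int k + 1)\<rparr>) z2" by (rule layout_cong'[OF z2(1)]) auto
      moreover have "\<forall>k<n. z2 k \<le> z k" using z2(2) z0(2) order_trans by blast
      moreover have "brute_covered k' t z2" if "k' < Suc k" "t < S * d" for k' t
        using that z2(2,3) z0(3) brute_covered_mono[of k' t z0 z2] k by (cases "k' = k") auto
      moreover have "t2 \<le> t' + (S * d * 260 + 40)" using t2 t0 by (simp add: algebra_simps)
      ultimately show "?Q s2 t2" using J' I' k by (auto simp: I_def)
    qed
    then show "wp b (Asg 26 (Vr 7) ;; For 8 (Mul (Vr 4) (Vr 2)) ?body) ?Q s' t'"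
      unfolding wp_Seq[of b "Asg 26 (Vr 7)"] wp_simps(1) in_range.simps aval.simps elen.simps k(1) by simp
  next
    fix t' and s' :: st
    assume "I n s'" and t': "t' \<le> t + (\<Sum>i<n. S * d * 260 + 40) + (n + 1) * (elen (Vr 0) + 10)"
    then obtain z' where z': "layout s' z'" "\<forall>k<n. z' k \<le> z k" "\<forall>k<n. \<forall>i<S * d. brute_covered k i z'"
       by (auto simp: I_def)
    show "Q s' t'" by (rule Q[OF z']) (use t' in \<open>simp add: algebra_simps\<close>)
  qed
qed

end

text \<open>
  The input occupies the scratch registers. The first iteration moves register 0 onto itself before storing it, so
  no input is lost; dually, \<open>Output\<close> writes register 0 last. The maximum is reduced to the minimum by the factor
  \<open>\<sigma> = -1\<close> on input and output.
\<close>

definition Copy :: com where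
  "Copy = For 7 (Mul (C 2) (Vr 0)) (RLd 0 (Vr 7) ;; RSt (Add (Mul (C 2) (Vr 0)) (Vr 7)) 0)"

definition Scale :: "nat \<Rightarrow> expr \<Rightarrow> com" where
  "Scale k e = For 7 e (RLd 0 (Add (Mul (C (int k)) (Vr 0)) (Vr 7)) ;; RMl 0 0 1 ;;
     RSt (Add (Mul (C (int k)) (Vr 0)) (Vr 7)) 0)"

text \<open>The map \<open>v \<mapsto> 81 * v + 40\<close> takes \<open>(81^c - 1) / 2\<close> to
  \<open>(81^(c+1) - 1) / 2\<close>, so the number of inner nodes is obtained along with the
  powers.\<close>

definition Params_step :: com where
  "Params_step = Asg 3 (Mul (Vr 3) (C 4096)) ;; Asg 2 (Add (Vr 2) (C 1)) ;; Asg 4 (Mul (Vr 4) (C 16)) ;;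
    Asg 5 (Add (Mul (C 81) (Vr 5)) (C 40))"

text \<open>The loop continues while the next power of 4096 is at most \<open>n\<close>, so it ends
  with the largest admissible \<open>d\<close>; the length of the blocks is thus found by integer
  arithmetic alone.\<close>

definition Params :: com where
  "Params = Asg 2 (C 0) ;; Asg 3 (C 1) ;; Asg 4 (C 1) ;; Asg 5 (C 0) ;;
    While (Mul (Vr 3) (C 4096)) (Add (Vr 0) (C 1))
     Params_step ;;
    Asg 6 (Dv (Vr 0) (Mul (Vr 4) (Vr 2)))"

text \<open>The initial value \<open>x 0 - y k\<close> is the candidate with index 0. Starting from
  a genuine candidate takes the place of an infinite value and establishes the last clause of
  \<open>layout\<close>.\<close>

definition InitZ :: com where
  "InitZ = For 7 (Vr 0) (RLd 0 (Mul (C 2) (Vr 0)) ;; RLd 1 (Add (Mul (C 3) (Vr 0)) (Vr 7)) ;;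
    RSb 0 0 1 ;; RSt (Add (Mul (C 4) (Vr 0)) (Vr 7)) 0)"

definition Output :: com where
  "Output = For 7 (Vr 0) (Asg 8 (Sub (Sub (Vr 0) (C 1)) (Vr 7)) ;;
     RLd 0 (Add (Mul (C 4) (Vr 0)) (Vr 8)) ;; RSt (Vr 8) 0)"

definition Algo :: "int \<Rightarrow> com" where
  "Algo \<sigma> = Copy ;; RFI 1 (C \<sigma>) ;; Scale 2 (Mul (C 2) (Vr 0)) ;; Params ;; InitZ ;; Brute ;; Mainloop ;;
     RFI 1 (C \<sigma>) ;; Scale 4 (Vr 0) ;; Output"

section \<open>Correctness of the preparation, the output and the whole program\<close>

context conv
begin

lemma wp_Copy:
  assumes s: "iv s 0 = int n"
    and Q: "\<And>s' t'. \<lbrakk>iv s' 0 = int n; \<forall>i<2 * n. rm s' (2 * n + i) = rm s i; t' \<le> t + 60 * n + 60\<rbrakk> \<Longrightarrow> Q s' t'"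
  shows "wp b Copy Q s t"
proof -
  define I where "I i s' \<longleftrightarrow> iv s' 0 = int n \<and> (\<forall>j<i. rm s' (2 * n + j) = rm s j) \<and>
     (\<forall>j. 0 < j \<and> j < 2 * n \<longrightarrow> rm s' j = rm s j) \<and> (i = 0 \<longrightarrow> rm s' 0 = rm s 0)" for i and s' :: st
  show ?thesis unfolding Copy_def
  proof (rule wp_For[where m = "2 * n" and \<tau> = "\<lambda>_. 15" and I = I])
    show "0 < b" "int (2 * n) < b" using b_ge n4096 by auto
    show "I 0 (s\<lparr>iv := (iv s)(7 := 0)\<rparr>)" using s by (simp add: I_def)
    show "in_range b (Mul (C 2) (Vr 0)) s' \<and> aval (Mul (C 2) (Vr 0)) s' = int (2 * n)" if "I i s'" for i s'
      using that b_ge n4096 by (simp add: I_def)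
    fix i and t' :: nat and s' :: st
    assume I: "I i s'" and i: "iv s' 7 = int i" "i < 2 * n"
    have r: "rm s' i = rm s i" using I i by (cases "i = 0") (auto simp: I_def)
    show "wp b (RLd 0 (Vr 7) ;; RSt (Add (Mul (C 2) (Vr 0)) (Vr 7)) 0)
      (loop_next 7 i (t' + 15) I) s' t'"
      using I i r b_ge n4096 by (auto simp: I_def nat_simps less_Suc_eq)
  next
    fix t' and s' :: st
    assume "I (2 * n) s'" "t' \<le> t + (\<Sum>i<2 * n. 15) + (2 * n + 1) * (elen (Mul (C 2) (Vr 0)) + 10)"
    then show "Q s' t'" by (intro Q) (auto simp: I_def)
  qed
qed

lemma wp_Scale:
  assumes s: "iv s 0 = int n" and k: "2 \<le> k" "k \<le> 4" and m: "m \<le> 2 * n" "elen e \<le> 10"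
    and e: "\<And>s'. iv s' 0 = int n \<Longrightarrow> in_range b e s' \<and> aval e s' = int m"
    and Q: "\<And>s' t'. \<lbrakk>\<forall>q<7. iv s' q = iv s q; \<forall>i<m. rm s' (k * n + i) = rm s (k * n + i) * rm s 1;
        t' \<le> t + 60 * m + 60\<rbrakk> \<Longrightarrow> Q s' t'"
  shows "wp b (Scale k e) Q s t"
proof -
  define I where "I i s' \<longleftrightarrow> (\<forall>q<7. iv s' q = iv s q) \<and> rm s' 1 = rm s 1 \<and>
     (\<forall>j<m. rm s' (k * n + j) = (if j < i then rm s (k * n + j) * rm s 1 else rm s (k * n + j)))" for i and s' :: st
  have kn: "4096 \<le> k * n" using k n4096 by (metis le_trans mult_le_mono1 nat_mult_1 one_le_numeral)
  have kn4: "k * n \<le> 4 * n" using k by simp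
  have kni: "\<bar>int k * int n\<bar> \<le> b" "\<bar>int k * int n + int i\<bar> \<le> b" if "i < m" for i
  proof -
    have "int k * int n = int (k * n)" by simp
    then show "\<bar>int k * int n\<bar> \<le> b" "\<bar>int k * int n + int i\<bar> \<le> b" using kn4 m that b_ge by linarith+
  qed
  have nk: "nat (int k * int n + int i) = k * n + i" for i
    by (simp only: of_nat_add[symmetric] of_nat_mult[symmetric] nat_int)
  show ?thesis unfolding Scale_def
  proof (rule wp_For[where m = m and \<tau> = "\<lambda>_. 30" and I = I])
    show "0 < b" "int m < b" using b_ge n4096 m by linarith+
    show "I 0 (s\<lparr>iv := (iv s)(7 := 0)\<rparr>)" using s by (simp add: I_def)
    show "in_range b e s' \<and> aval e s' = int m" if "I i s'" for i s' using that s by (intro e) (simp add: I_def)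
    fix i and t' :: nat and s' :: st
    assume I: "I i s'" and i: "iv s' 7 = int i" "i < m"
    have iv': "iv s' 0 = int n" using I s by (simp add: I_def)
    have ne: "k * n + i \<noteq> 0" "k * n + i \<noteq> Suc 0" using kn by linarith+
    have ne': "k * n + j \<noteq> 0" "k * n + j \<noteq> Suc 0" for j using kn by linarith+
    show "wp b (RLd 0 (Add (Mul (C (int k)) (Vr 0)) (Vr 7)) ;; RMl 0 0 1 ;; RSt (Add (Mul (C (int k)) (Vr 0)) (Vr 7)) 0)
      (loop_next 7 i (t' + 30) I) s' t'"
      using I i kni[OF i(2)] k b_ge n4096 ne'[of i] ne'[of 0] n4096
      by (auto simp: I_def iv' nk ne' ne'[THEN not_sym] less_Suc_eq)
  next
    fix t' and s' :: st
    assume I: "I m s'" and t': "t' \<le> t + (\<Sum>i<m. 30) + (m + 1) * (elen e + 10)"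
    have "(m + 1) * (elen e + 10) \<le> (m + 1) * 20" using m(2) by (intro mult_left_mono) auto
    then show "Q s' t'" using I t' by (intro Q) (auto simp: I_def)
  qed
qed

lemma wp_Params:
  assumes s: "iv s 0 = int n" and nd: "n < 4096 ^ Suc d"
    and Q: "\<And>s' t'. \<lbrakk>iv s' 0 = int n; iv s' 2 = int d; iv s' 4 = int S; iv s' 5 = int VI; iv s' 6 = int G; rm s' = rm s;
        t' \<le> t + 60 * d + 60\<rbrakk> \<Longrightarrow> Q s' t'"
  shows "wp b Params Q s t"
proof -
  \<comment> \<open>Register 5 is described by \<open>2 * v + 1 = 81 ^ c\<close>, a form without
    division that is visibly preserved:
    \<open>2 * (81 * v + 40) + 1 = 81 * (2 * v + 1)\<close>.\<close>
  let ?I = "\<lambda>k s' t'. \<exists>c. k = d - c \<and> c \<le> d \<and> iv s' 0 = int n \<and> iv s' 2 = int c \<and> iv s' 3 = 4096 ^ c \<and> iv s' 4 = 16 ^ c \<and>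
     2 * iv s' 5 + 1 = 81 ^ c \<and> rm s' = rm s \<and> t' \<le> t + 15 + 60 * c"
  let ?s1 = "s\<lparr>iv := (iv s)(2 := 0, 3 := 1, 4 := 1, 5 := 0)\<rparr>"
  let ?W = "wp b (Asg 6 (Dv (Vr 0) (Mul (Vr 4) (Vr 2)))) Q"
  have pw: "(4096::int) ^ c \<le> int n" "(16::int) ^ c \<le> int n" "(81::int) ^ c \<le> int n" if "c \<le> d" for c
  proof -
    have "(4096::nat) ^ c \<le> 4096 ^ d" using that by (intro power_increasing) auto
    then have *: "(4096::nat) ^ c \<le> n" using dn by linarith
    then have "int (4096 ^ c) \<le> int n" by (simp only: of_nat_le_iff)
    then show 1: "(4096::int) ^ c \<le> int n" by simp
    have "(16::int) ^ c \<le> 4096 ^ c" "(81::int) ^ c \<le> 4096 ^ c" by (auto intro: power_mono)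
    then show "(16::int) ^ c \<le> int n" "(81::int) ^ c \<le> int n" using 1 by linarith+
  qed
  have Sint: "(16::int) ^ d = int S" "(81::int) ^ d = 2 * int VI + 1"
  proof -
    show "(16::int) ^ d = int S" by (simp add: S_def)
    have "int (2 * VI + 1) = int (81 ^ d)" using VI_eq by (simp add: power_mult)
    then show "(81::int) ^ d = 2 * int VI + 1" by simp
  qed
  have dn': "int d \<le> int n" using S_le_n d_le_S by linarith
  have "wp b (While (Mul (Vr 3) (C 4096)) (Add (Vr 0) (C 1))
     Params_step) ?W ?s1 t0" if t0: "t0 \<le> t + 15" for t0
  proof (rule wp_While_measure[where k = d and I = ?I])
    show "?I d ?s1 t0" using s t0 by (intro exI[of _ 0]) simp
    fix k t' and s' :: st
    assume "?I k s' t'"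
    then obtain c where c: "k = d - c" "c \<le> d" "iv s' 0 = int n" "iv s' 2 = int c" "iv s' 3 = 4096 ^ c" "iv s' 4 = 16 ^ c"
     "2 * iv s' 5 + 1 = 81 ^ c" "rm s' = rm s" "t' \<le> t + 15 + 60 * c" by blast
    note bd = pw[OF c(2)]
    have test: "iv s' 3 * 4096 < int n + 1 \<longleftrightarrow> c < d"
    proof -
      have "iv s' 3 * 4096 < int n + 1 \<longleftrightarrow> int (4096 ^ Suc c) < int n + 1" using c by (simp add: mult.commute)
      also have "\<dots> \<longleftrightarrow> 4096 ^ Suc c \<le> n" by linarith
      also have "\<dots> \<longleftrightarrow> c < d"
      proof
        assume "4096 ^ Suc c \<le> n"
        then have "(4096::nat) ^ Suc c < 4096 ^ Suc d" using nd by linarith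
        then show "c < d" by (simp add: power_less_imp_less_exp)
      next
        assume "c < d"
        then have "(4096::nat) ^ Suc c \<le> 4096 ^ d" by (intro power_increasing) auto
        then show "4096 ^ Suc c \<le> n" using dn by linarith
      qed
      finally show ?thesis .
    qed
    show "in_range b (Mul (Vr 3) (C 4096)) s' \<and> in_range b (Add (Vr 0) (C 1)) s' \<and>
       (aval (Mul (Vr 3) (C 4096)) s' < aval (Add (Vr 0) (C 1)) s' \<longrightarrow>
        wp b Params_step (\<lambda>s'' t''. \<exists>k'<k. ?I k' s'' t'') s'
          (t' + (elen (Mul (Vr 3) (C 4096)) + elen (Add (Vr 0) (C 1)) + 2))) \<and>
       (\<not> aval (Mul (Vr 3) (C 4096)) s' < aval (Add (Vr 0) (C 1)) s' \<longrightarrow>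
        ?W s' (t' + (elen (Mul (Vr 3) (C 4096)) + elen (Add (Vr 0) (C 1)) + 2)))"
    proof (intro conjI impI)
      have "0 \<le> iv s' 3" using c(5) by simp
      moreover have "iv s' 3 * 4096 \<le> b" unfolding c(5) using bd(1) b_ge by linarith
      ultimately show "in_range b (Mul (Vr 3) (C 4096)) s'" using b_ge n4096 by simp
      show "in_range b (Add (Vr 0) (C 1)) s'" using c(3) b_ge n4096 by simp
    next
      assume "aval (Mul (Vr 3) (C 4096)) s' < aval (Add (Vr 0) (C 1)) s'"
      then have cd: "c < d" using test c(3) by simp
      have "(1::int) \<le> 81 ^ c" by simp
      then have v: "0 \<le> iv s' 5" "iv s' 5 \<le> int n" using c(7) bd by linarith+
      define R where "R s'' t'' \<longleftrightarrow> (\<exists>k'<k. ?I k' s'' t'')" for s'' :: st and t''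
      let ?s2 = "s'\<lparr>iv := (iv s')(3 := 4096 ^ c * 4096, 2 := int c + 1, 4 := 16 ^ c * 16, 5 := 81 * iv s' 5 + 40)\<rparr>"
      have "?I (d - Suc c) ?s2 t''" if "t'' \<le> t' + 60" for t''
        using that c cd by (intro exI[of _ "Suc c"]) auto
      moreover have "d - Suc c < k" using c(1) cd by linarith
      ultimately have ex: "R ?s2 t''" if "t'' \<le> t' + 60" for t'' unfolding R_def using that by blast
      have pos: "(0::int) \<le> 4096 ^ c" "(0::int) \<le> 16 ^ c" by simp_all
      have "int c \<le> int n" "int d \<le> int n" using c(2) dn' by linarith+
      moreover have "\<bar>4096 ^ c * 4096\<bar> \<le> b" "\<bar>16 ^ c * 16\<bar> \<le> b" using bd b_ge n4096 pos by linarith+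
      ultimately show "wp b Params_step (\<lambda>s'' t''. \<exists>k'<k. ?I k' s'' t'') s'
          (t' + (elen (Mul (Vr 3) (C 4096)) + elen (Add (Vr 0) (C 1)) + 2))"
        unfolding R_def[symmetric] using ex v b_ge n4096 by (simp add: Params_step_def c(3-6))
    next
      assume "\<not> aval (Mul (Vr 3) (C 4096)) s' < aval (Add (Vr 0) (C 1)) s'"
      then have cd: "c = d" using test c(2,3) by simp
      have i5: "iv s' 5 = int VI" using c(7) cd Sint by simp
      have i4: "iv s' 4 = int S" using c(6) cd Sint by simp
      have Sd: "int S * int d = int (S * d)" "int (S * d) \<le> int n"
        by (simp only: of_nat_mult) (simp only: of_nat_le_iff Sd_le)
      have Gi: "int n div int (S * d) = int G" by (simp only: G_def of_nat_div)
      have Gn: "int G \<le> int n" unfolding G_def by (simp add: div_le_dividend)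
      let ?s2 = "s'\<lparr>iv := (iv s')(6 := int G)\<rparr>"
      have "Q ?s2 t''" if "t'' \<le> t' + 30" for t''
        by (rule Q) (use that c cd i4 i5 in auto)
      then show "?W s' (t' + (elen (Mul (Vr 3) (C 4096)) + elen (Add (Vr 0) (C 1)) + 2))"
        using Sd Gn b_ge n4096 c(3,4) cd by (simp add: i4 Sd(1) Gi del: of_nat_mult)
    qed
  qed
  then show ?thesis unfolding Params_def using b_ge n4096 by (simp del: wp_simps(1) add: wp_simps(1)[of b 2] wp_simps(1)[of b 3] wp_simps(1)[of b 4] wp_simps(1)[of b 5])
qed

lemma wp_InitZ:
  assumes s: "iv s 0 = int n" "iv s 2 = int d" "iv s 4 = int S" "iv s 5 = int VI" "iv s 6 = int G"
    and r: "\<forall>i<n. rm s (2 * n + i) = x i \<and> rm s (3 * n + i) = y i"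
    and Q: "\<And>s' t'. \<lbrakk>layout s' (\<lambda>k. x 0 - y k); t' \<le> t + 60 * n + 60\<rbrakk> \<Longrightarrow> Q s' t'"
  shows "wp b InitZ Q s t"
proof -
  define I where "I i s' \<longleftrightarrow> (\<forall>q<7. iv s' q = iv s q) \<and> (\<forall>j<n. rm s' (2 * n + j) = x j \<and> rm s' (3 * n + j) = y j) \<and>
     (\<forall>j<i. rm s' (4 * n + j) = x 0 - y j)" for i and s' :: st
  show ?thesis unfolding InitZ_def
  proof (rule wp_For[where m = n and \<tau> = "\<lambda>_. 40" and I = I])
    show "0 < b" "int n < b" using b_ge n4096 by linarith+
    show "I 0 (s\<lparr>iv := (iv s)(7 := 0)\<rparr>)" using r by (simp add: I_def)
    show "in_range b (Vr 0) s' \<and> aval (Vr 0) s' = int n" if "I i s'" for i s' using that s by (simp add: I_def)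
    fix i and t' :: nat and s' :: st
    assume I: "I i s'" and i: "iv s' 7 = int i" "i < n"
    have iv': "iv s' 0 = int n" using I s by (simp add: I_def)
    have n0: "nat (2 * int n) = 2 * n" by simp
    have "rm s' (2 * n + 0) = x 0" using I n4096 unfolding I_def by (metis gr0I not_numeral_le_zero)
    then have r': "rm s' (2 * n) = x 0" "rm s' (3 * n + i) = y i" using I i by (auto simp: I_def)
    show "wp b (RLd 0 (Mul (C 2) (Vr 0)) ;; RLd 1 (Add (Mul (C 3) (Vr 0)) (Vr 7)) ;;
        RSb 0 0 1 ;; RSt (Add (Mul (C 4) (Vr 0)) (Vr 7)) 0)
      (loop_next 7 i (t' + 40) I) s' t'"
      using I i b_ge n4096 by (auto simp: I_def iv' nat_simps n0 r' less_Suc_eq)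
  next
    fix t' and s' :: st
    assume I: "I n s'" and t': "t' \<le> t + (\<Sum>i<n. 40) + (n + 1) * (elen (Vr 0) + 10)"
    show "Q s' t'"
    proof (rule Q)
      show "layout s' (\<lambda>k. x 0 - y k)" unfolding layout_def using I s by (auto simp: I_def)
    qed (use t' in simp)
  qed
qed

lemma wp_Output:
  assumes s: "iv s 0 = int n"
    and Q: "\<And>s' t'. \<lbrakk>\<forall>k<n. rm s' k = rm s (4 * n + k); t' \<le> t + 60 * n + 60\<rbrakk> \<Longrightarrow> Q s' t'"
  shows "wp b Output Q s t"
proof -
  define I where "I i s' \<longleftrightarrow> iv s' 0 = int n \<and> (\<forall>k<n. rm s' (4 * n + k) = rm s (4 * n + k)) \<and>
     (\<forall>k<n. n - i \<le> k \<longrightarrow> rm s' k = rm s (4 * n + k))" for i and s' :: st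
  show ?thesis unfolding Output_def
  proof (rule wp_For[where m = n and \<tau> = "\<lambda>_. 40" and I = I])
    show "0 < b" "int n < b" using b_ge n4096 by linarith+
    show "I 0 (s\<lparr>iv := (iv s)(7 := 0)\<rparr>)" using s by (simp add: I_def)
    show "in_range b (Vr 0) s' \<and> aval (Vr 0) s' = int n" if "I i s'" for i s' using that s by (simp add: I_def)
    fix i and t' :: nat and s' :: st
    assume I: "I i s'" and i: "iv s' 7 = int i" "i < n"
    obtain k where k: "n = Suc (k + i)" using i(2) by (metis less_imp_Suc_add add.commute)
    have iv': "iv s' 0 = int n" using I by (simp add: I_def)
    have ki: "int n - 1 - int i = int k" using k by simp
    have kn: "k < n" using k by simp
    have rank_of: "rm s' (4 * n + k) = rm s (4 * n + k)" using I kn unfolding I_def by blast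
    have n4: "0 < 4 * n + k" using n4096 by simp
    let ?s2 = "s'\<lparr>rm := (rm s')(0 := rm s (4 * n + k), k := rm s (4 * n + k)), iv := (iv s')(8 := int k, 7 := int i + 1)\<rparr>"
    have I2: "I (Suc i) ?s2"
      unfolding I_def
    proof (intro conjI allI impI)
      show "iv ?s2 0 = int n" using iv' by simp
      fix q assume q: "q < n"
      have "4 * n + q \<noteq> k" "4 * n + q \<noteq> 0" using k q by linarith+
      then show "rm ?s2 (4 * n + q) = rm s (4 * n + q)" using I q by (simp add: I_def)
    next
      fix q assume q: "q < n" "n - Suc i \<le> q"
      show "rm ?s2 q = rm s (4 * n + q)"
      proof (cases "q = k")
        case False
        then have "n - i \<le> q" "q \<noteq> 0" using q k by linarith+
        then show ?thesis using I q False by (simp add: I_def)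
      qed simp
    qed
    have kb: "int k \<le> int n" using k by simp
    show "wp b (Asg 8 (Sub (Sub (Vr 0) (C 1)) (Vr 7)) ;; RLd 0 (Add (Mul (C 4) (Vr 0)) (Vr 8)) ;; RSt (Vr 8) 0)
      (loop_next 7 i (t' + 40) I) s' t'"
      using I2 i kb b_ge n4096 n4 by (simp add: iv' ki nat_simps rank_of)
  next
    fix t' and s' :: st
    assume "I n s'" "t' \<le> t + (\<Sum>i<n. 40) + (n + 1) * (elen (Vr 0) + 10)"
    then show "Q s' t'" by (intro Q) (auto simp: I_def)
  qed
qed

lemma wp_Algo:
  assumes s: "iv s 0 = int n" and nd: "n < 4096 ^ Suc d"
    and r: "\<forall>i<n. rm s i * of_int \<sigma> = x i \<and> rm s (n + i) * of_int \<sigma> = y i" and \<sigma>: "\<bar>\<sigma>\<bar> \<le> 1"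
    and Q: "\<And>s' t'. \<lbrakk>\<forall>k<n. rm s' k = min_minus_conv x y k * of_int \<sigma>; d * t' \<le> 6000 * (n * n)\<rbrakk> \<Longrightarrow> Q s' t'"
  shows "wp b (Algo \<sigma>) Q s 0"
proof -
  define W7 where "W7 = wp b (Scale 4 (Vr 0)) (wp b Output Q)"
  define W6 where "W6 = wp b (RFI 1 (C \<sigma>)) W7"
  define W5 where "W5 = wp b Mainloop W6"
  define W4 where "W4 = wp b Brute W5"
  define W3 where "W3 = wp b InitZ W4"
  define W2 where "W2 = wp b Params W3"
  define W1 where "W1 = wp b (Scale 2 (Mul (C 2) (Vr 0))) W2"
  have Algo: "wp b (Algo \<sigma>) Q = wp b Copy (wp b (RFI 1 (C \<sigma>)) W1)"
    by (simp only: Algo_def wp_Seq_ext W1_def W2_def W3_def W4_def W5_def W6_def W7_def)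
  have \<sigma>b: "\<bar>\<sigma>\<bar> \<le> b" using \<sigma> b_ge n4096 by linarith
  show ?thesis unfolding Algo
  proof (rule wp_Copy[OF s])
  fix s1 :: st and t1
  assume 1: "iv s1 0 = int n" "\<forall>i<2 * n. rm s1 (2 * n + i) = rm s i" "t1 \<le> 0 + 60 * n + 60"
  let ?s1 = "s1\<lparr>rm := (rm s1)(1 := of_int \<sigma>)\<rparr>"
  have "W1 ?s1 (t1 + 2)" unfolding W1_def
  proof (rule wp_Scale[where m = "2 * n"])
    show "in_range b (Mul (C 2) (Vr 0)) s' \<and> aval (Mul (C 2) (Vr 0)) s' = int (2 * n)" if "iv s' 0 = int n" for s'
      using that b_ge n4096 by simp
    fix s2 :: st and t2
    assume 2: "\<forall>q<7. iv s2 q = iv ?s1 q" "\<forall>i<2 * n. rm s2 (2 * n + i) = rm ?s1 (2 * n + i) * rm ?s1 1" "t2 \<le> t1 + 2 + 60 * (2 * n) + 60"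
    have r2: "rm s2 (2 * n + i) = rm s i * of_int \<sigma>" if "i < 2 * n" for i
      using that 1(2) 2(2) n4096 by simp
    have r2': "\<forall>i<n. rm s2 (2 * n + i) = x i \<and> rm s2 (3 * n + i) = y i"
    proof (intro allI impI)
      fix i assume i: "i < n"
      have "2 * n + (n + i) = 3 * n + i" by simp
      then show "rm s2 (2 * n + i) = x i \<and> rm s2 (3 * n + i) = y i" using r2[of i] r2[of "n + i"] r i by auto
    qed
    have iv2: "iv s2 0 = int n" using 2(1) 1(1) by simp
    show "W2 s2 t2" unfolding W2_def
    proof (rule wp_Params[OF iv2 nd], unfold W3_def, rule wp_InitZ)
      fix s3 s4 :: st and t3 t4
      assume 3: "rm s3 = rm s2" "t3 \<le> t2 + 60 * d + 60"
      show "\<forall>i<n. rm s3 (2 * n + i) = x i \<and> rm s3 (3 * n + i) = y i" using 3(1) r2' by simp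
      assume 4: "layout s4 (\<lambda>k. x 0 - y k)" "t4 \<le> t3 + 60 * n + 60"
      show "W4 s4 t4" unfolding W4_def
      proof (rule wp_Brute[OF 4(1)], unfold W5_def, rule wp_Mainloop, assumption)
        fix s5 s6 :: st and t5 t6 z5 z6
        assume 5: "\<forall>k<n. \<forall>i<S * d. brute_covered k i z5" "t5 \<le> t4 + n * (S * d * 260 + 60) + 100"
        assume 6: "layout s6 z6" "\<forall>k<n. z6 k \<le> z5 k" "\<forall>g<G. \<forall>a<d. \<forall>j<n. covered g a j z6"
          "t6 \<le> t5 + (\<Sum>g<G. (\<Sum>a<d. tree_time + query_time g a) + (d + 1) * 12) + (G + 1) * 12"
        have bc: "\<forall>k<n. \<forall>i<S * d. brute_covered k i z6" using 5(1) brute_covered_mono[OF _ 6(2)] by blast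
        have z6: "z6 k = min_minus_conv x y k" if k: "k < n" for k
          unfolding min_minus_conv_def
        \<comment> \<open>Attainment is the last clause of \<open>layout\<close>; the lower bound
          against all candidates is \<open>all_covered\<close>.\<close>
        proof (rule Min_eqI[symmetric])
          show "z6 k \<in> (\<lambda>i. x i - y (k - i)) ` {0..k}" using 6(1) k by (force simp: layout_def)
          fix w assume "w \<in> (\<lambda>i. x i - y (k - i)) ` {0..k}"
          then show "z6 k \<le> w" using all_covered[OF 6(3) bc k] by auto
        qed simp
        have iv6: "iv s6 0 = int n" using 6(1) by (simp add: layout_def)
        let ?s6 = "s6\<lparr>rm := (rm s6)(1 := of_int \<sigma>)\<rparr>"
        have "W7 ?s6 (t6 + 2)" unfolding W7_def
        proof (rule wp_Scale[where m = n])
          fix s7 :: st and t7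
          assume 7: "\<forall>q<7. iv s7 q = iv ?s6 q" "\<forall>i<n. rm s7 (4 * n + i) = rm ?s6 (4 * n + i) * rm ?s6 1" "t7 \<le> t6 + 2 + 60 * n + 60"
          have r7: "rm s7 (4 * n + k) = min_minus_conv x y k * of_int \<sigma>" if k: "k < n" for k
          proof -
            have "rm s6 (4 * n + k) = z6 k" using 6(1) k by (simp add: layout_def)
            then show ?thesis using 7(2) k z6[OF k] n4096 by simp
          qed
          have iv7: "iv s7 0 = int n" using 7(1) iv6 by simp
          show "wp b Output Q s7 t7"
          proof (rule wp_Output[OF iv7])
            fix s8 :: st and t8
            assume 8: "\<forall>k<n. rm s8 k = rm s7 (4 * n + k)" "t8 \<le> t7 + 60 * n + 60"
            show "Q s8 t8"
            proof (rule Q)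
              show "\<forall>k<n. rm s8 k = min_minus_conv x y k * of_int \<sigma>" using 8(1) r7 by simp
              let ?M = "(\<Sum>g<G. (\<Sum>a<d. tree_time + query_time g a) + (d + 1) * 12) + (G + 1) * 12"
              have "t8 \<le> ?M + 260 * (n * (S * d)) + 480 * n + 60 * d + 600"
                using 8(2) 7(3) 6(4) 5(2) 4(2) 3(2) 2(3) 1(3) by (simp add: algebra_simps)
              then have "d * t8 \<le> d * (?M + 260 * (n * (S * d)) + 480 * n + 60 * d + 600)" by (rule mult_le_mono2)
              also have "\<dots> = d * ?M + 260 * (n * (d * (S * d))) + 480 * (d * n) + 60 * (d * d) + 600 * d" by (simp add: algebra_simps)
              finally have tt: "d * t8 \<le> d * ?M + 260 * (n * (d * (S * d))) + 480 * (d * n) + 60 * (d * d) + 600 * d" .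
              \<comment> \<open>The brute-force part takes time of order \<open>n * S * d\<close>.
                It stays within \<open>n^2 / d\<close> because
                \<open>d * S * d \<le> (2 * 16 * 2)^d = 64^d \<le> n\<close>.\<close>
              have "d * (S * d) \<le> 2 ^ d * (16 ^ d * 2 ^ d)" unfolding S_def using d_less by (intro mult_mono) auto
              also have "\<dots> = 64 ^ d" by (simp flip: power_mult_distrib)
              also have "\<dots> \<le> 4096 ^ d" by (intro power_mono) auto
              also have "\<dots> \<le> n" by (rule dn)
              finally have "n * (d * (S * d)) \<le> n * n" by (rule mult_le_mono2)
              moreover have dn': "d \<le> n" using S_le_n d_le_S by linarith
              then have "d * n \<le> n * n" "d * d \<le> n * n" by (auto intro: mult_le_mono)
              moreover have "d * 1 \<le> n * n" using dn' n4096 by (intro mult_le_mono) auto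
              ultimately show "d * t8 \<le> 6000 * (n * n)" using tt main_time by linarith
            qed
          qed
        qed (use iv6 in auto)
        then show "W6 s6 t6" unfolding W6_def using \<sigma>b by simp
      qed
    qed auto
  qed (use 1 in auto)
  then show "wp b (RFI 1 (C \<sigma>)) W1 s1 t1" using \<sigma>b by simp
  qed
qed

end

section \<open>The machine program and its resource bounds\<close>

lemma wf_Algo: "wf_com (Algo \<sigma>)"
  by (simp add: Algo_def Copy_def Scale_def Params_def Params_step_def InitZ_def Output_def Brute_def Mainloop_def For_def Root_def
    Build_def Split_def Rank_def Compare_def Distribute_def Place_def Key_def Queries_def Query_def Visit_def Branch_def Good_def Report_def Upd_def)

text \<open>The constant is \<open>24 * 6000\<close>: maximality of \<open>d\<close> gives
  \<open>lg n \<le> 12 * (d + 1) \<le> 24 * d\<close>, and the program satisfies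
  \<open>d * t \<le> 6000 * n^2\<close>. The threshold 4096 guarantees \<open>d \<ge> 1\<close>, and
  the register bound \<open>8 * n^2 + 71\<close> is below \<open>(n + 2)^4\<close>. The hypothesis
  on \<open>\<sigma>\<close> admits exactly the two signs needed for minimum and maximum.\<close>

lemma Algo_run:
  assumes n: "4096 \<le> n" and \<sigma>: "\<sigma> * \<sigma> = 1"
  shows "\<exists>t. real t \<le> 144000 * real n ^ 2 / log 2 (real n) \<and>
    halted (comp 0 (Algo \<sigma>)) (run (comp 0 (Algo \<sigma>)) t (init n x y)) \<and>
    (\<forall>k<n. rr (run (comp 0 (Algo \<sigma>)) t (init n x y)) k
       = min_minus_conv (\<lambda>i. x i * of_int \<sigma>) (\<lambda>i. y i * of_int \<sigma>) k * of_int \<sigma>) \<and>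
    (\<forall>s\<le>t. \<forall>r. \<bar>ir (run (comp 0 (Algo \<sigma>)) s (init n x y)) r\<bar> \<le> (int n + 2) ^ 4)"
proof -
  let ?P = "comp 0 (Algo \<sigma>)" and ?c = "init n x y"
  obtain d where d: "4096 ^ d \<le> n" "n < 4096 ^ (d + 1)"
    using ex_power_ivl1[of 4096 n] n by auto
  have d1: "1 \<le> d"
  proof (rule ccontr)
    assume "\<not> 1 \<le> d"
    then have "d = 0" by simp
    then show False using d(2) n by simp
  qed
  define x' y' where "x' = (\<lambda>i. x i * of_int \<sigma>)" and "y' = (\<lambda>i. y i * of_int \<sigma>)"
  interpret conv n d x' y' by unfold_locales (use d d1 in auto)
  define s :: st where "s = \<lparr>iv = ir ?c, ia = (\<lambda>_ _. 0), rm = rr ?c\<rparr>"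
  have "wp b (Algo \<sigma>) (\<lambda>s' t'. (\<forall>k<n. rm s' k = min_minus_conv x' y' k * of_int \<sigma>) \<and> d * t' \<le> 6000 * (n * n)) s 0"
  proof (rule wp_Algo)
    show "iv s 0 = int n" by (simp add: s_def init_def)
    show "n < 4096 ^ Suc d" using d by simp
    show "\<forall>i<n. rm s i * of_int \<sigma> = x' i \<and> rm s (n + i) * of_int \<sigma> = y' i"
      by (simp add: s_def init_def x'_def y'_def)
    show "\<bar>\<sigma>\<bar> \<le> 1" using \<sigma> by (auto simp: zmult_eq_1_iff)
  qed auto
  then obtain t s' where t: "big_step b (Algo \<sigma>) s t s'" "\<forall>k<n. rm s' k = min_minus_conv x' y' k * of_int \<sigma>" "d * t \<le> 6000 * (n * n)"
    unfolding wp_def by auto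
  let ?B = "8 * b + 71"
  have b0: "0 \<le> b" "int n \<le> b" using b_ge n4096 by linarith+
  have "codeat ?P 0 ?P" unfolding codeat_def by (intro exI[of _ "[]"]) simp
  moreover have "pc ?c = 0" by (simp add: init_def)
  moreover have "sim s ?c" by (auto simp: sim_def s_def init_def)
  moreover have "regs_bounded ?B ?c" using b0 by (auto simp: regs_bounded_def init_def)
  moreover have "vals_bounded b s" using b0 by (auto simp: vals_bounded_def s_def init_def)
  ultimately obtain c' where c': "reach ?P ?B ?c t c'" "sim s' c'" "pc c' = 0 + com_len (Algo \<sigma>)"
    using comp_correct[OF t(1), of ?P 0 ?c ?B] wf_Algo b0 by blast
  have run: "run ?P t ?c = c'" "\<And>i. i \<le> t \<Longrightarrow> regs_bounded ?B (run ?P i ?c)" using c'(1) by (auto simp: reach_def)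
  have Bn: "?B \<le> (int n + 2) ^ 4"
  proof -
    have n4: "4096 * 4096 \<le> int n * int n" using n by (intro mult_mono) auto
    then have "?B \<le> 9 * (int n * int n)" unfolding b_def by linarith
    also have "\<dots> \<le> (int n * int n) * (int n * int n)" using n4 by (intro mult_right_mono) auto
    also have "\<dots> = int n ^ 4" by (simp add: power4_eq_xxxx)
    also have "\<dots> \<le> (int n + 2) ^ 4" by (intro power_mono) auto
    finally show ?thesis .
  qed
  have time: "real t \<le> 144000 * real n ^ 2 / log 2 (real n)"
  proof -
    have lpos: "0 < log 2 (real n)" using n by simp
    have "real n \<le> 4096 ^ (d + 1)" using d(2) by (metis less_imp_le of_nat_le_iff of_nat_numeral of_nat_power)
    then have "log 2 (real n) \<le> log 2 (4096 ^ (d + 1))" using n by (subst log_le_cancel_iff) auto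
    also have "\<dots> = real (d + 1) * log 2 4096" by (rule log_nat_power) simp
    also have "log 2 4096 = (12::real)" using log_pow_cancel[of 2 12] by simp
    also have "real (d + 1) * 12 \<le> 24 * real d" using d1 by simp
    finally have "real t * log 2 (real n) \<le> real t * (24 * real d)" by (intro mult_left_mono) auto
    also have "\<dots> = 24 * real (d * t)" by simp
    also have "\<dots> \<le> 24 * real (6000 * (n * n))" using t(3) by (intro mult_left_mono) (simp_all only: of_nat_le_iff)
    finally show ?thesis using lpos by (simp add: pos_le_divide_eq power2_eq_square)
  qed
  have "halted ?P (run ?P t ?c)" using c'(3) by (simp add: run(1) halted_def)
  moreover have "\<forall>k<n. rr (run ?P t ?c) k = min_minus_conv x' y' k * of_int \<sigma>" using c'(2) t(2) by (simp add: run(1) sim_def)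
  moreover have "\<forall>s\<le>t. \<forall>r. \<bar>ir (run ?P s ?c) r\<bar> \<le> (int n + 2) ^ 4" using run(2) Bn by (meson regs_bounded_def order_trans)
  ultimately show ?thesis using time unfolding x'_def y'_def by blast
qed

lemma max_minus_conv_eq: "max_minus_conv x y k = - min_minus_conv (\<lambda>i. - x i) (\<lambda>i. - y i) k"
  unfolding max_minus_conv_def
proof (rule Max_eqI)
  let ?m = "min_minus_conv (\<lambda>i. - x i) (\<lambda>i. - y i) k"
  have "?m \<in> (\<lambda>i. - x i - - y (k - i)) ` {0..k}" unfolding min_minus_conv_def by (rule Min_in) auto
  then show "- ?m \<in> (\<lambda>i. x i - y (k - i)) ` {0..k}" by force
  fix w assume "w \<in> (\<lambda>i. x i - y (k - i)) ` {0..k}"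
  then obtain i where i: "i \<in> {0..k}" "w = x i - y (k - i)" by blast
  have "?m \<le> - x i - - y (k - i)" unfolding min_minus_conv_def using i(1) by (intro Min_le) auto
  then show "w \<le> - ?m" using i by simp
qed simp

theorem theorem6:
  shows "(\<exists>P. computes_in_n2_over_lg P min_minus_conv) \<and>
         (\<exists>P. computes_in_n2_over_lg P max_minus_conv)"
proof
  have "computes_in_n2_over_lg (comp 0 (Algo 1)) min_minus_conv"
    unfolding computes_in_n2_over_lg_def
    using Algo_run[of _ 1] by (intro exI[of _ 4096] exI[of _ 144000] exI[of _ 4]) simp
  then show "\<exists>P. computes_in_n2_over_lg P min_minus_conv" ..
  have "computes_in_n2_over_lg (comp 0 (Algo (- 1))) max_minus_conv"
    unfolding computes_in_n2_over_lg_def max_minus_conv_eq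
    using Algo_run[of _ "- 1"] by (intro exI[of _ 4096] exI[of _ 144000] exI[of _ 4]) simp
  then show "\<exists>P. computes_in_n2_over_lg P max_minus_conv" ..
qed

end
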